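(* The theory $\mathbb{F}in\mathbb{R}ank$ of local MV-algebras of finite rank is not of presheaf type, i.e. its classifying topos is not equivalent to any topos of presheaves on a small category.
   Context: An MV-algebra is a structure $(A,\oplus,\neg,0)$ such that $(A,\oplus,0)$ is a commutative monoid, $\neg\neg x=x$, $x\oplus\neg 0=\neg 0$ and $\neg(\neg x\oplus y)\oplus y=\neg(\neg y\oplus x)\oplus x$. Write $1=\neg 0$, $x\le y$ iff $\neg x\oplus y=1$, $kx=x\oplus\cdots\oplus x$ ($k$ times). An MV-algebra is local if it is non-trivial and for every $x$ there is $k\ge 1$ with $kx=1$ or $k(\neg x)=1$. The radical $\mathrm{Rad}(A)$ is the intersection of all maximal ideals of $A$; equivalently, the set of $x$ with $kx\le\neg x$ for all $k\in\mathbb{N}$. $S_n=\Gamma(\mathbb{Z},n)$ is the MV-algebra on $\{0,1,\dots,n\}$ with $x\oplus y=\min(x+y,n)$ and $\neg x=n-x$. A local MV-algebra $A$ is of rank $n$ ($n$ a positive integer) if $A/\mathrm{Rad}(A)\cong S_n$, and of finite rank if it is of rank $n$ for some $n$. A geometric formula is a first-order formula built from atomic formulae using finitary conjunctions, existential quantifications and arbitrary disjunctions; a geometric sequent is $(\phi\vdash_{\vec x}\psi)$ with $\phi,\psi$ geometric. $\mathbb{F}in\mathbb{R}ank$ is the geometric theory consisting of all geometric sequents over the signature of MV-algebras which are satisfied in every local MV-algebra of finite rank. *)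

theory Defs
  imports Complex_Main "HOL-Library.FuncSet" "HOL-Library.Equipollence"
begin

section \<open>Small sets\<close>

text \<open>
  A set is small if it belongs to a fixed universe \<open>\<U>\<close> of subsets of a type \<open>'u\<close>; sets are only
  considered up to bijection.  A Grothendieck universe of cardinality \<open>|'u|\<close> (take \<open>\<U>\<close> to be the
  sets of smaller cardinality) satisfies these axioms.  Closure under powersets is not required
  beyond the existence of a small set of size at least the continuum, so that the axioms also have
  instances that exist in plain HOL, such as the one below.
\<close>

locale set_universe =
  fixes \<U> :: "'u set set"
  assumes small_subset: "S \<in> \<U> \<Longrightarrow> R \<subseteq> S \<Longrightarrow> R \<in> \<U>"
    and small_image: "S \<in> \<U> \<Longrightarrow> (f :: 'u \<Rightarrow> 'u) ` S \<in> \<U>"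
    and small_Times: "S \<in> \<U> \<Longrightarrow> R \<in> \<U> \<Longrightarrow> \<exists>Q\<in>\<U>. Q \<approx> S \<times> R"
    and small_UN: "I \<in> \<U> \<Longrightarrow> (\<And>i. i \<in> I \<Longrightarrow> A i \<in> \<U>) \<Longrightarrow> (\<Union>i\<in>I. A i) \<in> \<U>"
    and small_continuum: "\<exists>S\<in>\<U>. (UNIV :: nat set set) \<lesssim> S"

lemma set_universe_UNIV: "set_universe (UNIV :: nat set set set)"
proof
  fix S R :: "nat set set"
  define code :: "nat set \<times> nat set \<Rightarrow> nat set"
    where "code = (\<lambda>(a, b). (\<lambda>i. 2 * i) ` a \<union> (\<lambda>i. Suc (2 * i)) ` b)"
  have "{i. 2 * i \<in> code (a, b)} = a" "{i. Suc (2 * i) \<in> code (a, b)} = b" for a b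
    unfolding code_def by (auto, presburger+)
  then have "inj code"
    by (intro injI) (metis surj_pair)
  then have "code ` (S \<times> R) \<approx> S \<times> R"
    by (meson eqpoll_sym inj_on_image_eqpoll_self inj_on_subset subset_UNIV)
  then show "\<exists>Q\<in>(UNIV :: nat set set set). Q \<approx> S \<times> R"
    by (intro bexI[of _ "code ` (S \<times> R)"]) auto
qed (auto intro: bexI[of _ UNIV])


section \<open>MV-algebras\<close>

record 'a mv =
  mcarrier :: "'a set"
  mplus :: "'a \<Rightarrow> 'a \<Rightarrow> 'a"
  mneg :: "'a \<Rightarrow> 'a"
  mzero :: 'a

definition mone :: "'a mv \<Rightarrow> 'a" where
  "mone A = mneg A (mzero A)"

definition mv_algebra :: "'a mv \<Rightarrow> bool" where
  "mv_algebra A \<longleftrightarrow>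
     mzero A \<in> mcarrier A \<and>
     (\<forall>x\<in>mcarrier A. mneg A x \<in> mcarrier A) \<and>
     (\<forall>x\<in>mcarrier A. \<forall>y\<in>mcarrier A. mplus A x y \<in> mcarrier A) \<and>
     (\<forall>x\<in>mcarrier A. \<forall>y\<in>mcarrier A. \<forall>z\<in>mcarrier A.
        mplus A (mplus A x y) z = mplus A x (mplus A y z)) \<and>
     (\<forall>x\<in>mcarrier A. \<forall>y\<in>mcarrier A. mplus A x y = mplus A y x) \<and>
     (\<forall>x\<in>mcarrier A. mplus A x (mzero A) = x) \<and>
     (\<forall>x\<in>mcarrier A. mneg A (mneg A x) = x) \<and>
     (\<forall>x\<in>mcarrier A. mplus A x (mneg A (mzero A)) = mneg A (mzero A)) \<and>
     (\<forall>x\<in>mcarrier A. \<forall>y\<in>mcarrier A.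
        mplus A (mneg A (mplus A (mneg A x) y)) y = mplus A (mneg A (mplus A (mneg A y) x)) x)"

definition mle :: "'a mv \<Rightarrow> 'a \<Rightarrow> 'a \<Rightarrow> bool" where
  "mle A x y \<longleftrightarrow> mplus A (mneg A x) y = mone A"

primrec mmult :: "'a mv \<Rightarrow> nat \<Rightarrow> 'a \<Rightarrow> 'a" where
  "mmult A 0 x = mzero A"
| "mmult A (Suc k) x = mplus A x (mmult A k x)"

definition mv_local :: "'a mv \<Rightarrow> bool" where
  "mv_local A \<longleftrightarrow> mv_algebra A \<and> mzero A \<noteq> mone A \<and>
     (\<forall>x\<in>mcarrier A. \<exists>k\<ge>1. mmult A k x = mone A \<or> mmult A k (mneg A x) = mone A)"

definition mv_ideal :: "'a mv \<Rightarrow> 'a set \<Rightarrow> bool" where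
  "mv_ideal A I \<longleftrightarrow> I \<subseteq> mcarrier A \<and> mzero A \<in> I \<and>
     (\<forall>x\<in>I. \<forall>y\<in>I. mplus A x y \<in> I) \<and>
     (\<forall>x\<in>I. \<forall>y\<in>mcarrier A. mle A y x \<longrightarrow> y \<in> I)"

definition mv_maximal_ideal :: "'a mv \<Rightarrow> 'a set \<Rightarrow> bool" where
  "mv_maximal_ideal A I \<longleftrightarrow> mv_ideal A I \<and> I \<noteq> mcarrier A \<and>
     (\<forall>J. mv_ideal A J \<and> I \<subseteq> J \<and> J \<noteq> mcarrier A \<longrightarrow> J = I)"

definition mv_radical :: "'a mv \<Rightarrow> 'a set" where
  "mv_radical A = {x \<in> mcarrier A. \<forall>I. mv_maximal_ideal A I \<longrightarrow> x \<in> I}"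

text \<open>Congruence modulo an ideal: both truncated differences
  \<open>x \<ominus> y = \<not>(\<not>x \<oplus> y)\<close> and \<open>y \<ominus> x\<close> lie in the ideal.\<close>

definition mv_cong :: "'a mv \<Rightarrow> 'a set \<Rightarrow> ('a \<times> 'a) set" where
  "mv_cong A I = {(x, y). x \<in> mcarrier A \<and> y \<in> mcarrier A \<and>
     mplus A (mneg A (mplus A (mneg A x) y)) (mneg A (mplus A (mneg A y) x)) \<in> I}"

definition mv_quotient :: "'a mv \<Rightarrow> 'a set \<Rightarrow> 'a set mv" where
  "mv_quotient A I =
     \<lparr>mcarrier = mcarrier A // mv_cong A I,
      mplus = (\<lambda>X Y. \<Union>x\<in>X. \<Union>y\<in>Y. mv_cong A I `` {mplus A x y}),
      mneg = (\<lambda>X. \<Union>x\<in>X. mv_cong A I `` {mneg A x}),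
      mzero = mv_cong A I `` {mzero A}\<rparr>"

definition mv_isomorphic :: "'a mv \<Rightarrow> 'b mv \<Rightarrow> bool" where
  "mv_isomorphic A B \<longleftrightarrow>
     (\<exists>h. bij_betw h (mcarrier A) (mcarrier B) \<and> h (mzero A) = mzero B \<and>
        (\<forall>x\<in>mcarrier A. h (mneg A x) = mneg B (h x)) \<and>
        (\<forall>x\<in>mcarrier A. \<forall>y\<in>mcarrier A. h (mplus A x y) = mplus B (h x) (h y)))"

definition mv_S :: "nat \<Rightarrow> nat mv" where
  "mv_S n = \<lparr>mcarrier = {0..n}, mplus = (\<lambda>x y. min (x + y) n), mneg = (\<lambda>x. n - x), mzero = 0\<rparr>"

definition mv_local_of_rank :: "'a mv \<Rightarrow> nat \<Rightarrow> bool" where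
  "mv_local_of_rank A n \<longleftrightarrow>
     mv_local A \<and> n \<ge> 1 \<and> mv_isomorphic (mv_quotient A (mv_radical A)) (mv_S n)"

definition mv_local_of_finite_rank :: "'a mv \<Rightarrow> bool" where
  "mv_local_of_finite_rank A \<longleftrightarrow> (\<exists>n. mv_local_of_rank A n)"


section \<open>Geometric logic over the signature of MV-algebras\<close>

text \<open>
  Variables are de Bruijn indices: \<^term>\<open>FEx \<phi>\<close> binds index 0 of \<open>\<phi>\<close>.
  A context is a number \<open>n\<close>, standing for the variables with indices \<open>0, \<dots>, n - 1\<close>, so that
  formulas-in-context are taken up to renaming of variables.
  \<^term>\<open>FOr K F\<close> is the disjunction of the \<open>F k\<close> with \<open>k \<in> K\<close>, where \<open>K\<close> is a small set
  (possibly empty); this is enforced by well-formedness.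
\<close>

datatype mv_term = TVar nat | TZero | TNeg mv_term | TPlus mv_term mv_term

datatype 'u gform =
    FEq mv_term mv_term
  | FTop
  | FAnd "'u gform" "'u gform"
  | FEx "'u gform"
  | FOr "'u set" "'u \<Rightarrow> 'u gform"

primrec twf :: "nat \<Rightarrow> mv_term \<Rightarrow> bool" where
  "twf n (TVar i) \<longleftrightarrow> i < n"
| "twf n TZero \<longleftrightarrow> True"
| "twf n (TNeg t) \<longleftrightarrow> twf n t"
| "twf n (TPlus s t) \<longleftrightarrow> twf n s \<and> twf n t"

primrec fwf :: "'u set set \<Rightarrow> 'u gform \<Rightarrow> nat \<Rightarrow> bool" where
  "fwf \<U> (FEq s t) = (\<lambda>n. twf n s \<and> twf n t)"
| "fwf \<U> FTop = (\<lambda>n. True)"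
| "fwf \<U> (FAnd \<phi> \<psi>) = (\<lambda>n. fwf \<U> \<phi> n \<and> fwf \<U> \<psi> n)"
| "fwf \<U> (FEx \<phi>) = (\<lambda>n. fwf \<U> \<phi> (Suc n))"
| "fwf \<U> (FOr K F) = (\<lambda>n. K \<in> \<U> \<and> (\<forall>k\<in>K. fwf \<U> (F k) n))"

primrec tsubst :: "(nat \<Rightarrow> mv_term) \<Rightarrow> mv_term \<Rightarrow> mv_term" where
  "tsubst \<sigma> (TVar i) = \<sigma> i"
| "tsubst \<sigma> TZero = TZero"
| "tsubst \<sigma> (TNeg t) = TNeg (tsubst \<sigma> t)"
| "tsubst \<sigma> (TPlus s t) = TPlus (tsubst \<sigma> s) (tsubst \<sigma> t)"

primrec fsubst :: "'u gform \<Rightarrow> (nat \<Rightarrow> mv_term) \<Rightarrow> 'u gform" where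
  "fsubst (FEq s t) = (\<lambda>\<sigma>. FEq (tsubst \<sigma> s) (tsubst \<sigma> t))"
| "fsubst FTop = (\<lambda>\<sigma>. FTop)"
| "fsubst (FAnd \<phi> \<psi>) = (\<lambda>\<sigma>. FAnd (fsubst \<phi> \<sigma>) (fsubst \<psi> \<sigma>))"
| "fsubst (FEx \<phi>) =
     (\<lambda>\<sigma>. FEx (fsubst \<phi> (case_nat (TVar 0) (\<lambda>i. tsubst (\<lambda>j. TVar (Suc j)) (\<sigma> i)))))"
| "fsubst (FOr K F) = (\<lambda>\<sigma>. FOr K (\<lambda>k. fsubst (F k) \<sigma>))"

definition fren :: "(nat \<Rightarrow> nat) \<Rightarrow> 'u gform \<Rightarrow> 'u gform" where
  "fren \<rho> \<phi> = fsubst \<phi> (\<lambda>i. TVar (\<rho> i))"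

primrec teval :: "'a mv \<Rightarrow> (nat \<Rightarrow> 'a) \<Rightarrow> mv_term \<Rightarrow> 'a" where
  "teval A e (TVar i) = e i"
| "teval A e TZero = mzero A"
| "teval A e (TNeg t) = mneg A (teval A e t)"
| "teval A e (TPlus s t) = mplus A (teval A e s) (teval A e t)"

primrec fsat :: "'a mv \<Rightarrow> 'u gform \<Rightarrow> (nat \<Rightarrow> 'a) \<Rightarrow> bool" where
  "fsat A (FEq s t) = (\<lambda>e. teval A e s = teval A e t)"
| "fsat A FTop = (\<lambda>e. True)"
| "fsat A (FAnd \<phi> \<psi>) = (\<lambda>e. fsat A \<phi> e \<and> fsat A \<psi> e)"
| "fsat A (FEx \<phi>) = (\<lambda>e. \<exists>a\<in>mcarrier A. fsat A \<phi> (case_nat a e))"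
| "fsat A (FOr K F) = (\<lambda>e. \<exists>k\<in>K. fsat A (F k) e)"

text \<open>The triple \<open>(n, \<phi>, \<psi>)\<close> is the sequent \<open>\<phi> \<turnstile>\<^sub>n \<psi>\<close>.\<close>

type_synonym 'u sequent = "nat \<times> 'u gform \<times> 'u gform"

definition seq_sat :: "'a mv \<Rightarrow> 'u sequent \<Rightarrow> bool" where
  "seq_sat A = (\<lambda>(n, \<phi>, \<psi>). \<forall>e. (\<forall>i<n. e i \<in> mcarrier A) \<longrightarrow> fsat A \<phi> e \<longrightarrow> fsat A \<psi> e)"

definition FinRank :: "'u set set \<Rightarrow> 'u sequent set" where
  "FinRank \<U> = {(n, \<phi>, \<psi>). fwf \<U> \<phi> n \<and> fwf \<U> \<psi> n \<and>
     (\<forall>A :: 'u mv. mcarrier A \<in> \<U> \<longrightarrow> mv_local_of_finite_rank A \<longrightarrow> seq_sat A (n, \<phi>, \<psi>))}"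

text \<open>Derivability in (infinitary) geometric logic from the axioms \<open>T\<close>.\<close>

inductive prov :: "'u set set \<Rightarrow> 'u sequent set \<Rightarrow> nat \<Rightarrow> 'u gform \<Rightarrow> 'u gform \<Rightarrow> bool"
  for \<U> :: "'u set set" and T :: "'u sequent set" where
  axiom: "(n, \<phi>, \<psi>) \<in> T \<Longrightarrow> fwf \<U> \<phi> n \<Longrightarrow> fwf \<U> \<psi> n \<Longrightarrow> prov \<U> T n \<phi> \<psi>"
| ident: "fwf \<U> \<phi> n \<Longrightarrow> prov \<U> T n \<phi> \<phi>"
| cut: "prov \<U> T n \<phi> \<psi> \<Longrightarrow> prov \<U> T n \<psi> \<chi> \<Longrightarrow> prov \<U> T n \<phi> \<chi>"
| subst: "prov \<U> T n \<phi> \<psi> \<Longrightarrow> (\<And>i. i < n \<Longrightarrow> twf m (\<sigma> i)) \<Longrightarrow>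
    prov \<U> T m (fsubst \<phi> \<sigma>) (fsubst \<psi> \<sigma>)"
| eq_refl: "twf n t \<Longrightarrow> prov \<U> T n FTop (FEq t t)"
| eq_subst: "twf n s \<Longrightarrow> twf n t \<Longrightarrow> fwf \<U> \<phi> (Suc n) \<Longrightarrow>
    prov \<U> T n (FAnd (FEq s t) (fsubst \<phi> (case_nat s TVar))) (fsubst \<phi> (case_nat t TVar))"
| top: "fwf \<U> \<phi> n \<Longrightarrow> prov \<U> T n \<phi> FTop"
| and1: "fwf \<U> \<phi> n \<Longrightarrow> fwf \<U> \<psi> n \<Longrightarrow> prov \<U> T n (FAnd \<phi> \<psi>) \<phi>"
| and2: "fwf \<U> \<phi> n \<Longrightarrow> fwf \<U> \<psi> n \<Longrightarrow> prov \<U> T n (FAnd \<phi> \<psi>) \<psi>"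
| andI: "prov \<U> T n \<phi> \<psi> \<Longrightarrow> prov \<U> T n \<phi> \<chi> \<Longrightarrow> prov \<U> T n \<phi> (FAnd \<psi> \<chi>)"
| orI: "fwf \<U> (FOr K F) n \<Longrightarrow> k \<in> K \<Longrightarrow> prov \<U> T n (F k) (FOr K F)"
| orE: "fwf \<U> (FOr K F) n \<Longrightarrow> fwf \<U> \<psi> n \<Longrightarrow> (\<And>k. k \<in> K \<Longrightarrow> prov \<U> T n (F k) \<psi>) \<Longrightarrow>
    prov \<U> T n (FOr K F) \<psi>"
| exE: "fwf \<U> \<psi> n \<Longrightarrow> prov \<U> T (Suc n) \<phi> (fren Suc \<psi>) \<Longrightarrow> prov \<U> T n (FEx \<phi>) \<psi>"
| exI: "fwf \<U> \<phi> (Suc n) \<Longrightarrow> fwf \<U> \<psi> n \<Longrightarrow> prov \<U> T n (FEx \<phi>) \<psi> \<Longrightarrow>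
    prov \<U> T (Suc n) \<phi> (fren Suc \<psi>)"
| distrib: "fwf \<U> \<phi> n \<Longrightarrow> fwf \<U> (FOr K F) n \<Longrightarrow>
    prov \<U> T n (FAnd \<phi> (FOr K F)) (FOr K (\<lambda>k. FAnd \<phi> (F k)))"
| frobenius: "fwf \<U> \<phi> n \<Longrightarrow> fwf \<U> \<psi> (Suc n) \<Longrightarrow>
    prov \<U> T n (FAnd \<phi> (FEx \<psi>)) (FEx (FAnd (fren Suc \<phi>) \<psi>))"


section \<open>Categories\<close>

record ('o, 'm) cat =
  cobj :: "'o set"
  carr :: "'m set"
  cdom :: "'m \<Rightarrow> 'o"
  ccod :: "'m \<Rightarrow> 'o"
  cid :: "'o \<Rightarrow> 'm"
  ccomp :: "'m \<Rightarrow> 'm \<Rightarrow> 'm"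

text \<open>\<open>ccomp C g f\<close> is the composite \<open>g \<circ> f\<close>.\<close>

definition category :: "('o, 'm) cat \<Rightarrow> bool" where
  "category C \<longleftrightarrow>
     (\<forall>f\<in>carr C. cdom C f \<in> cobj C \<and> ccod C f \<in> cobj C) \<and>
     (\<forall>X\<in>cobj C. cid C X \<in> carr C \<and> cdom C (cid C X) = X \<and> ccod C (cid C X) = X) \<and>
     (\<forall>f\<in>carr C. \<forall>g\<in>carr C. ccod C f = cdom C g \<longrightarrow>
        ccomp C g f \<in> carr C \<and> cdom C (ccomp C g f) = cdom C f \<and>
        ccod C (ccomp C g f) = ccod C g) \<and>
     (\<forall>f\<in>carr C. ccomp C f (cid C (cdom C f)) = f \<and> ccomp C (cid C (ccod C f)) f = f) \<and>
     (\<forall>f\<in>carr C. \<forall>g\<in>carr C. \<forall>h\<in>carr C. ccod C f = cdom C g \<and> ccod C g = cdom C h \<longrightarrow>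
        ccomp C h (ccomp C g f) = ccomp C (ccomp C h g) f)"

definition is_functor ::
  "('o, 'm) cat \<Rightarrow> ('p, 'n) cat \<Rightarrow> ('o \<Rightarrow> 'p) \<Rightarrow> ('m \<Rightarrow> 'n) \<Rightarrow> bool" where
  "is_functor C D Fo Fa \<longleftrightarrow>
     (\<forall>X\<in>cobj C. Fo X \<in> cobj D) \<and>
     (\<forall>f\<in>carr C. Fa f \<in> carr D \<and> cdom D (Fa f) = Fo (cdom C f) \<and> ccod D (Fa f) = Fo (ccod C f)) \<and>
     (\<forall>X\<in>cobj C. Fa (cid C X) = cid D (Fo X)) \<and>
     (\<forall>f\<in>carr C. \<forall>g\<in>carr C. ccod C f = cdom C g \<longrightarrow>
        Fa (ccomp C g f) = ccomp D (Fa g) (Fa f))"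

definition is_iso :: "('o, 'm) cat \<Rightarrow> 'm \<Rightarrow> bool" where
  "is_iso C f \<longleftrightarrow> f \<in> carr C \<and>
     (\<exists>g\<in>carr C. cdom C g = ccod C f \<and> ccod C g = cdom C f \<and>
        ccomp C g f = cid C (cdom C f) \<and> ccomp C f g = cid C (ccod C f))"

definition nat_isomorphic ::
  "('o, 'm) cat \<Rightarrow> ('p, 'n) cat \<Rightarrow> ('o \<Rightarrow> 'p) \<Rightarrow> ('m \<Rightarrow> 'n) \<Rightarrow> ('o \<Rightarrow> 'p) \<Rightarrow> ('m \<Rightarrow> 'n) \<Rightarrow> bool" where
  "nat_isomorphic C D Fo Fa Go Ga \<longleftrightarrow>
     (\<exists>\<eta>. (\<forall>X\<in>cobj C. is_iso D (\<eta> X) \<and> cdom D (\<eta> X) = Fo X \<and> ccod D (\<eta> X) = Go X) \<and>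
        (\<forall>f\<in>carr C. ccomp D (Ga f) (\<eta> (cdom C f)) = ccomp D (\<eta> (ccod C f)) (Fa f)))"

definition equivalent_cats :: "('o, 'm) cat \<Rightarrow> ('p, 'n) cat \<Rightarrow> bool" where
  "equivalent_cats C D \<longleftrightarrow>
     (\<exists>Fo Fa Go Ga. is_functor C D Fo Fa \<and> is_functor D C Go Ga \<and>
        nat_isomorphic C C id id (Go \<circ> Fo) (Ga \<circ> Fa) \<and>
        nat_isomorphic D D (Fo \<circ> Go) (Fa \<circ> Ga) id id)"

definition full_subcat :: "'o set \<Rightarrow> ('o, 'm) cat \<Rightarrow> ('o, 'm) cat" where
  "full_subcat X C =
     C\<lparr>cobj := cobj C \<inter> X, carr := {f \<in> carr C. cdom C f \<in> X \<and> ccod C f \<in> X}\<rparr>"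


section \<open>Presheaves and sheaves of small sets\<close>

record ('o, 'm, 'u) psh =
  pob :: "'o \<Rightarrow> 'u set"
  pact :: "'m \<Rightarrow> 'u \<Rightarrow> 'u"

definition presheaf :: "'u set set \<Rightarrow> ('o, 'm) cat \<Rightarrow> ('o, 'm, 'u) psh \<Rightarrow> bool" where
  "presheaf \<U> C P \<longleftrightarrow>
     (\<forall>X\<in>cobj C. pob P X \<in> \<U>) \<and>
     (\<forall>f\<in>carr C. \<forall>x\<in>pob P (ccod C f). pact P f x \<in> pob P (cdom C f)) \<and>
     (\<forall>X\<in>cobj C. \<forall>x\<in>pob P X. pact P (cid C X) x = x) \<and>
     (\<forall>f\<in>carr C. \<forall>g\<in>carr C. ccod C f = cdom C g \<longrightarrow>
        (\<forall>x\<in>pob P (ccod C g). pact P (ccomp C g f) x = pact P f (pact P g x)))"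

text \<open>Components of natural transformations are extensional functions, which makes equality of
  arrows equality of natural transformations.\<close>

definition nat_trans ::
  "('o, 'm) cat \<Rightarrow> ('o, 'm, 'u) psh \<Rightarrow> ('o, 'm, 'u) psh \<Rightarrow> ('o \<Rightarrow> 'u \<Rightarrow> 'u) \<Rightarrow> bool" where
  "nat_trans C P Q \<alpha> \<longleftrightarrow>
     \<alpha> \<in> (\<Pi>\<^sub>E X\<in>cobj C. pob P X \<rightarrow>\<^sub>E pob Q X) \<and>
     (\<forall>f\<in>carr C. \<forall>x\<in>pob P (ccod C f).
        \<alpha> (cdom C f) (pact P f x) = pact Q f (\<alpha> (ccod C f) x))"

type_synonym ('o, 'm, 'u) psh_arrow =
  "('o, 'm, 'u) psh \<times> ('o, 'm, 'u) psh \<times> ('o \<Rightarrow> 'u \<Rightarrow> 'u)"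

definition presheaf_cat ::
  "'u set set \<Rightarrow> ('o, 'm) cat \<Rightarrow> (('o, 'm, 'u) psh, ('o, 'm, 'u) psh_arrow) cat" where
  "presheaf_cat \<U> C =
     \<lparr>cobj = {P. presheaf \<U> C P},
      carr = {(P, Q, \<alpha>). presheaf \<U> C P \<and> presheaf \<U> C Q \<and> nat_trans C P Q \<alpha>},
      cdom = (\<lambda>(P, Q, \<alpha>). P),
      ccod = (\<lambda>(P, Q, \<alpha>). Q),
      cid = (\<lambda>P. (P, P, \<lambda>X\<in>cobj C. \<lambda>x\<in>pob P X. x)),
      ccomp = (\<lambda>(Q', R, \<beta>) (P, Q, \<alpha>). (P, R, \<lambda>X\<in>cobj C. \<lambda>x\<in>pob P X. \<beta> X (\<alpha> X x)))\<rparr>"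

definition sieve :: "('o, 'm) cat \<Rightarrow> 'o \<Rightarrow> 'm set \<Rightarrow> bool" where
  "sieve C X S \<longleftrightarrow> S \<subseteq> {f \<in> carr C. ccod C f = X} \<and>
     (\<forall>f\<in>S. \<forall>g\<in>carr C. ccod C g = cdom C f \<longrightarrow> ccomp C f g \<in> S)"

text \<open>A topology is given by its covering sieves: \<open>J X\<close> is the set of covering sieves on \<open>X\<close>.\<close>

definition sheaf :: "('o, 'm) cat \<Rightarrow> ('o \<Rightarrow> 'm set set) \<Rightarrow> ('o, 'm, 'u) psh \<Rightarrow> bool" where
  "sheaf C J P \<longleftrightarrow>
     (\<forall>X\<in>cobj C. \<forall>S\<in>J X. \<forall>s.
        (\<forall>f\<in>S. s f \<in> pob P (cdom C f)) \<and>
        (\<forall>f\<in>S. \<forall>g\<in>carr C. ccod C g = cdom C f \<longrightarrow> s (ccomp C f g) = pact P g (s f)) \<longrightarrow>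
        (\<exists>!x. x \<in> pob P X \<and> (\<forall>f\<in>S. pact P f x = s f)))"

definition sheaf_cat ::
  "'u set set \<Rightarrow> ('o, 'm) cat \<Rightarrow> ('o \<Rightarrow> 'm set set) \<Rightarrow>
     (('o, 'm, 'u) psh, ('o, 'm, 'u) psh_arrow) cat" where
  "sheaf_cat \<U> C J = full_subcat {P. sheaf C J P} (presheaf_cat \<U> C)"


section \<open>The geometric syntactic site and the classifying topos\<close>

text \<open>
  An object \<open>(n, \<phi>)\<close> is the formula-in-context \<open>{x. \<phi>}\<close> with \<open>x = (x\<^sub>0, \<dots>, x\<^bsub>n-1\<^esub>)\<close>.
  An arrow from \<open>{x. \<phi>}\<close> to \<open>{y. \<psi>}\<close> is a class of \<open>T\<close>-provably functional formulas \<open>\<theta>(y, x)\<close>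
  modulo \<open>T\<close>-provable equivalence.  The variables of the codomain come first: if \<open>y\<close> has length
  \<open>m\<close>, then \<open>y\<^sub>j\<close> is the variable \<open>j\<close> and \<open>x\<^sub>i\<close> is the variable \<open>m + i\<close>.
\<close>

type_synonym 'u fic = "nat \<times> 'u gform"
type_synonym 'u syn_arrow = "'u fic \<times> 'u fic \<times> 'u gform set"

text \<open>\<open>fexs m \<phi>\<close> quantifies existentially over the variables \<open>0, \<dots>, m - 1\<close>.\<close>

definition fexs :: "nat \<Rightarrow> 'u gform \<Rightarrow> 'u gform" where
  "fexs m \<phi> = (FEx ^^ m) \<phi>"

primrec feqs :: "nat \<Rightarrow> (nat \<Rightarrow> nat) \<Rightarrow> (nat \<Rightarrow> nat) \<Rightarrow> 'u gform" where
  "feqs 0 u v = FTop"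
| "feqs (Suc k) u v = FAnd (feqs k u v) (FEq (TVar (u k)) (TVar (v k)))"

text \<open>The last clause is \<open>\<theta>(z, x) \<and> \<theta>(y, x) \<turnstile> z = y\<close>, in the context \<open>z, y, x\<close>.\<close>

definition functional :: "'u set set \<Rightarrow> 'u sequent set \<Rightarrow> 'u fic \<Rightarrow> 'u fic \<Rightarrow> 'u gform \<Rightarrow> bool" where
  "functional \<U> T = (\<lambda>(n, \<phi>) (m, \<psi>) \<theta>.
     fwf \<U> \<theta> (m + n) \<and>
     prov \<U> T (m + n) \<theta> (FAnd (fren (\<lambda>i. m + i) \<phi>) \<psi>) \<and>
     prov \<U> T n \<phi> (fexs m \<theta>) \<and>
     prov \<U> T (m + m + n)
       (FAnd (fren (\<lambda>i. if i < m then i else m + i) \<theta>) (fren (\<lambda>i. m + i) \<theta>))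
       (feqs m (\<lambda>j. j) (\<lambda>j. m + j)))"

definition fclass :: "'u set set \<Rightarrow> 'u sequent set \<Rightarrow> nat \<Rightarrow> 'u gform \<Rightarrow> 'u gform set" where
  "fclass \<U> T n \<theta> = {\<theta>'. fwf \<U> \<theta>' n \<and> prov \<U> T n \<theta> \<theta>' \<and> prov \<U> T n \<theta>' \<theta>}"

definition syn_arr :: "'u set set \<Rightarrow> 'u sequent set \<Rightarrow> 'u fic \<Rightarrow> 'u fic \<Rightarrow> 'u gform \<Rightarrow> 'u syn_arrow" where
  "syn_arr \<U> T X Y \<theta> = (X, Y, fclass \<U> T (fst Y + fst X) \<theta>)"

text \<open>The composite of \<open>\<theta>(y, x)\<close> and \<open>\<eta>(z, y)\<close>, for \<open>y\<close> of length \<open>m\<close> and \<open>z\<close> of length \<open>p\<close>, is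
  \<open>\<exists>y. \<theta>(y, x) \<and> \<eta>(z, y)\<close>; the matrix is in the context \<open>y, z, x\<close>.\<close>

definition fcomp :: "nat \<Rightarrow> nat \<Rightarrow> 'u gform \<Rightarrow> 'u gform \<Rightarrow> 'u gform" where
  "fcomp m p \<eta> \<theta> =
     fexs m (FAnd (fren (\<lambda>i. if i < m then i else p + i) \<theta>)
                  (fren (\<lambda>i. if i < p then m + i else i - p) \<eta>))"

definition syn_cat :: "'u set set \<Rightarrow> 'u sequent set \<Rightarrow> ('u fic, 'u syn_arrow) cat" where
  "syn_cat \<U> T =
     \<lparr>cobj = {(n, \<phi>). fwf \<U> \<phi> n},
      carr = {syn_arr \<U> T (n, \<phi>) (m, \<psi>) \<theta> | n \<phi> m \<psi> \<theta>.
                fwf \<U> \<phi> n \<and> fwf \<U> \<psi> m \<and> functional \<U> T (n, \<phi>) (m, \<psi>) \<theta>},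
      cdom = (\<lambda>(X, Y, E). X),
      ccod = (\<lambda>(X, Y, E). Y),
      cid = (\<lambda>(n, \<phi>). syn_arr \<U> T (n, \<phi>) (n, \<phi>)
                (FAnd (fren (\<lambda>i. n + i) \<phi>) (feqs n (\<lambda>i. i) (\<lambda>i. n + i)))),
      ccomp = (\<lambda>(Y, Z, E') (X, Y', E).
                (X, Z, \<Union>\<eta>\<in>E'. \<Union>\<theta>\<in>E. fclass \<U> T (fst Z + fst X) (fcomp (fst Y) (fst Z) \<eta> \<theta>)))\<rparr>"

text \<open>The image \<open>\<exists>x. \<theta>(y, x)\<close>, a formula in \<open>y\<close>, for \<open>x\<close> of length \<open>n\<close> and \<open>y\<close> of length \<open>m\<close>.\<close>

definition fimage :: "nat \<Rightarrow> nat \<Rightarrow> 'u gform \<Rightarrow> 'u gform" where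
  "fimage n m \<theta> = fexs n (fren (\<lambda>i. if i < m then n + i else i - m) \<theta>)"

text \<open>A sieve on \<open>{y. \<psi>}\<close> covers if it contains a small family of arrows
  \<open>\<theta>\<^sub>k : {x\<^sub>k. \<phi>\<^sub>k} \<rightarrow> {y. \<psi>}\<close> such that \<open>\<psi> \<turnstile>\<^sub>y \<Or>\<^sub>k \<exists>x\<^sub>k. \<theta>\<^sub>k\<close> is provable.\<close>

definition syn_top :: "'u set set \<Rightarrow> 'u sequent set \<Rightarrow> 'u fic \<Rightarrow> 'u syn_arrow set set" where
  "syn_top \<U> T = (\<lambda>(m, \<psi>).
     {S. sieve (syn_cat \<U> T) (m, \<psi>) S \<and>
         (\<exists>K\<in>\<U>. \<exists>X \<theta>.
            (\<forall>k\<in>K. X k \<in> cobj (syn_cat \<U> T) \<and> functional \<U> T (X k) (m, \<psi>) (\<theta> k) \<and>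
                   syn_arr \<U> T (X k) (m, \<psi>) (\<theta> k) \<in> S) \<and>
            prov \<U> T m \<psi> (FOr K (\<lambda>k. fimage (fst (X k)) m (\<theta> k))))})"

definition classifying_topos ::
  "'u set set \<Rightarrow> 'u sequent set \<Rightarrow>
     (('u fic, 'u syn_arrow, 'u) psh, ('u fic, 'u syn_arrow, 'u) psh_arrow) cat" where
  "classifying_topos \<U> T = sheaf_cat \<U> (syn_cat \<U> T) (syn_top \<U> T)"

text \<open>Every small category is isomorphic to one whose objects and arrows are elements of \<open>'u\<close>.\<close>

definition of_presheaf_type :: "'u set set \<Rightarrow> 'u sequent set \<Rightarrow> bool" where
  "of_presheaf_type \<U> T \<longleftrightarrow>
     (\<exists>D :: ('u, 'u) cat. category D \<and> cobj D \<in> \<U> \<and> carr D \<in> \<U> \<and>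
        equivalent_cats (classifying_topos \<U> T) (presheaf_cat \<U> D))"

end

theory Submission
  imports Defs "HOL-Library.Countable_Set"
begin

text \<open>
  In a topos of presheaves on a small category every object receives a jointly epic family of arrows
  from irreducible objects, that is, objects onto which every jointly epic family contains a split
  epimorphism: the representables are irreducible (\<open>hom_irreducible\<close>), and they generate by the Yoneda
  lemma (\<open>elements_jointly_epic\<close>).  Equivalences of categories preserve both notions
  (\<open>jointly_epic_transport\<close>, \<open>irreducible_transport\<close>).  It is shown that in the classifying topos the
  underlying object \<open>M\<close> of the generic model, which is represented by the formula \<open>{x. \<top>}\<close>, does not
  receive such a family.

  As the theory consists of all sequents that hold in the local MV-algebras of finite rank, provability
  is truth in these algebras (\<open>prov_iff\<close>).  Hence the arrows of the syntactic category are the definable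
  functions between definable sets, and covers are families that are jointly surjective on points
  (\<open>cover_iff\<close>).

  Let \<open>C\<close> be Chang's algebra with its infinitesimal \<open>\<epsilon>\<close>; it is local of rank \<open>1\<close>.  Substituting \<open>1/N\<close> for \<open>\<epsilon>\<close>
  gives maps from \<open>C\<close> to the chains \<open>S_N\<close> that respect every single sum for all large \<open>N\<close>.  Therefore a
  geometric formula that is true in \<open>C\<close> remains true in \<open>S_N\<close> for all large \<open>N\<close> (\<open>fsat_trunc\<close>): geometric
  logic cannot separate \<open>\<epsilon>\<close> from all the elements \<open>1/N\<close>, although \<open>\<epsilon>\<close> lies in the radical and they do not.

  Suppose now that \<open>M\<close> had such a family.  Testing it against the skyscraper sheaf at \<open>C\<close> shows that it
  reaches \<open>\<epsilon>\<close> (\<open>jointly_epic_hits\<close>): there are an arrow \<open>a : H \<rightarrow> M\<close> with \<open>H\<close> irreducible, an element \<open>s\<close> of \<open>H\<close>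
  at some stage \<open>Y\<close>, and a \<open>C\<close>-point of \<open>Y\<close> that the definable function \<open>a s\<close> sends to \<open>\<epsilon>\<close>.  Then, for some \<open>N\<close>,
  \<open>a s\<close> also takes the value \<open>1/N\<close> at some \<open>S_N\<close>-point of \<open>Y\<close>.  By locality, \<open>M\<close> is covered by two definable
  subobjects: either some multiple of \<open>N x\<close> or some multiple of \<open>\<not>(N x)\<close> is \<open>1\<close>.  As \<open>H\<close> is irreducible, \<open>a\<close>
  factors through one of them (\<open>irreducible_dichotomy\<close>).  It is not the first, since \<open>N\<epsilon>\<close> is infinitesimal,
  and not the second, since \<open>N (1/N) = 1\<close> in \<open>S_N\<close>.
\<close>

section \<open>Geometric formulas and their values\<close>

definition tup :: "'a mv \<Rightarrow> nat \<Rightarrow> 'a list set" where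
  "tup A n = {xs. length xs = n \<and> set xs \<subseteq> mcarrier A}"

abbreviation sat :: "'a mv \<Rightarrow> 'u gform \<Rightarrow> 'a list \<Rightarrow> bool" where
  "sat A \<phi> xs \<equiv> fsat A \<phi> ((!) xs)"

lemma tup_length: "xs \<in> tup A n \<Longrightarrow> length xs = n"
  by (simp add: tup_def)

lemma tup_nth: "xs \<in> tup A n \<Longrightarrow> i < n \<Longrightarrow> xs ! i \<in> mcarrier A"
  by (auto simp: tup_def)

lemma tup_append: "ys \<in> tup A m \<Longrightarrow> xs \<in> tup A n \<Longrightarrow> ys @ xs \<in> tup A (m + n)"
  by (auto simp: tup_def)

lemma tup_split: "(\<forall>zs\<in>tup A (m + n). P zs) \<longleftrightarrow> (\<forall>ys\<in>tup A m. \<forall>xs\<in>tup A n. P (ys @ xs))"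
proof
  assume "\<forall>ys\<in>tup A m. \<forall>xs\<in>tup A n. P (ys @ xs)"
  moreover have "take m zs \<in> tup A m" "drop m zs \<in> tup A n" if "zs \<in> tup A (m + n)" for zs
    using that by (auto simp: tup_def dest: in_set_takeD in_set_dropD)
  ultimately show "\<forall>zs\<in>tup A (m + n). P zs"
    by (metis append_take_drop_id)
qed (auto intro: tup_append)

lemma tup_map_nth: "xs \<in> tup A m \<Longrightarrow> (\<And>i. i < n \<Longrightarrow> \<rho> i < m) \<Longrightarrow> map (\<lambda>i. xs ! \<rho> i) [0..<n] \<in> tup A n"
  by (auto simp: tup_def)

lemma teval_cong: "twf n t \<Longrightarrow> (\<And>i. i < n \<Longrightarrow> e i = e' i) \<Longrightarrow> teval A e t = teval A e' t"
  by (induction t) auto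

lemma teval_closed:
  "mv_algebra A \<Longrightarrow> twf n t \<Longrightarrow> (\<And>i. i < n \<Longrightarrow> e i \<in> mcarrier A) \<Longrightarrow> teval A e t \<in> mcarrier A"
  by (induction t) (auto simp: mv_algebra_def)

lemma fsat_cong: "fwf \<U> \<phi> n \<Longrightarrow> (\<And>i. i < n \<Longrightarrow> e i = e' i) \<Longrightarrow> fsat A \<phi> e = fsat A \<phi> e'"
proof (induction \<phi> arbitrary: n e e')
  case (FEq s t)
  then show ?case using teval_cong[of n s e e' A] teval_cong[of n t e e' A] by simp
next
  case (FAnd \<phi> \<psi>)
  then show ?case by (metis fsat.simps(3) fwf.simps(3))
next
  case (FEx \<phi>)
  have "fsat A \<phi> (case_nat a e) = fsat A \<phi> (case_nat a e')" for a
    using FEx.prems by (intro FEx.IH[of "Suc n"]) (auto split: nat.split)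
  then show ?case by simp
next
  case (FOr K F)
  then have "fsat A (F k) e = fsat A (F k) e'" if "k \<in> K" for k
    using that by (intro FOr.IH[of "F k" n]) auto
  then show ?case by auto
qed auto

lemma twf_tsubst: "twf n t \<Longrightarrow> (\<And>i. i < n \<Longrightarrow> twf m (\<sigma> i)) \<Longrightarrow> twf m (tsubst \<sigma> t)"
  by (induction t) auto

lemma fwf_fsubst: "fwf \<U> \<phi> n \<Longrightarrow> (\<And>i. i < n \<Longrightarrow> twf m (\<sigma> i)) \<Longrightarrow> fwf \<U> (fsubst \<phi> \<sigma>) m"
proof (induction \<phi> arbitrary: n m \<sigma>)
  case (FEx \<phi>)
  show ?case
    unfolding fsubst.simps fwf.simps
  proof (rule FEx.IH[of "Suc n"])
    show "fwf \<U> \<phi> (Suc n)" using FEx.prems by simp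
    fix i assume "i < Suc n"
    then show "twf (Suc m) (case i of 0 \<Rightarrow> TVar 0 | Suc j \<Rightarrow> tsubst (\<lambda>j. TVar (Suc j)) (\<sigma> j))"
      using FEx.prems(2) by (auto split: nat.split intro!: twf_tsubst[of m])
  qed
qed (auto intro: twf_tsubst)

lemma teval_tsubst: "teval A e (tsubst \<sigma> t) = teval A (\<lambda>i. teval A e (\<sigma> i)) t"
  by (induction t) auto

lemma fsat_fsubst: "fsat A (fsubst \<phi> \<sigma>) e \<longleftrightarrow> fsat A \<phi> (\<lambda>i. teval A e (\<sigma> i))"
proof (induction \<phi> arbitrary: \<sigma> e)
  case (FEx \<phi>)
  have "(\<lambda>i. teval A (case_nat a e)
           (case i of 0 \<Rightarrow> TVar 0 | Suc j \<Rightarrow> tsubst (\<lambda>j. TVar (Suc j)) (\<sigma> j)))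
        = case_nat a (\<lambda>i. teval A e (\<sigma> i))" for a
    by (rule ext) (auto simp: teval_tsubst split: nat.split)
  then show ?case by (simp add: FEx.IH)
qed (auto simp: teval_tsubst)

lemma fwf_fren: "fwf \<U> \<phi> n \<Longrightarrow> (\<And>i. i < n \<Longrightarrow> \<rho> i < m) \<Longrightarrow> fwf \<U> (fren \<rho> \<phi>) m"
  unfolding fren_def by (rule fwf_fsubst) auto

lemma fsat_fren: "fsat A (fren \<rho> \<phi>) e \<longleftrightarrow> fsat A \<phi> (\<lambda>i. e (\<rho> i))"
  by (simp add: fren_def fsat_fsubst)

lemma fwf_fexs: "fwf \<U> (fexs m \<phi>) n \<longleftrightarrow> fwf \<U> \<phi> (m + n)"
  unfolding fexs_def by (induction m arbitrary: n) auto

lemma fsat_fexs: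
  "fsat A (fexs m \<phi>) e \<longleftrightarrow> (\<exists>xs\<in>tup A m. fsat A \<phi> (\<lambda>i. if i < m then xs ! i else e (i - m)))"
proof (induction m arbitrary: e)
  case 0
  then show ?case by (simp add: fexs_def tup_def)
next
  case (Suc m)
  have eq: "(\<lambda>i. if i < m then xs ! i else case_nat a e (i - m)) =
      (\<lambda>i. if i < Suc m then (xs @ [a]) ! i else e (i - Suc m))" if "length xs = m" for xs :: "'a list" and a
  proof
    fix i
    consider "i < m" | "i = m" | j where "i = Suc (m + j)"
      by (metis less_iff_Suc_add linorder_neqE_nat)
    then show "(if i < m then xs ! i else case_nat a e (i - m)) =
      (if i < Suc m then (xs @ [a]) ! i else e (i - Suc m))"
      using that by cases (auto simp: nth_append Suc_diff_le)
  qed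
  have "fsat A (fexs (Suc m) \<phi>) e \<longleftrightarrow>
      (\<exists>a\<in>mcarrier A. \<exists>xs\<in>tup A m. fsat A \<phi> (\<lambda>i. if i < Suc m then (xs @ [a]) ! i else e (i - Suc m)))"
    using Suc by (auto simp: fexs_def eq tup_length)
  also have "\<dots> \<longleftrightarrow> (\<exists>xs\<in>tup A (Suc m). fsat A \<phi> (\<lambda>i. if i < Suc m then xs ! i else e (i - Suc m)))"
  proof
    assume "\<exists>a\<in>mcarrier A. \<exists>xs\<in>tup A m. fsat A \<phi> (\<lambda>i. if i < Suc m then (xs @ [a]) ! i else e (i - Suc m))"
    then obtain a xs where "a \<in> mcarrier A" "xs \<in> tup A m"
      "fsat A \<phi> (\<lambda>i. if i < Suc m then (xs @ [a]) ! i else e (i - Suc m))" by auto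
    then show "\<exists>xs\<in>tup A (Suc m). fsat A \<phi> (\<lambda>i. if i < Suc m then xs ! i else e (i - Suc m))"
      by (intro bexI[of _ "xs @ [a]"]) (auto simp: tup_def)
  next
    assume "\<exists>xs\<in>tup A (Suc m). fsat A \<phi> (\<lambda>i. if i < Suc m then xs ! i else e (i - Suc m))"
    then obtain xs where xs: "xs \<in> tup A (Suc m)"
      "fsat A \<phi> (\<lambda>i. if i < Suc m then xs ! i else e (i - Suc m))" by auto
    then obtain ys a where "xs = ys @ [a]" by (cases xs rule: rev_cases) (auto simp: tup_def)
    with xs show "\<exists>a\<in>mcarrier A. \<exists>xs\<in>tup A m. fsat A \<phi> (\<lambda>i. if i < Suc m then (xs @ [a]) ! i else e (i - Suc m))"
      by (intro bexI[of _ a] bexI[of _ ys]) (auto simp: tup_def)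
  qed
  finally show ?case .
qed

lemma sat_fexs:
  assumes "fwf \<U> \<phi> (m + n)" "length ys = n"
  shows "sat A (fexs m \<phi>) ys \<longleftrightarrow> (\<exists>xs\<in>tup A m. sat A \<phi> (xs @ ys))"
proof -
  have "fsat A \<phi> (\<lambda>i. if i < m then xs ! i else ys ! (i - m)) = sat A \<phi> (xs @ ys)" if "xs \<in> tup A m" for xs
    using that by (intro fsat_cong[OF assms(1)]) (auto simp: tup_def nth_append)
  then show ?thesis by (auto simp: fsat_fexs)
qed

lemma fwf_feqs: "(\<And>i. i < k \<Longrightarrow> u i < n \<and> v i < n) \<Longrightarrow> fwf \<U> (feqs k u v) n"
  by (induction k) auto

lemma fsat_feqs: "fsat A (feqs k u v) e \<longleftrightarrow> (\<forall>i<k. e (u i) = e (v i))"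
  by (induction k) (auto simp: less_Suc_eq)

lemma seq_sat_iff:
  assumes "fwf \<U> \<phi> n" "fwf \<U> \<psi> n"
  shows "seq_sat A (n, \<phi>, \<psi>) \<longleftrightarrow> (\<forall>xs\<in>tup A n. sat A \<phi> xs \<longrightarrow> sat A \<psi> xs)"
proof
  assume *: "seq_sat A (n, \<phi>, \<psi>)"
  have "sat A \<psi> xs" if "xs \<in> tup A n" "sat A \<phi> xs" for xs
    using * that tup_nth[OF that(1)] unfolding seq_sat_def prod.case by blast
  then show "\<forall>xs\<in>tup A n. sat A \<phi> xs \<longrightarrow> sat A \<psi> xs" by blast
next
  assume *: "\<forall>xs\<in>tup A n. sat A \<phi> xs \<longrightarrow> sat A \<psi> xs"
  show "seq_sat A (n, \<phi>, \<psi>)"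
    unfolding seq_sat_def prod.case
  proof (intro allI impI)
    fix e assume e: "\<forall>i<n. e i \<in> mcarrier A" "fsat A \<phi> e"
    have "map e [0..<n] \<in> tup A n" using e by (auto simp: tup_def)
    moreover have "fsat A \<chi> e = sat A \<chi> (map e [0..<n])" if "fwf \<U> \<chi> n" for \<chi>
      using that by (intro fsat_cong) auto
    ultimately show "fsat A \<psi> e" using * e(2) assms by blast
  qed
qed

section \<open>Provability is truth in all models\<close>

definition models :: "'u set set \<Rightarrow> 'u mv set" where
  "models \<U> = {A. mcarrier A \<in> \<U> \<and> mv_local_of_finite_rank A}"

lemma models_mv_algebra: "A \<in> models \<U> \<Longrightarrow> mv_algebra A"
  by (auto simp: models_def mv_local_of_finite_rank_def mv_local_of_rank_def mv_local_def)

lemma prov_sound: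
  assumes "prov \<U> T n \<phi> \<psi>" "mv_algebra A"
    and "\<And>n \<phi> \<psi>. (n, \<phi>, \<psi>) \<in> T \<Longrightarrow> seq_sat A (n, \<phi>, \<psi>)"
  shows "seq_sat A (n, \<phi>, \<psi>)"
  using assms(1)
proof induction
  case (axiom n \<phi> \<psi>)
  then show ?case using assms(3) by blast
next
  case (subst n \<phi> \<psi> m \<sigma>)
  have "teval A e (\<sigma> i) \<in> mcarrier A" if "i < n" "\<forall>i<m. e i \<in> mcarrier A" for e i
    using subst.hyps that assms(2) by (intro teval_closed[of A m]) auto
  then show ?case using subst.IH by (auto simp: seq_sat_def fsat_fsubst)
next
  case (eq_subst n s t \<phi>)
  have "(\<lambda>i. teval A e (case i of 0 \<Rightarrow> s | Suc x \<Rightarrow> TVar x)) = case_nat (teval A e s) e" for e s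
    by (rule ext) (auto split: nat.split)
  then show ?case by (auto simp: seq_sat_def fsat_fsubst)
next
  case (exE \<psi> n \<phi>)
  show ?case
    unfolding seq_sat_def prod.case fsat.simps
  proof (intro allI impI, elim bexE)
    fix e a assume "\<forall>i<n. e i \<in> mcarrier A" "a \<in> mcarrier A" "fsat A \<phi> (case_nat a e)"
    moreover from this have "\<forall>i<Suc n. case_nat a e i \<in> mcarrier A" by (auto split: nat.split)
    ultimately have "fsat A (fren Suc \<psi>) (case_nat a e)"
      using exE.IH by (auto simp: seq_sat_def)
    then show "fsat A \<psi> e" by (simp add: fsat_fren)
  qed
next
  case (exI \<phi> n \<psi>)
  show ?case
    unfolding seq_sat_def prod.case fsat_fren
  proof (intro allI impI)
    fix e assume e: "\<forall>i<Suc n. e i \<in> mcarrier A" "fsat A \<phi> e"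
    have "case_nat (e 0) (\<lambda>i. e (Suc i)) = e" by (rule ext) (auto split: nat.split)
    then have "fsat A (FEx \<phi>) (\<lambda>i. e (Suc i))" using e by (auto intro!: bexI[of _ "e 0"])
    moreover have "\<forall>i<n. e (Suc i) \<in> mcarrier A" using e by auto
    ultimately show "fsat A \<psi> (\<lambda>i. e (Suc i))" using exI.IH by (auto simp: seq_sat_def)
  qed
qed (auto simp: seq_sat_def fsat_fren)

lemma prov_fwf: "prov \<U> T n \<phi> \<psi> \<Longrightarrow> fwf \<U> \<phi> n \<and> fwf \<U> \<psi> n"
proof (induction rule: prov.induct)
  case (eq_subst n s t \<phi>)
  have "fwf \<U> (fsubst \<phi> (case_nat r TVar)) n" if "twf n r" for r
    using eq_subst that by (intro fwf_fsubst[of _ _ "Suc n"]) (auto split: nat.split)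
  with eq_subst show ?case by auto
next
  case (frobenius \<phi> n \<psi>)
  then show ?case by (auto intro: fwf_fren)
next
  case (exI \<phi> n \<psi>)
  then show ?case by (auto intro: fwf_fren)
qed (auto intro: fwf_fsubst)

text \<open>
  Soundness gives one direction.  Conversely a sequent that is true in all models is an axiom by the
  definition of the theory, so no completeness theorem for geometric logic enters.
\<close>

lemma prov_iff:
  "prov \<U> (FinRank \<U>) n \<phi> \<psi> \<longleftrightarrow> fwf \<U> \<phi> n \<and> fwf \<U> \<psi> n \<and>
     (\<forall>A\<in>models \<U>. \<forall>xs\<in>tup A n. sat A \<phi> xs \<longrightarrow> sat A \<psi> xs)" (is "?l \<longleftrightarrow> ?r")
proof
  assume l: ?l
  have "seq_sat A (n, \<phi>, \<psi>)" if "A \<in> models \<U>" for A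
    using l models_mv_algebra[OF that]
    by (rule prov_sound) (use that in \<open>auto simp: FinRank_def models_def\<close>)
  then show ?r using prov_fwf[OF l] by (auto simp: seq_sat_iff)
next
  assume r: ?r
  then have "(n, \<phi>, \<psi>) \<in> FinRank \<U>"
    by (auto simp: FinRank_def seq_sat_iff models_def)
  then show ?l using r by (auto intro: prov.axiom)
qed

section \<open>The syntactic category as a category of definable functions\<close>

lemma twf_mono: "twf n t \<Longrightarrow> n \<le> m \<Longrightarrow> twf m t"
  by (induction t) auto

lemma fwf_mono: "fwf \<U> \<phi> n \<Longrightarrow> n \<le> m \<Longrightarrow> fwf \<U> \<phi> m"
proof (induction \<phi> arbitrary: n m)
  case (FEx \<phi>)
  then show ?case by (metis Suc_le_mono fwf.simps(4))
qed (auto intro: twf_mono)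

lemma sat_ren:
  assumes "fwf \<U> \<phi> k" "\<And>i. i < k \<Longrightarrow> zs ! \<rho> i = ws ! i"
  shows "sat A (fren \<rho> \<phi>) zs \<longleftrightarrow> sat A \<phi> ws"
  unfolding fsat_fren using assms by (rule fsat_cong)

lemma sat_append:
  assumes "fwf \<U> \<phi> m" "length ys = m"
  shows "sat A \<phi> (ys @ xs) \<longleftrightarrow> sat A \<phi> ys"
  using assms by (intro fsat_cong) (auto simp: nth_append)

definition pts :: "'a mv \<Rightarrow> 'u fic \<Rightarrow> 'a list set" where
  "pts A X = {xs \<in> tup A (fst X). sat A (snd X) xs}"

text \<open>
  Quantifying over the whole class of formulas avoids choosing a representative: in a model, all members
  of the class define the same graph.
\<close>

definition gr :: "'a mv \<Rightarrow> 'u syn_arrow \<Rightarrow> ('a list \<times> 'a list) set" where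
  "gr A f = {(xs, ys). xs \<in> tup A (fst (fst f)) \<and> ys \<in> tup A (fst (fst (snd f))) \<and>
     (\<exists>\<theta>\<in>snd (snd f). sat A \<theta> (ys @ xs))}"

definition ap :: "'a mv \<Rightarrow> 'u syn_arrow \<Rightarrow> 'a list \<Rightarrow> 'a list" where
  "ap A f xs = (THE ys. (xs, ys) \<in> gr A f)"

lemma pts_tup: "xs \<in> pts A X \<Longrightarrow> xs \<in> tup A (fst X)"
  by (simp add: pts_def)

lemma fwf_fcomp:
  assumes "fwf \<U> \<theta> (m + n)" "fwf \<U> \<eta> (p + m)"
  shows "fwf \<U> (fcomp m p \<eta> \<theta>) (p + n)"
  unfolding fcomp_def fwf_fexs using assms by (auto intro!: fwf_fren)

lemma sat_fcomp:
  assumes "fwf \<U> \<theta> (m + n)" "fwf \<U> \<eta> (p + m)" "length zs = p" "length xs = n"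
  shows "sat A (fcomp m p \<eta> \<theta>) (zs @ xs) \<longleftrightarrow> (\<exists>ys\<in>tup A m. sat A \<theta> (ys @ xs) \<and> sat A \<eta> (zs @ ys))"
proof -
  have "sat A (fren (\<lambda>i. if i < m then i else p + i) \<theta>) (ys @ zs @ xs) = sat A \<theta> (ys @ xs)"
    if "ys \<in> tup A m" for ys
    using that assms by (intro sat_ren[OF assms(1)]) (auto simp: nth_append tup_def)
  moreover have "sat A (fren (\<lambda>i. if i < p then m + i else i - p) \<eta>) (ys @ zs @ xs) = sat A \<eta> (zs @ ys)"
    if "ys \<in> tup A m" for ys
    using that assms by (intro sat_ren[OF assms(2)]) (auto simp: nth_append tup_def)
  moreover have "fwf \<U> (FAnd (fren (\<lambda>i. if i < m then i else p + i) \<theta>)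
      (fren (\<lambda>i. if i < p then m + i else i - p) \<eta>)) (m + (p + n))"
    using assms by (auto intro!: fwf_fren)
  ultimately show ?thesis
    unfolding fcomp_def using assms by (subst sat_fexs) auto
qed

lemma fwf_fimage: "fwf \<U> \<theta> (m + n) \<Longrightarrow> fwf \<U> (fimage n m \<theta>) m"
  unfolding fimage_def fwf_fexs by (auto intro!: fwf_fren)

lemma sat_fimage:
  assumes "fwf \<U> \<theta> (m + n)" "length ys = m"
  shows "sat A (fimage n m \<theta>) ys \<longleftrightarrow> (\<exists>xs\<in>tup A n. sat A \<theta> (ys @ xs))"
proof -
  have "sat A (fren (\<lambda>i. if i < m then n + i else i - m) \<theta>) (xs @ ys) = sat A \<theta> (ys @ xs)"
    if "xs \<in> tup A n" for xs
    using that assms by (intro sat_ren[OF assms(1)]) (auto simp: nth_append tup_def)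
  moreover have "fwf \<U> (fren (\<lambda>i. if i < m then n + i else i - m) \<theta>) (n + m)"
    using assms by (auto intro!: fwf_fren)
  ultimately show ?thesis
    unfolding fimage_def using assms by (subst sat_fexs) auto
qed

context set_universe
begin

abbreviation "SC \<equiv> syn_cat \<U> (FinRank \<U>)"

abbreviation ob :: "'u fic \<Rightarrow> bool" where
  "ob X \<equiv> fwf \<U> (snd X) (fst X)"

lemma cobj_SC: "X \<in> cobj SC \<longleftrightarrow> ob X"
  by (cases X) (simp add: syn_cat_def)

lemma cdom_SC [simp]: "cdom SC f = fst f" and ccod_SC [simp]: "ccod SC f = fst (snd f)"
  by (simp_all add: syn_cat_def case_prod_beta)

text \<open>A formula represents an arrow exactly when it defines the graph of a function in every model.\<close>

definition defines_fun :: "'u mv \<Rightarrow> 'u fic \<Rightarrow> 'u fic \<Rightarrow> 'u gform \<Rightarrow> ('u list \<Rightarrow> 'u list) \<Rightarrow> bool" where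
  "defines_fun A X Y \<theta> F \<longleftrightarrow> (\<forall>xs\<in>pts A X. F xs \<in> pts A Y) \<and>
     (\<forall>xs\<in>tup A (fst X). \<forall>ys\<in>tup A (fst Y). sat A \<theta> (ys @ xs) \<longleftrightarrow> xs \<in> pts A X \<and> ys = F xs)"

lemma functional_sat:
  assumes "ob X" "ob Y"
  shows "functional \<U> (FinRank \<U>) X Y \<theta> \<longleftrightarrow> fwf \<U> \<theta> (fst Y + fst X) \<and> (\<forall>A\<in>models \<U>.
     (\<forall>ys\<in>tup A (fst Y). \<forall>xs\<in>tup A (fst X). sat A \<theta> (ys @ xs) \<longrightarrow> xs \<in> pts A X \<and> ys \<in> pts A Y) \<and>
     (\<forall>xs\<in>pts A X. \<exists>ys\<in>tup A (fst Y). sat A \<theta> (ys @ xs)) \<and>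
     (\<forall>zs\<in>tup A (fst Y). \<forall>ys\<in>tup A (fst Y). \<forall>xs\<in>tup A (fst X).
        sat A \<theta> (zs @ xs) \<and> sat A \<theta> (ys @ xs) \<longrightarrow> zs = ys))"
proof -
  obtain n \<phi> m \<psi> where X: "X = (n, \<phi>)" and Y: "Y = (m, \<psi>)" by (metis surj_pair)
  show ?thesis
  proof (cases "fwf \<U> \<theta> (m + n)")
    case False
    then show ?thesis by (simp add: functional_def X Y)
  next
    case wf: True
    have \<phi>: "fwf \<U> \<phi> n" and \<psi>: "fwf \<U> \<psi> m" using assms X Y by auto
    have 1: "prov \<U> (FinRank \<U>) (m + n) \<theta> (FAnd (fren (\<lambda>i. m + i) \<phi>) \<psi>) \<longleftrightarrow>
      (\<forall>A\<in>models \<U>. \<forall>ys\<in>tup A m. \<forall>xs\<in>tup A n. sat A \<theta> (ys @ xs) \<longrightarrow> xs \<in> pts A X \<and> ys \<in> pts A Y)"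
    proof -
      have "fwf \<U> (FAnd (fren (\<lambda>i. m + i) \<phi>) \<psi>) (m + n)"
        using fwf_fren[OF \<phi>, of "\<lambda>i. m + i" "m + n"] fwf_mono[OF \<psi>, of "m + n"] by simp
      moreover have "sat A (fren (\<lambda>i. m + i) \<phi>) (ys @ xs) = sat A \<phi> xs" if "ys \<in> tup A m" for A :: "'u mv" and ys xs
        using that by (intro sat_ren[OF \<phi>]) (auto simp: tup_def)
      moreover have "sat A \<psi> (ys @ xs) = sat A \<psi> ys" if "ys \<in> tup A m" for A :: "'u mv" and ys xs
        using that by (intro sat_append[OF \<psi>]) (auto simp: tup_def)
      ultimately show ?thesis
        using wf by (simp add: prov_iff tup_split pts_def X Y)
    qed
    have 2: "prov \<U> (FinRank \<U>) n \<phi> (fexs m \<theta>) \<longleftrightarrow>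
      (\<forall>A\<in>models \<U>. \<forall>xs\<in>pts A X. \<exists>ys\<in>tup A m. sat A \<theta> (ys @ xs))"
      using wf \<phi> by (auto simp: prov_iff pts_def X fwf_fexs sat_fexs[OF wf tup_length])
    have 3: "prov \<U> (FinRank \<U>) (m + m + n)
       (FAnd (fren (\<lambda>i. if i < m then i else m + i) \<theta>) (fren (\<lambda>i. m + i) \<theta>))
       (feqs m (\<lambda>j. j) (\<lambda>j. m + j)) \<longleftrightarrow> (\<forall>A\<in>models \<U>. \<forall>zs\<in>tup A m. \<forall>ys\<in>tup A m. \<forall>xs\<in>tup A n.
        sat A \<theta> (zs @ xs) \<and> sat A \<theta> (ys @ xs) \<longrightarrow> zs = ys)"
    proof -
      have wfs: "fwf \<U> (fren (\<lambda>i. if i < m then i else m + i) \<theta>) (m + m + n)"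
        "fwf \<U> (fren (\<lambda>i. m + i) \<theta>) (m + m + n)"
        "fwf \<U> (feqs m (\<lambda>j. j) (\<lambda>j. m + j)) (m + m + n)"
        using wf by (auto intro!: fwf_fren fwf_feqs)
      have eqs: "sat A (fren (\<lambda>i. if i < m then i else m + i) \<theta>) ((zs @ ys) @ xs) = sat A \<theta> (zs @ xs)"
        "sat A (fren (\<lambda>i. m + i) \<theta>) ((zs @ ys) @ xs) = sat A \<theta> (ys @ xs)"
        "sat A (feqs m (\<lambda>j. j) (\<lambda>j. m + j) :: 'u gform) ((zs @ ys) @ xs) \<longleftrightarrow> zs = ys"
        if "zs \<in> tup A m" "ys \<in> tup A m" for A :: "'u mv" and ys xs zs
        using that
        by (auto intro!: sat_ren[OF wf] simp: tup_def nth_append fsat_feqs list_eq_iff_nth_eq)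
      have "(\<forall>A\<in>models \<U>. \<forall>zs\<in>tup A m. \<forall>ys\<in>tup A m. \<forall>xs\<in>tup A n.
          sat A (fren (\<lambda>i. if i < m then i else m + i) \<theta>) ((zs @ ys) @ xs) \<and>
          sat A (fren (\<lambda>i. m + i) \<theta>) ((zs @ ys) @ xs) \<longrightarrow>
          sat A (feqs m (\<lambda>j. j) (\<lambda>j. m + j) :: 'u gform) ((zs @ ys) @ xs)) \<longleftrightarrow>
        (\<forall>A\<in>models \<U>. \<forall>zs\<in>tup A m. \<forall>ys\<in>tup A m. \<forall>xs\<in>tup A n.
          sat A \<theta> (zs @ xs) \<and> sat A \<theta> (ys @ xs) \<longrightarrow> zs = ys)"
        by (intro ball_cong refl) (simp only: eqs)
      then show ?thesis
        unfolding prov_iff tup_split fsat.simps fwf.simps using wfs by blast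
    qed
    show ?thesis
      unfolding functional_def X Y prod.case 1 2 3 fst_conv
      using wf by (simp only: simp_thms ball_conj_distrib X Y)
  qed
qed

lemma functional_iff:
  assumes "ob X" "ob Y"
  shows "functional \<U> (FinRank \<U>) X Y \<theta> \<longleftrightarrow> fwf \<U> \<theta> (fst Y + fst X) \<and>
    (\<forall>A\<in>models \<U>. \<exists>F. defines_fun A X Y \<theta> F)"
proof -
  have "(\<forall>ys\<in>tup A (fst Y). \<forall>xs\<in>tup A (fst X). sat A \<theta> (ys @ xs) \<longrightarrow> xs \<in> pts A X \<and> ys \<in> pts A Y) \<and>
     (\<forall>xs\<in>pts A X. \<exists>ys\<in>tup A (fst Y). sat A \<theta> (ys @ xs)) \<and>
     (\<forall>zs\<in>tup A (fst Y). \<forall>ys\<in>tup A (fst Y). \<forall>xs\<in>tup A (fst X).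
        sat A \<theta> (zs @ xs) \<and> sat A \<theta> (ys @ xs) \<longrightarrow> zs = ys) \<longleftrightarrow> (\<exists>F. defines_fun A X Y \<theta> F)"
    (is "?a A \<and> ?b A \<and> ?c A \<longleftrightarrow> _") for A
  proof
    assume abc: "?a A \<and> ?b A \<and> ?c A"
    then obtain F where F: "\<And>xs. xs \<in> pts A X \<Longrightarrow> F xs \<in> tup A (fst Y) \<and> sat A \<theta> (F xs @ xs)"
      by metis
    have "defines_fun A X Y \<theta> F"
      unfolding defines_fun_def
    proof (intro conjI ballI)
      show "F xs \<in> pts A Y" if "xs \<in> pts A X" for xs
        using that abc F[OF that] pts_tup[OF that] by blast
      show "sat A \<theta> (ys @ xs) \<longleftrightarrow> xs \<in> pts A X \<and> ys = F xs"
        if "xs \<in> tup A (fst X)" "ys \<in> tup A (fst Y)" for xs ys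
      proof
        assume "sat A \<theta> (ys @ xs)"
        with that abc have "xs \<in> pts A X" by blast
        with that abc F[OF this] \<open>sat A \<theta> (ys @ xs)\<close> show "xs \<in> pts A X \<and> ys = F xs" by blast
      qed (use F in auto)
    qed
    then show "\<exists>F. defines_fun A X Y \<theta> F" by blast
  next
    assume "\<exists>F. defines_fun A X Y \<theta> F"
    then obtain F where F: "defines_fun A X Y \<theta> F" ..
    then show "?a A \<and> ?b A \<and> ?c A"
      unfolding defines_fun_def by (metis pts_tup)
  qed
  then show ?thesis
    unfolding functional_sat[OF assms] by blast
qed

lemma fclass_eq:
  assumes "fwf \<U> \<theta> n" "fwf \<U> \<theta>' n"
    "\<And>A xs. A \<in> models \<U> \<Longrightarrow> xs \<in> tup A n \<Longrightarrow> sat A \<theta> xs \<longleftrightarrow> sat A \<theta>' xs"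
  shows "fclass \<U> (FinRank \<U>) n \<theta> = fclass \<U> (FinRank \<U>) n \<theta>'"
  unfolding fclass_def prov_iff using assms by auto

lemma fclass_mem:
  assumes "fwf \<U> \<theta> n"
  shows "\<theta>' \<in> fclass \<U> (FinRank \<U>) n \<theta> \<longleftrightarrow> fwf \<U> \<theta>' n \<and>
    (\<forall>A\<in>models \<U>. \<forall>xs\<in>tup A n. sat A \<theta>' xs \<longleftrightarrow> sat A \<theta> xs)"
  unfolding fclass_def prov_iff using assms by auto

lemma carr_SC: "f \<in> carr SC \<longleftrightarrow> (\<exists>X Y \<theta>. f = syn_arr \<U> (FinRank \<U>) X Y \<theta> \<and> ob X \<and> ob Y \<and>
    functional \<U> (FinRank \<U>) X Y \<theta>)"
  by (auto simp: syn_cat_def)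

lemma arr_ob: "f \<in> carr SC \<Longrightarrow> ob (fst f) \<and> ob (fst (snd f))"
  by (auto simp: carr_SC syn_arr_def)

lemma gr_syn_arr:
  assumes "fwf \<U> \<theta> (fst Y + fst X)" "A \<in> models \<U>"
  shows "(xs, ys) \<in> gr A (syn_arr \<U> (FinRank \<U>) X Y \<theta>) \<longleftrightarrow>
    xs \<in> tup A (fst X) \<and> ys \<in> tup A (fst Y) \<and> sat A \<theta> (ys @ xs)"
  using assms by (auto simp: gr_def syn_arr_def fclass_mem tup_append)

lemma gr_defines:
  assumes "fwf \<U> \<theta> (fst Y + fst X)" "A \<in> models \<U>" "defines_fun A X Y \<theta> F"
  shows "(xs, ys) \<in> gr A (syn_arr \<U> (FinRank \<U>) X Y \<theta>) \<longleftrightarrow> xs \<in> pts A X \<and> ys = F xs"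
  unfolding gr_syn_arr[OF assms(1,2)] using assms(3) unfolding defines_fun_def
  by (metis pts_tup)

lemma ap_defines:
  assumes "fwf \<U> \<theta> (fst Y + fst X)" "A \<in> models \<U>" "defines_fun A X Y \<theta> F" "xs \<in> pts A X"
  shows "ap A (syn_arr \<U> (FinRank \<U>) X Y \<theta>) xs = F xs"
  unfolding ap_def gr_defines[OF assms(1-3)] using assms(4) by auto

lemma gr_iff:
  assumes "f \<in> carr SC" "A \<in> models \<U>"
  shows "(xs, ys) \<in> gr A f \<longleftrightarrow> xs \<in> pts A (fst f) \<and> ys = ap A f xs"
proof -
  obtain X Y \<theta> where f: "f = syn_arr \<U> (FinRank \<U>) X Y \<theta>" "ob X" "ob Y" "functional \<U> (FinRank \<U>) X Y \<theta>"
    using assms(1) by (auto simp: carr_SC)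
  then have wf: "fwf \<U> \<theta> (fst Y + fst X)" by (simp add: functional_iff)
  obtain F where F: "defines_fun A X Y \<theta> F"
    using f assms(2) by (auto simp: functional_iff)
  have "fst f = X" by (simp add: f syn_arr_def)
  then show ?thesis
    using gr_defines[OF wf assms(2) F] ap_defines[OF wf assms(2) F] f(1) by metis
qed

lemma ap_pts:
  assumes "f \<in> carr SC" "A \<in> models \<U>" "xs \<in> pts A (fst f)"
  shows "ap A f xs \<in> pts A (fst (snd f))"
proof -
  obtain X Y \<theta> where f: "f = syn_arr \<U> (FinRank \<U>) X Y \<theta>" "ob X" "ob Y" "functional \<U> (FinRank \<U>) X Y \<theta>"
    using assms(1) by (auto simp: carr_SC)
  then have wf: "fwf \<U> \<theta> (fst Y + fst X)" by (simp add: functional_iff)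
  obtain F where F: "defines_fun A X Y \<theta> F"
    using f assms(2) by (auto simp: functional_iff)
  have "fst f = X" "fst (snd f) = Y" by (simp_all add: f syn_arr_def)
  then show ?thesis
    using ap_defines[OF wf assms(2) F] f(1) assms(3) F by (auto simp: defines_fun_def)
qed

lemma syn_arr_eqI:
  assumes "fwf \<U> \<theta> (fst Y + fst X)" "fwf \<U> \<theta>' (fst Y + fst X)"
    "\<And>A ys xs. A \<in> models \<U> \<Longrightarrow> ys \<in> tup A (fst Y) \<Longrightarrow> xs \<in> tup A (fst X) \<Longrightarrow>
       sat A \<theta> (ys @ xs) \<longleftrightarrow> sat A \<theta>' (ys @ xs)"
  shows "syn_arr \<U> (FinRank \<U>) X Y \<theta> = syn_arr \<U> (FinRank \<U>) X Y \<theta>'"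
proof -
  have "\<forall>zs\<in>tup A (fst Y + fst X). sat A \<theta> zs \<longleftrightarrow> sat A \<theta>' zs" if "A \<in> models \<U>" for A
    unfolding tup_split using assms(3)[OF that] by blast
  then have "fclass \<U> (FinRank \<U>) (fst Y + fst X) \<theta> = fclass \<U> (FinRank \<U>) (fst Y + fst X) \<theta>'"
    using assms(1,2) by (intro fclass_eq) auto
  then show ?thesis by (simp add: syn_arr_def)
qed

text \<open>
  Arrows are formulas modulo provable equivalence, and provable equivalence is equality of graphs in all
  models.
\<close>

lemma arr_eqI:
  assumes f: "f \<in> carr SC" and g: "g \<in> carr SC" and eq: "fst f = fst g" "fst (snd f) = fst (snd g)"
    and ap: "\<And>A xs. A \<in> models \<U> \<Longrightarrow> xs \<in> pts A (fst f) \<Longrightarrow> ap A f xs = ap A g xs"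
  shows "f = g"
proof -
  obtain X Y \<theta> where f': "f = syn_arr \<U> (FinRank \<U>) X Y \<theta>" "ob X" "ob Y" "functional \<U> (FinRank \<U>) X Y \<theta>"
    using f by (auto simp: carr_SC)
  obtain X' Y' \<theta>' where g': "g = syn_arr \<U> (FinRank \<U>) X' Y' \<theta>'" "ob X'" "ob Y'" "functional \<U> (FinRank \<U>) X' Y' \<theta>'"
    using g by (auto simp: carr_SC)
  have [simp]: "X' = X" "Y' = Y" using eq f' g' by (auto simp: syn_arr_def)
  have wf: "fwf \<U> \<theta> (fst Y + fst X)" "fwf \<U> \<theta>' (fst Y + fst X)"
    using f' g' by (auto simp: functional_iff)
  have "gr A f = gr A g" if "A \<in> models \<U>" for A
    using gr_iff[OF f that] gr_iff[OF g that] ap[OF that] eq by auto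
  then show ?thesis
    unfolding f'(1) g'(1) using gr_syn_arr[OF wf(1)] gr_syn_arr[OF wf(2)] wf
    by simp (rule syn_arr_eqI; blast)
qed

text \<open>
  The composite of two classes is a union over all pairs of representatives.  All these pairs give
  equivalent formulas, so the union is a single class.
\<close>

lemma syn_comp:
  assumes f: "f \<in> carr SC" and g: "g \<in> carr SC" and fg: "fst (snd f) = fst g"
  shows "ccomp SC g f \<in> carr SC" "fst (ccomp SC g f) = fst f" "fst (snd (ccomp SC g f)) = fst (snd g)"
    and "A \<in> models \<U> \<Longrightarrow> xs \<in> pts A (fst f) \<Longrightarrow> ap A (ccomp SC g f) xs = ap A g (ap A f xs)"
proof -
  obtain X Y \<theta> where f': "f = syn_arr \<U> (FinRank \<U>) X Y \<theta>" "ob X" "ob Y" "functional \<U> (FinRank \<U>) X Y \<theta>"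
    using f by (auto simp: carr_SC)
  obtain Y' Z \<eta> where g': "g = syn_arr \<U> (FinRank \<U>) Y' Z \<eta>" "ob Y'" "ob Z" "functional \<U> (FinRank \<U>) Y' Z \<eta>"
    using g by (auto simp: carr_SC)
  have [simp]: "Y' = Y" using fg f' g' by (auto simp: syn_arr_def)
  have wf: "fwf \<U> \<theta> (fst Y + fst X)" "fwf \<U> \<eta> (fst Z + fst Y)"
    using f' g' by (auto simp: functional_iff)
  let ?h = "fcomp (fst Y) (fst Z) \<eta> \<theta>"
  have wfh: "fwf \<U> ?h (fst Z + fst X)" using wf by (rule fwf_fcomp)
  have same: "syn_arr \<U> (FinRank \<U>) X Z (fcomp (fst Y) (fst Z) \<eta>' \<theta>') = syn_arr \<U> (FinRank \<U>) X Z ?h"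
    if th: "\<theta>' \<in> fclass \<U> (FinRank \<U>) (fst Y + fst X) \<theta>" and et: "\<eta>' \<in> fclass \<U> (FinRank \<U>) (fst Z + fst Y) \<eta>" for \<theta>' \<eta>'
  proof (rule syn_arr_eqI[OF _ wfh])
    have th': "fwf \<U> \<theta>' (fst Y + fst X)" and et': "fwf \<U> \<eta>' (fst Z + fst Y)"
      using th et wf by (auto simp: fclass_mem)
    show "fwf \<U> (fcomp (fst Y) (fst Z) \<eta>' \<theta>') (fst Z + fst X)" using th' et' by (rule fwf_fcomp)
    fix A :: "'u mv" and zs xs assume A: "A \<in> models \<U>" "zs \<in> tup A (fst Z)" "xs \<in> tup A (fst X)"
    then have "length zs = fst Z" "length xs = fst X" by (auto simp: tup_def)
    note [simp] = sat_fcomp[OF wf this] sat_fcomp[OF th' et' this]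
    show "sat A (fcomp (fst Y) (fst Z) \<eta>' \<theta>') (zs @ xs) = sat A ?h (zs @ xs)"
      using th et A wf by (auto simp: fclass_mem tup_append)
  qed
  have "ccomp SC g f = (X, Z, \<Union>\<eta>'\<in>fclass \<U> (FinRank \<U>) (fst Z + fst Y) \<eta>.
      \<Union>\<theta>'\<in>fclass \<U> (FinRank \<U>) (fst Y + fst X) \<theta>.
      fclass \<U> (FinRank \<U>) (fst Z + fst X) (fcomp (fst Y) (fst Z) \<eta>' \<theta>'))"
    by (simp add: syn_cat_def f'(1) g'(1) syn_arr_def)
  also have "\<dots> = (X, Z, \<Union>\<eta>'\<in>fclass \<U> (FinRank \<U>) (fst Z + fst Y) \<eta>.
      \<Union>\<theta>'\<in>fclass \<U> (FinRank \<U>) (fst Y + fst X) \<theta>.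
      fclass \<U> (FinRank \<U>) (fst Z + fst X) ?h)"
    using same by (simp add: syn_arr_def)
  also have "\<dots> = syn_arr \<U> (FinRank \<U>) X Z ?h"
    using fclass_mem[OF wf(1)] fclass_mem[OF wf(2)] wf by (auto simp: syn_arr_def)
  finally have comp: "ccomp SC g f = syn_arr \<U> (FinRank \<U>) X Z ?h" .
  have def: "defines_fun A X Z ?h (G \<circ> F)"
    if A: "A \<in> models \<U>" and F: "defines_fun A X Y \<theta> F" and G: "defines_fun A Y Z \<eta> G" for A F G
    unfolding defines_fun_def
  proof (intro conjI ballI)
    fix xs assume "xs \<in> pts A X"
    then show "(G \<circ> F) xs \<in> pts A Z" using F G by (auto simp: defines_fun_def)
  next
    fix xs zs assume xz: "xs \<in> tup A (fst X)" "zs \<in> tup A (fst Z)"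
    have "sat A ?h (zs @ xs) \<longleftrightarrow> (\<exists>ys\<in>tup A (fst Y). sat A \<theta> (ys @ xs) \<and> sat A \<eta> (zs @ ys))"
      using xz by (intro sat_fcomp[OF wf]) (auto simp: tup_def)
    also have "\<dots> \<longleftrightarrow> (\<exists>ys\<in>tup A (fst Y). (xs \<in> pts A X \<and> ys = F xs) \<and> (ys \<in> pts A Y \<and> zs = G ys))"
      using F G xz by (auto simp: defines_fun_def)
    also have "\<dots> \<longleftrightarrow> xs \<in> pts A X \<and> zs = (G \<circ> F) xs"
      using F by (auto simp: defines_fun_def dest: pts_tup)
    finally show "sat A ?h (zs @ xs) \<longleftrightarrow> xs \<in> pts A X \<and> zs = (G \<circ> F) xs" .
  qed
  have "functional \<U> (FinRank \<U>) X Z ?h"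
    unfolding functional_iff[OF f'(2) g'(3)]
    using wfh def f' g' by (auto simp: functional_iff) blast
  then show "ccomp SC g f \<in> carr SC"
    unfolding comp carr_SC using f' g' by blast
  show "fst (ccomp SC g f) = fst f" "fst (snd (ccomp SC g f)) = fst (snd g)"
    using comp f' g' by (auto simp: syn_arr_def)
  assume A: "A \<in> models \<U>" and xs: "xs \<in> pts A (fst f)"
  obtain F where F: "defines_fun A X Y \<theta> F"
    using f' A by (auto simp: functional_iff)
  obtain G where G: "defines_fun A Y Z \<eta> G"
    using g' A by (auto simp: functional_iff)
  have xs': "xs \<in> pts A X" using xs f' by (simp add: syn_arr_def)
  then have "F xs \<in> pts A Y" using F by (auto simp: defines_fun_def)
  then show "ap A (ccomp SC g f) xs = ap A g (ap A f xs)"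
    unfolding comp unfolding f'(1) g'(1) using xs' ap_defines[OF wfh A def[OF A F G]]
      ap_defines[OF wf(1) A F] ap_defines[OF wf(2) A G] by simp
qed

lemma syn_id:
  assumes X: "ob X"
  shows "cid SC X \<in> carr SC" "fst (cid SC X) = X" "fst (snd (cid SC X)) = X"
    and "A \<in> models \<U> \<Longrightarrow> xs \<in> pts A X \<Longrightarrow> ap A (cid SC X) xs = xs"
proof -
  obtain n \<phi> where X': "X = (n, \<phi>)" by (metis surj_pair)
  have \<phi>: "fwf \<U> \<phi> n" using X X' by simp
  let ?i = "FAnd (fren (\<lambda>i. n + i) \<phi>) (feqs n (\<lambda>i. i) (\<lambda>i. n + i))"
  have i: "cid SC X = syn_arr \<U> (FinRank \<U>) X X ?i"
    by (simp add: syn_cat_def X')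
  have wf: "fwf \<U> ?i (fst X + fst X)"
    using \<phi> by (auto simp: X' intro!: fwf_fren fwf_feqs)
  have "sat A (fren (\<lambda>i. n + i) \<phi>) (ys @ xs) = sat A \<phi> xs" if "length ys = n" for A :: "'u mv" and ys xs
    using that by (intro sat_ren[OF \<phi>]) auto
  then have def: "defines_fun A X X ?i (\<lambda>xs. xs)" for A
    unfolding defines_fun_def by (auto simp: X' pts_def tup_def fsat_feqs nth_append list_eq_iff_nth_eq)
  show "fst (cid SC X) = X" "fst (snd (cid SC X)) = X"
    by (simp_all add: i syn_arr_def)
  show "cid SC X \<in> carr SC"
    unfolding i carr_SC using X wf def functional_iff[OF X X] by blast
  show "A \<in> models \<U> \<Longrightarrow> xs \<in> pts A X \<Longrightarrow> ap A (cid SC X) xs = xs"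
    unfolding i using ap_defines[OF wf _ def] .
qed

lemma syn_category: "category SC"
  unfolding category_def
proof (intro conjI ballI impI; (elim conjE)?)
  fix f g h assume "f \<in> carr SC" "g \<in> carr SC" "h \<in> carr SC" "ccod SC f = cdom SC g" "ccod SC g = cdom SC h"
  then show "ccomp SC h (ccomp SC g f) = ccomp SC (ccomp SC h g) f"
    using ap_pts[of f] by (intro arr_eqI) (simp_all add: syn_comp)
next
  fix f assume f: "f \<in> carr SC"
  then have ob: "ob (fst f)" "ob (fst (snd f))" by (auto dest: arr_ob)
  show "ccomp SC f (cid SC (cdom SC f)) = f"
    using f syn_comp[OF syn_id(1)[OF ob(1)] f] syn_id[OF ob(1)] by (intro arr_eqI) auto
  show "ccomp SC (cid SC (ccod SC f)) f = f"
    using f syn_comp[OF f syn_id(1)[OF ob(2)]] syn_id[OF ob(2)] ap_pts by (intro arr_eqI) auto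
qed (use syn_comp syn_id arr_ob cobj_SC in auto)

end

section \<open>Definable relations, fibre products and covers\<close>

context set_universe
begin

text \<open>
  A relation is definable if one formula defines it uniformly in all models.  The closure properties
  below produce formulas without naming them, which keeps the renaming of de Bruijn indices out of all
  later constructions.
\<close>

definition dfn :: "nat \<Rightarrow> ('u mv \<Rightarrow> 'u list \<Rightarrow> bool) \<Rightarrow> bool" where
  "dfn n R \<longleftrightarrow> (\<exists>\<phi>. fwf \<U> \<phi> n \<and> (\<forall>A\<in>models \<U>. \<forall>xs\<in>tup A n. sat A \<phi> xs \<longleftrightarrow> R A xs))"

lemma dfnI: "fwf \<U> \<phi> n \<Longrightarrow> (\<And>A xs. A \<in> models \<U> \<Longrightarrow> xs \<in> tup A n \<Longrightarrow> sat A \<phi> xs \<longleftrightarrow> R A xs) \<Longrightarrow> dfn n R"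
  unfolding dfn_def by blast

lemma dfn_cong: "dfn n R \<Longrightarrow> (\<And>A xs. A \<in> models \<U> \<Longrightarrow> xs \<in> tup A n \<Longrightarrow> R A xs \<longleftrightarrow> R' A xs) \<Longrightarrow> dfn n R'"
  unfolding dfn_def by blast

lemma dfn_conj:
  assumes "dfn n R" "dfn n R'"
  shows "dfn n (\<lambda>A xs. R A xs \<and> R' A xs)"
proof -
  obtain \<phi> \<psi> where "fwf \<U> \<phi> n" "\<forall>A\<in>models \<U>. \<forall>xs\<in>tup A n. sat A \<phi> xs \<longleftrightarrow> R A xs"
    "fwf \<U> \<psi> n" "\<forall>A\<in>models \<U>. \<forall>xs\<in>tup A n. sat A \<psi> xs \<longleftrightarrow> R' A xs"
    using assms unfolding dfn_def by blast
  then show ?thesis by (intro dfnI[of "FAnd \<phi> \<psi>"]) auto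
qed

lemma dfn_or:
  assumes "K \<in> \<U>" "\<And>k. k \<in> K \<Longrightarrow> dfn n (R k)"
  shows "dfn n (\<lambda>A xs. \<exists>k\<in>K. R k A xs)"
proof -
  obtain F where "\<And>k. k \<in> K \<Longrightarrow> fwf \<U> (F k) n \<and> (\<forall>A\<in>models \<U>. \<forall>xs\<in>tup A n. sat A (F k) xs \<longleftrightarrow> R k A xs)"
    using assms(2) unfolding dfn_def by metis
  then show ?thesis using assms(1) by (intro dfnI[of "FOr K F"]) auto
qed

lemma dfn_ex:
  assumes "dfn (m + n) R"
  shows "dfn n (\<lambda>A xs. \<exists>ys\<in>tup A m. R A (ys @ xs))"
proof -
  obtain \<phi> where \<phi>: "fwf \<U> \<phi> (m + n)" "\<forall>A\<in>models \<U>. \<forall>xs\<in>tup A (m + n). sat A \<phi> xs \<longleftrightarrow> R A xs"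
    using assms unfolding dfn_def by blast
  then show ?thesis
    by (intro dfnI[of "fexs m \<phi>"]) (auto simp: fwf_fexs sat_fexs[OF \<phi>(1) tup_length] tup_append)
qed

lemma dfn_ren:
  assumes "dfn n R" "\<And>i. i < n \<Longrightarrow> \<rho> i < m"
  shows "dfn m (\<lambda>A xs. R A (map (\<lambda>i. xs ! \<rho> i) [0..<n]))"
proof -
  obtain \<phi> where \<phi>: "fwf \<U> \<phi> n" "\<forall>A\<in>models \<U>. \<forall>xs\<in>tup A n. sat A \<phi> xs \<longleftrightarrow> R A xs"
    using assms unfolding dfn_def by blast
  show ?thesis
  proof (rule dfnI[of "fren \<rho> \<phi>"])
    show "fwf \<U> (fren \<rho> \<phi>) m" using \<phi> assms by (intro fwf_fren)
    fix A :: "'u mv" and xs assume "A \<in> models \<U>" "xs \<in> tup A m"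
    moreover have "sat A (fren \<rho> \<phi>) xs = sat A \<phi> (map (\<lambda>i. xs ! \<rho> i) [0..<n])"
      by (intro sat_ren[OF \<phi>(1)]) auto
    ultimately show "sat A (fren \<rho> \<phi>) xs = R A (map (\<lambda>i. xs ! \<rho> i) [0..<n])"
      using \<phi>(2) tup_map_nth[of xs A m n \<rho>] assms(2) by auto
  qed
qed

lemma dfn_slices:
  assumes "dfn (a + b) R" "i + a \<le> m" "j + b \<le> m"
  shows "dfn m (\<lambda>A zs. R A (take a (drop i zs) @ take b (drop j zs)))"
proof -
  have "dfn m (\<lambda>A xs. R A (map (\<lambda>k. xs ! (if k < a then i + k else j + (k - a))) [0..<a + b]))"
    using assms by (intro dfn_ren) auto
  then show ?thesis
  proof (rule dfn_cong)
    fix A :: "'u mv" and xs assume "xs \<in> tup A m"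
    then have "map (\<lambda>k. xs ! (if k < a then i + k else j + (k - a))) [0..<a + b] =
      take a (drop i xs) @ take b (drop j xs)"
      using assms by (intro nth_equalityI) (auto simp: tup_def nth_append)
    then show "R A (map (\<lambda>k. xs ! (if k < a then i + k else j + (k - a))) [0..<a + b]) =
      R A (take a (drop i xs) @ take b (drop j xs))" by simp
  qed
qed

lemma dfn_slice:
  assumes "dfn a R" "i + a \<le> m"
  shows "dfn m (\<lambda>A zs. R A (take a (drop i zs)))"
  using dfn_slices[of a 0 R i m 0] assms by simp

lemma dfn_eq:
  assumes "i + k \<le> m" "j + k \<le> m"
  shows "dfn m (\<lambda>A zs. take k (drop i zs) = take k (drop j zs))"
proof (rule dfnI[of "feqs k (\<lambda>l. i + l) (\<lambda>l. j + l)"])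
  show "fwf \<U> (feqs k (\<lambda>l. i + l) (\<lambda>l. j + l)) m" using assms by (intro fwf_feqs) auto
  fix A :: "'u mv" and xs assume "xs \<in> tup A m"
  then show "sat A (feqs k (\<lambda>l. i + l) (\<lambda>l. j + l) :: 'u gform) xs = (take k (drop i xs) = take k (drop j xs))"
    using assms by (auto simp: fsat_feqs tup_def list_eq_iff_nth_eq)
qed

lemma dfn_pts: "ob X \<Longrightarrow> dfn (fst X) (\<lambda>A xs. xs \<in> pts A X)"
  by (rule dfnI[of "snd X"]) (auto simp: pts_def)

lemma dfn_gr:
  assumes "f \<in> carr SC" "i + fst (fst (snd f)) \<le> l" "j + fst (fst f) \<le> l"
  shows "dfn l (\<lambda>A zs. (take (fst (fst f)) (drop j zs), take (fst (fst (snd f))) (drop i zs)) \<in> gr A f)"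
proof -
  obtain X Y \<theta> where f: "f = syn_arr \<U> (FinRank \<U>) X Y \<theta>" "ob X" "ob Y" "functional \<U> (FinRank \<U>) X Y \<theta>"
    using assms(1) by (auto simp: carr_SC)
  then have wf: "fwf \<U> \<theta> (fst Y + fst X)" by (simp add: functional_iff)
  have XY: "fst f = X" "fst (snd f) = Y" by (simp_all add: f syn_arr_def)
  have "dfn (fst Y + fst X) (\<lambda>A zs. (drop (fst Y) zs, take (fst Y) zs) \<in> gr A f)"
  proof (rule dfnI[OF wf])
    fix A :: "'u mv" and zs assume A: "A \<in> models \<U>" and "zs \<in> tup A (fst Y + fst X)"
    then have "drop (fst Y) zs \<in> tup A (fst X)" "take (fst Y) zs \<in> tup A (fst Y)"
      by (auto simp: tup_def dest: in_set_takeD in_set_dropD)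
    then show "sat A \<theta> zs = ((drop (fst Y) zs, take (fst Y) zs) \<in> gr A f)"
      unfolding f(1) gr_syn_arr[OF wf A] by simp
  qed
  from dfn_slices[OF this assms(2,3)[unfolded XY]] show ?thesis
    unfolding XY
    by (rule dfn_cong) (use assms(2,3) XY in \<open>auto simp: tup_def\<close>)
qed

lemma ob_ex:
  assumes "dfn n R"
  shows "\<exists>X. ob X \<and> fst X = n \<and> (\<forall>A\<in>models \<U>. pts A X = {xs \<in> tup A n. R A xs})"
proof -
  obtain \<phi> where \<phi>: "fwf \<U> \<phi> n" "\<forall>A\<in>models \<U>. \<forall>xs\<in>tup A n. sat A \<phi> xs \<longleftrightarrow> R A xs"
    using assms unfolding dfn_def by blast
  then show ?thesis
    by (intro HOL.exI[of _ "(n, \<phi>)"]) (auto simp: pts_def)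
qed

lemma arr_ex:
  assumes "ob X" "ob Y" "dfn (fst Y + fst X) R"
    and F: "\<And>A xs. A \<in> models \<U> \<Longrightarrow> xs \<in> pts A X \<Longrightarrow> F A xs \<in> pts A Y"
    and R: "\<And>A xs ys. A \<in> models \<U> \<Longrightarrow> xs \<in> tup A (fst X) \<Longrightarrow> ys \<in> tup A (fst Y) \<Longrightarrow>
       R A (ys @ xs) \<longleftrightarrow> xs \<in> pts A X \<and> ys = F A xs"
  shows "\<exists>f\<in>carr SC. fst f = X \<and> fst (snd f) = Y \<and> (\<forall>A\<in>models \<U>. \<forall>xs\<in>pts A X. ap A f xs = F A xs)"
proof -
  obtain \<theta> where \<theta>: "fwf \<U> \<theta> (fst Y + fst X)"
    "\<forall>A\<in>models \<U>. \<forall>xs\<in>tup A (fst Y + fst X). sat A \<theta> xs \<longleftrightarrow> R A xs"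
    using assms(3) unfolding dfn_def by blast
  have def: "defines_fun A X Y \<theta> (F A)" if "A \<in> models \<U>" for A
    unfolding defines_fun_def using \<theta>(2) that F R by (auto simp: tup_append)
  then have fn: "functional \<U> (FinRank \<U>) X Y \<theta>"
    unfolding functional_iff[OF assms(1,2)] using \<theta>(1) by blast
  show ?thesis
  proof (intro bexI conjI ballI)
    show "syn_arr \<U> (FinRank \<U>) X Y \<theta> \<in> carr SC" using fn assms(1,2) unfolding carr_SC by blast
  qed (auto simp: syn_arr_def[of _ _ _ _ \<theta>] ap_defines[OF \<theta>(1) _ def, unfolded syn_arr_def])
qed

text \<open>
  The fibre product of two definable functions is the definable set of pairs with equal images; a tuple
  of it is the concatenation of the two parts.  Its points are what makes gluing along a cover
  well defined: two preimages of one point, in two members of the cover, come from a common point.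
\<close>

lemma fibre_product:
  assumes f: "f \<in> carr SC" and g: "g \<in> carr SC" and fg: "fst (snd f) = fst (snd g)"
  obtains p q where "p \<in> carr SC" "q \<in> carr SC" "fst p = fst q" "fst (snd p) = fst f" "fst (snd q) = fst g"
    "ccomp SC f p = ccomp SC g q"
    "\<And>A xs ys. A \<in> models \<U> \<Longrightarrow> xs \<in> pts A (fst f) \<Longrightarrow> ys \<in> pts A (fst g) \<Longrightarrow> ap A f xs = ap A g ys \<Longrightarrow>
      \<exists>v\<in>pts A (fst p). ap A p v = xs \<and> ap A q v = ys"
proof -
  define n1 n2 m where "n1 = fst (fst f)" and "n2 = fst (fst g)" and "m = fst (fst (snd g))"
  define R :: "'u mv \<Rightarrow> 'u list \<Rightarrow> bool" where "R = (\<lambda>A v. \<exists>w\<in>tup A m. (take n1 v, w) \<in> gr A f \<and> (drop n1 v, w) \<in> gr A g)"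
  have "dfn (m + (n1 + n2)) (\<lambda>A zs. (take n1 (drop m zs), take m (drop 0 zs)) \<in> gr A f \<and>
      (take n2 (drop (m + n1) zs), take m (drop 0 zs)) \<in> gr A g)"
    using dfn_gr[OF f, of 0 "m + (n1 + n2)" m] dfn_gr[OF g, of 0 "m + (n1 + n2)" "m + n1"]
    by (intro dfn_conj) (auto simp: n1_def n2_def m_def fg)
  then have "dfn (n1 + n2) (\<lambda>A v. \<exists>w\<in>tup A m. (take n1 (drop m (w @ v)), take m (drop 0 (w @ v))) \<in> gr A f \<and>
      (take n2 (drop (m + n1) (w @ v)), take m (drop 0 (w @ v))) \<in> gr A g)"
    by (rule dfn_ex)
  then have R: "dfn (n1 + n2) R"
    by (rule dfn_cong) (auto simp: R_def tup_def)
  then obtain P where P: "ob P" "fst P = n1 + n2" "\<And>A. A \<in> models \<U> \<Longrightarrow> pts A P = {xs \<in> tup A (n1 + n2). R A xs}"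
    using ob_ex by blast
  have obs: "ob (fst f)" "ob (fst g)" using f g arr_ob by auto
  have PP: "dfn (k + (n1 + n2)) (\<lambda>A zs. drop k zs \<in> pts A P)" for k
    using dfn_slice[OF dfn_pts[OF P(1)], of k "k + (n1 + n2)"]
    by (rule dfn_cong[OF _]) (auto simp: P(2) tup_def)
  have mem: "v \<in> pts A P \<longleftrightarrow> v \<in> tup A (n1 + n2) \<and> take n1 v \<in> pts A (fst f) \<and> drop n1 v \<in> pts A (fst g) \<and>
      ap A f (take n1 v) = ap A g (drop n1 v)" if A: "A \<in> models \<U>" for A v
    using pts_tup[OF ap_pts[OF f A]]
    by (auto simp: P(3)[OF A] R_def gr_iff[OF f A] gr_iff[OF g A] fg m_def)
  have "\<exists>p\<in>carr SC. fst p = P \<and> fst (snd p) = fst f \<and> (\<forall>A\<in>models \<U>. \<forall>xs\<in>pts A P. ap A p xs = take n1 xs)"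
  proof (rule arr_ex[OF P(1) obs(1), of "\<lambda>A zs. take n1 (drop 0 zs) = take n1 (drop n1 zs) \<and> drop n1 zs \<in> pts A P"])
    show "dfn (fst (fst f) + fst P) (\<lambda>A zs. take n1 (drop 0 zs) = take n1 (drop n1 zs) \<and> drop n1 zs \<in> pts A P)"
      unfolding P(2) n1_def[symmetric] by (intro dfn_conj dfn_eq PP) auto
  qed (auto simp: mem n1_def tup_def)
  then obtain p where p: "p \<in> carr SC" "fst p = P" "fst (snd p) = fst f"
    "\<And>A xs. A \<in> models \<U> \<Longrightarrow> xs \<in> pts A P \<Longrightarrow> ap A p xs = take n1 xs" by blast
  have "\<exists>q\<in>carr SC. fst q = P \<and> fst (snd q) = fst g \<and> (\<forall>A\<in>models \<U>. \<forall>xs\<in>pts A P. ap A q xs = drop n1 xs)"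
  proof (rule arr_ex[OF P(1) obs(2), of "\<lambda>A zs. take n2 (drop 0 zs) = take n2 (drop (n2 + n1) zs) \<and> drop n2 zs \<in> pts A P"])
    show "dfn (fst (fst g) + fst P) (\<lambda>A zs. take n2 (drop 0 zs) = take n2 (drop (n2 + n1) zs) \<and> drop n2 zs \<in> pts A P)"
      unfolding P(2) n2_def[symmetric] by (intro dfn_conj dfn_eq PP) auto
  qed (auto simp: mem n2_def tup_def)
  then obtain q where q: "q \<in> carr SC" "fst q = P" "fst (snd q) = fst g"
    "\<And>A xs. A \<in> models \<U> \<Longrightarrow> xs \<in> pts A P \<Longrightarrow> ap A q xs = drop n1 xs" by blast
  show ?thesis
  proof (rule that[OF p(1) q(1)])
    note cf = syn_comp[OF p(1) f p(3)] and cg = syn_comp[OF q(1) g q(3)]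
    show "ccomp SC f p = ccomp SC g q"
      using cf cg p q mem by (intro arr_eqI) (auto simp: fg)
    fix A :: "'u mv" and xs ys
    assume A: "A \<in> models \<U>" and xs: "xs \<in> pts A (fst f)" and ys: "ys \<in> pts A (fst g)" and eq: "ap A f xs = ap A g ys"
    have "length xs = n1" using pts_tup[OF xs] by (simp add: tup_def n1_def)
    then have "xs @ ys \<in> pts A P"
      using xs ys eq pts_tup[OF xs] pts_tup[OF ys] by (auto simp: mem[OF A] n1_def n2_def tup_append)
    then show "\<exists>v\<in>pts A (fst p). ap A p v = xs \<and> ap A q v = ys"
      using p q A \<open>length xs = n1\<close> by (intro bexI[of _ "xs @ ys"]) auto
  qed (auto simp: p q)
qed

abbreviation "ST \<equiv> syn_top \<U> (FinRank \<U>)"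

text \<open>
  Provability of the disjunction of the images says that the chosen members of the sieve are jointly
  surjective on points of every model.
\<close>

lemma cover_iff:
  assumes Y: "ob Y"
  shows "S \<in> ST Y \<longleftrightarrow> sieve SC Y S \<and> (\<exists>K\<in>\<U>. \<exists>F. (\<forall>k\<in>K. F k \<in> S) \<and>
    (\<forall>A\<in>models \<U>. \<forall>ys\<in>pts A Y. \<exists>k\<in>K. \<exists>xs\<in>pts A (fst (F k)). ap A (F k) xs = ys))"
proof -
  obtain m \<psi> where Y': "Y = (m, \<psi>)" by (metis surj_pair)
  have \<psi>: "fwf \<U> \<psi> m" using Y Y' by simp
  have key: "prov \<U> (FinRank \<U>) m \<psi> (FOr K (\<lambda>k. fimage (fst (X k)) m (\<theta> k))) \<longleftrightarrow>
     (\<forall>A\<in>models \<U>. \<forall>ys\<in>pts A Y. \<exists>k\<in>K. \<exists>xs\<in>pts A (X k). ap A (syn_arr \<U> (FinRank \<U>) (X k) Y (\<theta> k)) xs = ys)"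
    if K: "K \<in> \<U>" and X: "\<And>k. k \<in> K \<Longrightarrow> ob (X k) \<and> functional \<U> (FinRank \<U>) (X k) Y (\<theta> k)" for K X \<theta>
  proof -
    have wf: "fwf \<U> (\<theta> k) (m + fst (X k))" if "k \<in> K" for k
      using X[OF that] functional_iff[OF _ Y, of "X k" "\<theta> k"] by (simp add: Y')
    have arr: "syn_arr \<U> (FinRank \<U>) (X k) Y (\<theta> k) \<in> carr SC" if "k \<in> K" for k
      using X[OF that] Y unfolding carr_SC by blast
    have sat: "sat A (fimage (fst (X k)) m (\<theta> k)) ys \<longleftrightarrow>
      (\<exists>xs\<in>pts A (X k). ap A (syn_arr \<U> (FinRank \<U>) (X k) Y (\<theta> k)) xs = ys)"
      if "k \<in> K" "A \<in> models \<U>" "ys \<in> tup A m" for k A ys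
    proof -
      have "sat A (fimage (fst (X k)) m (\<theta> k)) ys \<longleftrightarrow> (\<exists>xs\<in>tup A (fst (X k)). sat A (\<theta> k) (ys @ xs))"
        using that by (intro sat_fimage[OF wf]) (auto simp: tup_def)
      also have "\<dots> \<longleftrightarrow> (\<exists>xs\<in>tup A (fst (X k)). (xs, ys) \<in> gr A (syn_arr \<U> (FinRank \<U>) (X k) Y (\<theta> k)))"
        using that wf[OF that(1)] by (simp add: gr_syn_arr Y')
      also have "\<dots> \<longleftrightarrow> (\<exists>xs\<in>pts A (X k). ap A (syn_arr \<U> (FinRank \<U>) (X k) Y (\<theta> k)) xs = ys)"
        unfolding gr_iff[OF arr[OF that(1)] that(2)]
        by (auto simp: syn_arr_def pts_tup)
      finally show ?thesis .
    qed
    have "fwf \<U> (FOr K (\<lambda>k. fimage (fst (X k)) m (\<theta> k))) m"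
      using K wf by (auto intro: fwf_fimage)
    then show ?thesis
      unfolding prov_iff using \<psi> sat by (auto simp: Y' pts_def)
  qed
  show ?thesis
  proof
    assume "S \<in> ST Y"
    then obtain K X \<theta> where S: "sieve SC Y S" and K: "K \<in> \<U>"
      and X: "\<forall>k\<in>K. X k \<in> cobj SC \<and> functional \<U> (FinRank \<U>) (X k) Y (\<theta> k) \<and> syn_arr \<U> (FinRank \<U>) (X k) Y (\<theta> k) \<in> S"
      and p: "prov \<U> (FinRank \<U>) m \<psi> (FOr K (\<lambda>k. fimage (fst (X k)) m (\<theta> k)))"
      by (auto simp: syn_top_def Y')
    have "\<forall>A\<in>models \<U>. \<forall>ys\<in>pts A Y. \<exists>k\<in>K. \<exists>xs\<in>pts A (X k). ap A (syn_arr \<U> (FinRank \<U>) (X k) Y (\<theta> k)) xs = ys"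
      using p key[OF K, of X \<theta>] X by (simp add: cobj_SC)
    moreover have "fst (syn_arr \<U> (FinRank \<U>) (X k) Y (\<theta> k)) = X k" for k by (simp add: syn_arr_def)
    ultimately show "sieve SC Y S \<and> (\<exists>K\<in>\<U>. \<exists>F. (\<forall>k\<in>K. F k \<in> S) \<and>
    (\<forall>A\<in>models \<U>. \<forall>ys\<in>pts A Y. \<exists>k\<in>K. \<exists>xs\<in>pts A (fst (F k)). ap A (F k) xs = ys))"
      using S K X by (intro conjI bexI[of _ K] HOL.exI[of _ "\<lambda>k. syn_arr \<U> (FinRank \<U>) (X k) Y (\<theta> k)"]) auto
  next
    assume "sieve SC Y S \<and> (\<exists>K\<in>\<U>. \<exists>F. (\<forall>k\<in>K. F k \<in> S) \<and>
    (\<forall>A\<in>models \<U>. \<forall>ys\<in>pts A Y. \<exists>k\<in>K. \<exists>xs\<in>pts A (fst (F k)). ap A (F k) xs = ys))"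
    then obtain K F where S: "sieve SC Y S" and K: "K \<in> \<U>" "\<forall>k\<in>K. F k \<in> S"
      and F: "\<forall>A\<in>models \<U>. \<forall>ys\<in>pts A Y. \<exists>k\<in>K. \<exists>xs\<in>pts A (fst (F k)). ap A (F k) xs = ys" by blast
    have "\<exists>X \<theta>. F k = syn_arr \<U> (FinRank \<U>) X Y \<theta> \<and> ob X \<and> functional \<U> (FinRank \<U>) X Y \<theta>" if "k \<in> K" for k
    proof -
      have "F k \<in> carr SC" "fst (snd (F k)) = Y" using S K that by (auto simp: sieve_def)
      then show ?thesis unfolding carr_SC by (auto simp: syn_arr_def)
    qed
    then obtain X \<theta> where X: "\<And>k. k \<in> K \<Longrightarrow> F k = syn_arr \<U> (FinRank \<U>) (X k) Y (\<theta> k) \<and> ob (X k) \<and>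
       functional \<U> (FinRank \<U>) (X k) Y (\<theta> k)" by metis
    then have "\<forall>k\<in>K. fst (F k) = X k" by (simp add: syn_arr_def)
    then have "prov \<U> (FinRank \<U>) m \<psi> (FOr K (\<lambda>k. fimage (fst (X k)) m (\<theta> k)))"
      using key[OF K(1), of X \<theta>] X F by auto
    moreover have "\<forall>k\<in>K. X k \<in> cobj SC \<and> functional \<U> (FinRank \<U>) (X k) Y (\<theta> k) \<and> syn_arr \<U> (FinRank \<U>) (X k) Y (\<theta> k) \<in> S"
      using X K by (auto simp: cobj_SC)
    ultimately show "S \<in> ST Y"
      using S K(1) by (auto simp: syn_top_def Y')
  qed
qed

end

section \<open>Jointly epic families and irreducible objects\<close>

context
  fixes C :: "('o, 'm) cat"
  assumes C: "category C"
begin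

lemma cat_arr: "f \<in> carr C \<Longrightarrow> cdom C f \<in> cobj C" "f \<in> carr C \<Longrightarrow> ccod C f \<in> cobj C"
  using C by (auto simp: category_def)

lemma cat_id: "X \<in> cobj C \<Longrightarrow> cid C X \<in> carr C" "X \<in> cobj C \<Longrightarrow> cdom C (cid C X) = X"
  "X \<in> cobj C \<Longrightarrow> ccod C (cid C X) = X"
  using C by (auto simp: category_def)

lemma cat_comp:
  assumes "f \<in> carr C" "g \<in> carr C" "ccod C f = cdom C g"
  shows "ccomp C g f \<in> carr C" "cdom C (ccomp C g f) = cdom C f" "ccod C (ccomp C g f) = ccod C g"
  using C assms by (auto simp: category_def)

lemma cat_unit: "f \<in> carr C \<Longrightarrow> ccomp C f (cid C (cdom C f)) = f"
  "f \<in> carr C \<Longrightarrow> ccomp C (cid C (ccod C f)) f = f"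
  using C by (auto simp: category_def)

lemma cat_assoc:
  "f \<in> carr C \<Longrightarrow> g \<in> carr C \<Longrightarrow> h \<in> carr C \<Longrightarrow> ccod C f = cdom C g \<Longrightarrow> ccod C g = cdom C h \<Longrightarrow>
   ccomp C (ccomp C h g) f = ccomp C h (ccomp C g f)"
  using C by (simp add: category_def)

lemma iso_cancel_left:
  assumes i: "is_iso C i" and fg: "f \<in> carr C" "g \<in> carr C" "ccod C f = cdom C i" "ccod C g = cdom C i"
    "ccomp C i f = ccomp C i g"
  shows "f = g"
proof -
  obtain j where j: "j \<in> carr C" "cdom C j = ccod C i" "ccod C j = cdom C i" "ccomp C j i = cid C (cdom C i)"
    using i by (auto simp: is_iso_def)
  have i': "i \<in> carr C" using i by (simp add: is_iso_def)
  have "f = ccomp C (ccomp C j i) f" "g = ccomp C (ccomp C j i) g"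
    using fg by (auto simp: j(4) cat_unit[symmetric] dest!: cat_unit(2)) 
  then show ?thesis
    using i' j fg by (metis cat_assoc)
qed

lemma iso_cancel_right:
  assumes i: "is_iso C i" and fg: "f \<in> carr C" "g \<in> carr C" "cdom C f = ccod C i" "cdom C g = ccod C i"
    "ccomp C f i = ccomp C g i"
  shows "f = g"
proof -
  obtain j where j: "j \<in> carr C" "cdom C j = ccod C i" "ccod C j = cdom C i" "ccomp C i j = cid C (ccod C i)"
    using i by (auto simp: is_iso_def)
  have i': "i \<in> carr C" using i by (simp add: is_iso_def)
  have "f = ccomp C f (ccomp C i j)" "g = ccomp C g (ccomp C i j)"
    using fg cat_unit(1)[of f] cat_unit(1)[of g] by (auto simp: j(4))
  then show ?thesis
    using i' j fg by (metis cat_assoc)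
qed

end

text \<open>
  Both notions are formulated with arrows only, so that equivalences preserve them.  An object is
  irreducible if every jointly epic family onto it contains a split epimorphism.
\<close>

definition jointly_epic :: "('o, 'm) cat \<Rightarrow> 'o \<Rightarrow> 'm set \<Rightarrow> bool" where
  "jointly_epic C X F \<longleftrightarrow> (\<forall>f\<in>F. f \<in> carr C \<and> ccod C f = X) \<and>
     (\<forall>u\<in>carr C. \<forall>v\<in>carr C. cdom C u = X \<longrightarrow> cdom C v = X \<longrightarrow> ccod C u = ccod C v \<longrightarrow>
        (\<forall>f\<in>F. ccomp C u f = ccomp C v f) \<longrightarrow> u = v)"

definition irreducible_ob :: "('o, 'm) cat \<Rightarrow> 'o \<Rightarrow> bool" where
  "irreducible_ob C X \<longleftrightarrow> (\<forall>F. jointly_epic C X F \<longrightarrow>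
     (\<exists>f\<in>F. \<exists>s\<in>carr C. cdom C s = X \<and> ccod C s = cdom C f \<and> ccomp C f s = cid C X))"

text \<open>
  The definition of an equivalence orients one of the two natural isomorphisms towards the identity and
  the other away from it.  Reversing the latter makes the situation symmetric in the two categories, so
  that each transport lemma below can also be used with the roles exchanged.
\<close>

lemma nat_isomorphic_sym:
  assumes D: "category D" and F: "is_functor C D Fo Fa" and G: "is_functor C D Go Ga" and C: "category C"
    and n: "nat_isomorphic C D Fo Fa Go Ga"
  shows "nat_isomorphic C D Go Ga Fo Fa"
proof -
  obtain \<eta> where \<eta>: "\<forall>X\<in>cobj C. is_iso D (\<eta> X) \<and> cdom D (\<eta> X) = Fo X \<and> ccod D (\<eta> X) = Go X"
    and nat: "\<forall>f\<in>carr C. ccomp D (Ga f) (\<eta> (cdom C f)) = ccomp D (\<eta> (ccod C f)) (Fa f)"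
    using n by (auto simp: nat_isomorphic_def)
  then have "\<forall>X\<in>cobj C. \<exists>g. is_iso D g \<and> cdom D g = Go X \<and> ccod D g = Fo X \<and>
     ccomp D g (\<eta> X) = cid D (Fo X) \<and> ccomp D (\<eta> X) g = cid D (Go X)"
    by (metis is_iso_def)
  then obtain \<epsilon> where \<epsilon>: "\<forall>X\<in>cobj C. is_iso D (\<epsilon> X) \<and> cdom D (\<epsilon> X) = Go X \<and> ccod D (\<epsilon> X) = Fo X \<and>
     ccomp D (\<epsilon> X) (\<eta> X) = cid D (Fo X) \<and> ccomp D (\<eta> X) (\<epsilon> X) = cid D (Go X)"
    by metis
  have "ccomp D (Fa f) (\<epsilon> (cdom C f)) = ccomp D (\<epsilon> (ccod C f)) (Ga f)" if f: "f \<in> carr C" for f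
  proof (rule iso_cancel_right[OF D])
    let ?X = "cdom C f" and ?Y = "ccod C f"
    have XY: "?X \<in> cobj C" "?Y \<in> cobj C" using f C by (auto simp: category_def)
    have fs: "Fa f \<in> carr D" "cdom D (Fa f) = Fo ?X" "ccod D (Fa f) = Fo ?Y"
      "Ga f \<in> carr D" "cdom D (Ga f) = Go ?X" "ccod D (Ga f) = Go ?Y"
      using f F G by (auto simp: is_functor_def)
    have ar: "\<eta> ?X \<in> carr D" "\<eta> ?Y \<in> carr D" "\<epsilon> ?X \<in> carr D" "\<epsilon> ?Y \<in> carr D"
      using XY \<eta> \<epsilon> by (auto simp: is_iso_def)
    note t = \<eta>[THEN bspec, OF XY(1)] \<eta>[THEN bspec, OF XY(2)] \<epsilon>[THEN bspec, OF XY(1)] \<epsilon>[THEN bspec, OF XY(2)]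
    show "is_iso D (\<eta> ?X)" using t by blast
    show "ccomp D (Fa f) (\<epsilon> ?X) \<in> carr D" "ccomp D (\<epsilon> ?Y) (Ga f) \<in> carr D"
      "cdom D (ccomp D (Fa f) (\<epsilon> ?X)) = ccod D (\<eta> ?X)"
      "cdom D (ccomp D (\<epsilon> ?Y) (Ga f)) = ccod D (\<eta> ?X)"
      using fs ar t by (simp_all add: cat_comp[OF D])
    have "ccomp D (ccomp D (Fa f) (\<epsilon> ?X)) (\<eta> ?X) = Fa f"
      using fs ar t cat_unit(1)[OF D fs(1)] by (simp add: cat_assoc[OF D])
    moreover have "ccomp D (ccomp D (\<epsilon> ?Y) (Ga f)) (\<eta> ?X) = ccomp D (\<epsilon> ?Y) (ccomp D (\<eta> ?Y) (Fa f))"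
      using fs ar t nat f by (simp add: cat_assoc[OF D])
    moreover have "ccomp D (\<epsilon> ?Y) (ccomp D (\<eta> ?Y) (Fa f)) = ccomp D (ccomp D (\<epsilon> ?Y) (\<eta> ?Y)) (Fa f)"
      using fs ar t by (intro cat_assoc[OF D, symmetric]) auto
    moreover have "\<dots> = Fa f"
      using fs t cat_unit(2)[OF D fs(1)] by simp
    ultimately show "ccomp D (ccomp D (Fa f) (\<epsilon> ?X)) (\<eta> ?X) = ccomp D (ccomp D (\<epsilon> ?Y) (Ga f)) (\<eta> ?X)"
      by simp
  qed
  then show ?thesis
    unfolding nat_isomorphic_def using \<epsilon> by blast
qed

locale cat_equiv =
  fixes E :: "('o, 'm) cat" and P :: "('p, 'n) cat" and Fo Fa Go Ga
  assumes E: "category E" and P: "category P"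
    and F: "is_functor E P Fo Fa" and G: "is_functor P E Go Ga"
    and GF: "nat_isomorphic E E (Go \<circ> Fo) (Ga \<circ> Fa) id id"
    and FG: "nat_isomorphic P P (Fo \<circ> Go) (Fa \<circ> Ga) id id"
begin

lemma cat_equiv_sym: "cat_equiv P E Go Ga Fo Fa"
  using E P F G GF FG by unfold_locales

lemma F_arr: "f \<in> carr E \<Longrightarrow> Fa f \<in> carr P" "f \<in> carr E \<Longrightarrow> cdom P (Fa f) = Fo (cdom E f)"
   "f \<in> carr E \<Longrightarrow> ccod P (Fa f) = Fo (ccod E f)"
  using F by (auto simp: is_functor_def)

lemma F_comp: "f \<in> carr E \<Longrightarrow> g \<in> carr E \<Longrightarrow> ccod E f = cdom E g \<Longrightarrow> Fa (ccomp E g f) = ccomp P (Fa g) (Fa f)"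
  using F by (auto simp: is_functor_def)

lemma F_id: "X \<in> cobj E \<Longrightarrow> Fa (cid E X) = cid P (Fo X)"
  using F by (auto simp: is_functor_def)

lemma F_obj: "X \<in> cobj E \<Longrightarrow> Fo X \<in> cobj P"
  using F by (auto simp: is_functor_def)

definition counit :: "'o \<Rightarrow> 'm" where
  "counit = (SOME \<eta>. (\<forall>X\<in>cobj E. is_iso E (\<eta> X) \<and> cdom E (\<eta> X) = Go (Fo X) \<and> ccod E (\<eta> X) = X) \<and>
     (\<forall>f\<in>carr E. ccomp E f (\<eta> (cdom E f)) = ccomp E (\<eta> (ccod E f)) (Ga (Fa f))))"

lemma counit:
  "X \<in> cobj E \<Longrightarrow> is_iso E (counit X)" "X \<in> cobj E \<Longrightarrow> counit X \<in> carr E"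
  "X \<in> cobj E \<Longrightarrow> cdom E (counit X) = Go (Fo X)" "X \<in> cobj E \<Longrightarrow> ccod E (counit X) = X"
  "f \<in> carr E \<Longrightarrow> ccomp E (counit (ccod E f)) (Ga (Fa f)) = ccomp E f (counit (cdom E f))"
proof -
  have "\<exists>\<eta>. (\<forall>X\<in>cobj E. is_iso E (\<eta> X) \<and> cdom E (\<eta> X) = Go (Fo X) \<and> ccod E (\<eta> X) = X) \<and>
     (\<forall>f\<in>carr E. ccomp E f (\<eta> (cdom E f)) = ccomp E (\<eta> (ccod E f)) (Ga (Fa f)))"
    using GF by (simp add: nat_isomorphic_def)
  from someI_ex[OF this, folded counit_def]
  show *: "X \<in> cobj E \<Longrightarrow> is_iso E (counit X)"
    "X \<in> cobj E \<Longrightarrow> cdom E (counit X) = Go (Fo X)" "X \<in> cobj E \<Longrightarrow> ccod E (counit X) = X"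
    "f \<in> carr E \<Longrightarrow> ccomp E (counit (ccod E f)) (Ga (Fa f)) = ccomp E f (counit (cdom E f))"
    by auto
  show "X \<in> cobj E \<Longrightarrow> counit X \<in> carr E" using * by (simp add: is_iso_def)
qed

lemma F_faithful:
  assumes "f \<in> carr E" "g \<in> carr E" "cdom E f = cdom E g" "ccod E f = ccod E g" "Fa f = Fa g"
  shows "f = g"
proof (rule iso_cancel_right[OF E counit(1)[of "cdom E f"]])
  show "ccomp E f (counit (cdom E f)) = ccomp E g (counit (cdom E f))"
    using counit(5)[OF assms(1)] counit(5)[OF assms(2)] assms by simp
qed (use assms counit cat_arr[OF E] in auto)

text \<open>
  If \<open>u\<close> and \<open>v\<close> agree on the transported family, then naturality of the counit moves it out of the way,
  faithfulness of \<open>G\<close> shows that \<open>F u\<close> and \<open>F v\<close> agree on the original family, and faithfulness of \<open>F\<close>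
  gives \<open>u = v\<close>.
\<close>

lemma jointly_epic_transport:
  assumes X: "X \<in> cobj E" and S: "jointly_epic P (Fo X) S"
  shows "jointly_epic E X ((\<lambda>f. ccomp E (counit X) (Ga f)) ` S)"
proof -
  interpret sym: cat_equiv P E Go Ga Fo Fa by (rule cat_equiv_sym)
  note [simp] = cat_comp[OF E] cat_comp[OF P] cat_assoc[OF E] cat_assoc[OF P] counit(1-4) cat_arr[OF E] cat_arr[OF P]
    F_arr sym.F_arr
  have S': "\<And>f. f \<in> S \<Longrightarrow> f \<in> carr P \<and> ccod P f = Fo X" using S by (auto simp: jointly_epic_def)
  show ?thesis
    unfolding jointly_epic_def
  proof (intro conjI ballI impI)
    fix f assume "f \<in> (\<lambda>f. ccomp E (counit X) (Ga f)) ` S"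
    then show "f \<in> carr E" "ccod E f = X" using X S' by auto
  next
    fix u v
    assume u: "u \<in> carr E" "cdom E u = X" and v: "v \<in> carr E" "cdom E v = X" and cod: "ccod E u = ccod E v"
      and eq: "\<forall>f\<in>(\<lambda>f. ccomp E (counit X) (Ga f)) ` S. ccomp E u f = ccomp E v f"
    have "ccomp P (Fa u) f = ccomp P (Fa v) f" if f: "f \<in> S" for f
    proof -
      have f': "f \<in> carr P" "ccod P f = Fo X" using S' f by auto
      have lift: "ccomp E w (ccomp E (counit X) (Ga f)) = ccomp E (counit (ccod E w)) (Ga (ccomp P (Fa w) f))"
        if w: "w \<in> carr E" "cdom E w = X" for w
      proof -
        have "ccomp E w (ccomp E (counit X) (Ga f)) = ccomp E (ccomp E w (counit X)) (Ga f)"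
          using w f' X by simp
        also have "\<dots> = ccomp E (ccomp E (counit (ccod E w)) (Ga (Fa w))) (Ga f)"
          by (simp only: counit(5)[OF w(1)] w(2))
        also have "\<dots> = ccomp E (counit (ccod E w)) (Ga (ccomp P (Fa w) f))"
          using w f' by (simp add: sym.F_comp)
        finally show ?thesis .
      qed
      have "Ga (ccomp P (Fa u) f) = Ga (ccomp P (Fa v) f)"
      proof (rule iso_cancel_left[OF E counit(1)[of "ccod E u"]])
        show "ccomp E (counit (ccod E u)) (Ga (ccomp P (Fa u) f)) = ccomp E (counit (ccod E u)) (Ga (ccomp P (Fa v) f))"
          using lift[OF u] lift[OF v] eq f cod by auto
      qed (use u v cod f' in auto)
      then show ?thesis
        by (rule sym.F_faithful[rotated 4]) (use u v cod f' in auto)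
    qed
    then have "Fa u = Fa v"
      using S u v cod by (simp add: jointly_epic_def)
    then show "u = v" using u v cod by (intro F_faithful) auto
  qed
qed

text \<open>
  A jointly epic family onto \<open>G h\<close> is carried by \<open>F\<close>, composed with the counit, to one onto \<open>h\<close>, which has
  a member with a section.  The image of this section under \<open>G\<close> is a section only up to isomorphism, as
  the two natural isomorphisms need not satisfy the triangle identities; precomposition with the isomorphisms
  \<open>Ga r\<close> and \<open>j\<close>, the latter an inverse of the counit, corrects it.
\<close>

lemma irreducible_transport:
  assumes h: "h \<in> cobj P" and irr: "irreducible_ob P h"
  shows "irreducible_ob E (Go h)"
  unfolding irreducible_ob_def
proof (intro allI impI)
  fix S assume S: "jointly_epic E (Go h) S"
  interpret sym: cat_equiv P E Go Ga Fo Fa by (rule cat_equiv_sym)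
  note [simp] = cat_comp[OF E] cat_comp[OF P] cat_assoc[OF E] cat_assoc[OF P] counit(1-4) cat_arr[OF E] cat_arr[OF P]
    F_arr sym.F_arr sym.counit(2-4)
  from sym.jointly_epic_transport[OF h S] irr obtain f s where f: "f \<in> S"
    and s: "s \<in> carr P" "cdom P s = h" "ccod P s = cdom P (ccomp P (sym.counit h) (Fa f))"
      "ccomp P (ccomp P (sym.counit h) (Fa f)) s = cid P h"
    unfolding irreducible_ob_def by blast
  have f': "f \<in> carr E" "ccod E f = Go h" using S f by (auto simp: jointly_epic_def)
  define r where "r = sym.counit h"
  have r: "r \<in> carr P" "cdom P r = Fo (Go h)" "ccod P r = h" using h by (auto simp: r_def)
  have s': "ccod P s = Fo (cdom E f)" using s(3) f' r by (simp add: r_def[symmetric])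
  obtain i where i: "i \<in> carr P" "cdom P i = h" "ccod P i = Fo (Go h)" "ccomp P r i = cid P h" "ccomp P i r = cid P (Fo (Go h))"
    using sym.counit(1)[OF h] r unfolding is_iso_def r_def by auto
  have "ccomp P (Fa f) s = i"
  proof (rule iso_cancel_left[OF P sym.counit(1)[OF h]])
    show "ccomp P (sym.counit h) (ccomp P (Fa f) s) = ccomp P (sym.counit h) i"
      using s s' f' i r by (simp add: r_def[symmetric])
  qed (use s s' f' i h in auto)
  then have fs: "ccomp E (Ga (Fa f)) (Ga s) = Ga i"
    using s s' f' by (simp add: sym.F_comp[symmetric])
  have Gh: "Go h \<in> cobj E" using sym.F_obj[OF h] .
  obtain j where j: "j \<in> carr E" "cdom E j = Go h" "ccod E j = Go (Fo (Go h))"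
      "ccomp E (counit (Go h)) j = cid E (Go h)"
    using counit(1)[OF Gh] counit(3,4)[OF Gh] unfolding is_iso_def by auto
  define t where "t = ccomp E (counit (cdom E f)) (ccomp E (Ga s) (ccomp E (Ga r) j))"
  have t: "t \<in> carr E" "cdom E t = Go h" "ccod E t = cdom E f"
    using f' s s' r j Gh by (auto simp: t_def)
  have "ccomp E f t = ccomp E (ccomp E f (counit (cdom E f))) (ccomp E (Ga s) (ccomp E (Ga r) j))"
    using f' s s' r j Gh by (simp add: t_def)
  also have "\<dots> = ccomp E (ccomp E (counit (Go h)) (Ga (Fa f))) (ccomp E (Ga s) (ccomp E (Ga r) j))"
    using counit(5)[OF f'(1)] f' by simp
  also have "\<dots> = ccomp E (counit (Go h)) (ccomp E (ccomp E (Ga (Fa f)) (Ga s)) (ccomp E (Ga r) j))"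
    using f' s s' r j Gh by simp
  also have "\<dots> = ccomp E (counit (Go h)) (ccomp E (ccomp E (Ga i) (Ga r)) j)"
    unfolding fs using i r j Gh by simp
  also have "\<dots> = ccomp E (counit (Go h)) j"
    using i r j Gh cat_unit(2)[OF E j(1)] by (simp add: sym.F_comp[symmetric] sym.F_id F_obj)
  finally show "\<exists>f\<in>S. \<exists>s\<in>carr E. cdom E s = Go h \<and> ccod E s = cdom E f \<and> ccomp E f s = cid E (Go h)"
    using f t j by auto
qed

end

lemma equivalent_cats_cat_equiv:
  assumes "equivalent_cats E P" "category E" "category P"
  shows "\<exists>Fo Fa Go Ga. cat_equiv E P Fo Fa Go Ga"
proof -
  obtain Fo Fa Go Ga where *: "is_functor E P Fo Fa" "is_functor P E Go Ga"
        "nat_isomorphic E E id id (Go \<circ> Fo) (Ga \<circ> Fa)"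
        "nat_isomorphic P P (Fo \<circ> Go) (Fa \<circ> Ga) id id"
    using assms(1) unfolding equivalent_cats_def by blast
  have "is_functor E E id id" by (auto simp: is_functor_def cat_arr[OF assms(2)])
  moreover have "is_functor E E (Go \<circ> Fo) (Ga \<circ> Fa)"
    using * by (auto simp: is_functor_def)
  ultimately have "nat_isomorphic E E (Go \<circ> Fo) (Ga \<circ> Fa) id id"
    using nat_isomorphic_sym[OF assms(2) _ _ assms(2) *(3)] by blast
  then have "cat_equiv E P Fo Fa Go Ga"
    using * assms by unfold_locales
  then show ?thesis by blast
qed

section \<open>Presheaf categories\<close>

lemma presheaf_cat_simps [simp]:
  "cobj (presheaf_cat \<U> C) = {P. presheaf \<U> C P}"
  "cdom (presheaf_cat \<U> C) f = fst f" "ccod (presheaf_cat \<U> C) f = fst (snd f)"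
  by (simp_all add: presheaf_cat_def case_prod_beta)

lemma carr_presheaf_cat: "f \<in> carr (presheaf_cat \<U> C) \<longleftrightarrow>
    presheaf \<U> C (fst f) \<and> presheaf \<U> C (fst (snd f)) \<and> nat_trans C (fst f) (fst (snd f)) (snd (snd f))"
  by (auto simp: presheaf_cat_def)

definition psh_arr :: "('o, 'm) cat \<Rightarrow> ('o, 'm, 'u) psh \<Rightarrow> ('o, 'm, 'u) psh \<Rightarrow> ('o \<Rightarrow> 'u \<Rightarrow> 'u) \<Rightarrow> ('o, 'm, 'u) psh_arrow" where
  "psh_arr C P Q a = (P, Q, \<lambda>X\<in>cobj C. \<lambda>x\<in>pob P X. a X x)"

lemma psh_arr_simps [simp]:
  "fst (psh_arr C P Q a) = P" "fst (snd (psh_arr C P Q a)) = Q"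
  by (simp_all add: psh_arr_def)

lemma psh_arr_apply [simp]:
  "X \<in> cobj C \<Longrightarrow> x \<in> pob P X \<Longrightarrow> snd (snd (psh_arr C P Q a)) X x = a X x"
  by (simp add: psh_arr_def)

lemma nat_trans_closed: "nat_trans C P Q \<alpha> \<Longrightarrow> X \<in> cobj C \<Longrightarrow> x \<in> pob P X \<Longrightarrow> \<alpha> X x \<in> pob Q X"
  by (auto simp: nat_trans_def PiE_iff)

lemma nat_trans_natural: "nat_trans C P Q \<alpha> \<Longrightarrow> f \<in> carr C \<Longrightarrow> x \<in> pob P (ccod C f) \<Longrightarrow>
    \<alpha> (cdom C f) (pact P f x) = pact Q f (\<alpha> (ccod C f) x)"
  by (auto simp: nat_trans_def)

lemma presheaf_act: "presheaf \<U> C P \<Longrightarrow> f \<in> carr C \<Longrightarrow> x \<in> pob P (ccod C f) \<Longrightarrow> pact P f x \<in> pob P (cdom C f)"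
  by (auto simp: presheaf_def)

lemma presheaf_id: "presheaf \<U> C P \<Longrightarrow> X \<in> cobj C \<Longrightarrow> x \<in> pob P X \<Longrightarrow> pact P (cid C X) x = x"
  by (auto simp: presheaf_def)

lemma presheaf_comp: "presheaf \<U> C P \<Longrightarrow> f \<in> carr C \<Longrightarrow> g \<in> carr C \<Longrightarrow> ccod C f = cdom C g \<Longrightarrow>
    x \<in> pob P (ccod C g) \<Longrightarrow> pact P (ccomp C g f) x = pact P f (pact P g x)"
  by (auto simp: presheaf_def)

lemma presheaf_cat_eqI:
  assumes "f \<in> carr (presheaf_cat \<U> C)" "g \<in> carr (presheaf_cat \<U> C)"
    "fst f = fst g" "fst (snd f) = fst (snd g)"
    "\<And>X x. X \<in> cobj C \<Longrightarrow> x \<in> pob (fst f) X \<Longrightarrow> snd (snd f) X x = snd (snd g) X x"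
  shows "f = g"
proof -
  have *: "snd (snd f) \<in> (\<Pi>\<^sub>E X\<in>cobj C. pob (fst f) X \<rightarrow>\<^sub>E pob (fst (snd f)) X)"
    "snd (snd g) \<in> (\<Pi>\<^sub>E X\<in>cobj C. pob (fst f) X \<rightarrow>\<^sub>E pob (fst (snd f)) X)"
    using assms(1-4) by (auto simp: carr_presheaf_cat nat_trans_def)
  then have "snd (snd f) = snd (snd g)"
  proof (rule PiE_ext)
    fix X assume X: "X \<in> cobj C"
    then have "snd (snd f) X \<in> pob (fst f) X \<rightarrow>\<^sub>E pob (fst (snd f)) X"
      "snd (snd g) X \<in> pob (fst f) X \<rightarrow>\<^sub>E pob (fst (snd f)) X"
      using * by (auto dest: PiE_mem)
    then show "snd (snd f) X = snd (snd g) X"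
      by (rule PiE_ext) (use assms(5) X in auto)
  qed
  then show ?thesis using assms(3,4) by (simp add: prod_eq_iff)
qed

lemma psh_arr_carr:
  assumes "category C" "presheaf \<U> C P" "presheaf \<U> C Q"
    "\<And>X x. X \<in> cobj C \<Longrightarrow> x \<in> pob P X \<Longrightarrow> a X x \<in> pob Q X"
    "\<And>f x. f \<in> carr C \<Longrightarrow> x \<in> pob P (ccod C f) \<Longrightarrow> a (cdom C f) (pact P f x) = pact Q f (a (ccod C f) x)"
  shows "psh_arr C P Q a \<in> carr (presheaf_cat \<U> C)"
  using assms cat_arr[OF assms(1)] presheaf_act[OF assms(2)]
  by (auto simp: carr_presheaf_cat psh_arr_def nat_trans_def)

lemma ccomp_presheaf_cat: "ccomp (presheaf_cat \<U> C) g f = psh_arr C (fst f) (fst (snd g)) (\<lambda>X x. snd (snd g) X (snd (snd f) X x))"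
  by (simp add: presheaf_cat_def psh_arr_def case_prod_beta)

lemma cid_presheaf_cat: "cid (presheaf_cat \<U> C) P = psh_arr C P P (\<lambda>X x. x)"
  by (simp add: presheaf_cat_def psh_arr_def)

lemma ccomp_carr:
  assumes "category C" "f \<in> carr (presheaf_cat \<U> C)" "g \<in> carr (presheaf_cat \<U> C)" "fst (snd f) = fst g"
  shows "ccomp (presheaf_cat \<U> C) g f \<in> carr (presheaf_cat \<U> C)"
  unfolding ccomp_presheaf_cat
proof (intro psh_arr_carr)
  have n: "nat_trans C (fst f) (fst g) (snd (snd f))" "nat_trans C (fst g) (fst (snd g)) (snd (snd g))"
    using assms by (auto simp: carr_presheaf_cat)
  show "snd (snd g) X (snd (snd f) X x) \<in> pob (fst (snd g)) X" if "X \<in> cobj C" "x \<in> pob (fst f) X" for X x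
    using n that by (meson nat_trans_closed)
  show "snd (snd g) (cdom C h) (snd (snd f) (cdom C h) (pact (fst f) h x)) =
      pact (fst (snd g)) h (snd (snd g) (ccod C h) (snd (snd f) (ccod C h) x))"
    if "h \<in> carr C" "x \<in> pob (fst f) (ccod C h)" for h x
    using that nat_trans_natural[OF n(1) that] nat_trans_closed[OF n(1) cat_arr(2)[OF assms(1) that(1)] that(2)]
      nat_trans_natural[OF n(2) that(1)] by simp
qed (use assms in \<open>auto simp: carr_presheaf_cat\<close>)

lemma cid_carr: "category C \<Longrightarrow> presheaf \<U> C P \<Longrightarrow> cid (presheaf_cat \<U> C) P \<in> carr (presheaf_cat \<U> C)"
  unfolding cid_presheaf_cat by (intro psh_arr_carr) auto

lemma presheaf_cat_category:
  assumes C: "category C"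
  shows "category (presheaf_cat \<U> C)"
proof -
  have closed: "snd (snd f) X x \<in> pob (fst (snd f)) X"
    if "f \<in> carr (presheaf_cat \<U> C)" "X \<in> cobj C" "x \<in> pob (fst f) X" for f X x
    using that by (auto simp: carr_presheaf_cat intro: nat_trans_closed)
  show ?thesis
    unfolding category_def
  proof (intro conjI ballI impI; (elim conjE)?)
    fix f g h assume fgh: "f \<in> carr (presheaf_cat \<U> C)" "g \<in> carr (presheaf_cat \<U> C)" "h \<in> carr (presheaf_cat \<U> C)"
      "ccod (presheaf_cat \<U> C) f = cdom (presheaf_cat \<U> C) g" "ccod (presheaf_cat \<U> C) g = cdom (presheaf_cat \<U> C) h"
    then have eq: "fst (snd f) = fst g" "fst (snd g) = fst h" by auto
    show "ccomp (presheaf_cat \<U> C) h (ccomp (presheaf_cat \<U> C) g f) = ccomp (presheaf_cat \<U> C) (ccomp (presheaf_cat \<U> C) h g) f"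
    proof (rule presheaf_cat_eqI)
      fix X x assume "X \<in> cobj C" "x \<in> pob (fst (ccomp (presheaf_cat \<U> C) h (ccomp (presheaf_cat \<U> C) g f))) X"
      then show "snd (snd (ccomp (presheaf_cat \<U> C) h (ccomp (presheaf_cat \<U> C) g f))) X x =
         snd (snd (ccomp (presheaf_cat \<U> C) (ccomp (presheaf_cat \<U> C) h g) f)) X x"
        using closed[OF fgh(1)] eq by (auto simp: ccomp_presheaf_cat)
    next
      show "ccomp (presheaf_cat \<U> C) h (ccomp (presheaf_cat \<U> C) g f) \<in> carr (presheaf_cat \<U> C)"
        using fgh eq by (intro ccomp_carr C) (auto simp: ccomp_presheaf_cat)
      show "ccomp (presheaf_cat \<U> C) (ccomp (presheaf_cat \<U> C) h g) f \<in> carr (presheaf_cat \<U> C)"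
        using fgh eq by (intro ccomp_carr C) (auto simp: ccomp_presheaf_cat)
    qed (auto simp: ccomp_presheaf_cat)
  next
    fix f assume f: "f \<in> carr (presheaf_cat \<U> C)"
    then have P: "presheaf \<U> C (fst f)" "presheaf \<U> C (fst (snd f))" by (auto simp: carr_presheaf_cat)
    show "ccomp (presheaf_cat \<U> C) f (cid (presheaf_cat \<U> C) (cdom (presheaf_cat \<U> C) f)) = f"
      using f P ccomp_carr[OF C cid_carr[OF C P(1)] f]
      by (intro presheaf_cat_eqI) (auto simp: ccomp_presheaf_cat cid_presheaf_cat)
    show "ccomp (presheaf_cat \<U> C) (cid (presheaf_cat \<U> C) (ccod (presheaf_cat \<U> C) f)) f = f"
      using f P ccomp_carr[OF C f cid_carr[OF C P(2)]] closed[OF f]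
      by (intro presheaf_cat_eqI) (auto simp: ccomp_presheaf_cat cid_presheaf_cat)
  next
    fix f g assume fg: "f \<in> carr (presheaf_cat \<U> C)" "g \<in> carr (presheaf_cat \<U> C)"
      "ccod (presheaf_cat \<U> C) f = cdom (presheaf_cat \<U> C) g"
    then show "ccomp (presheaf_cat \<U> C) g f \<in> carr (presheaf_cat \<U> C)"
      by (intro ccomp_carr C) auto
  next
    fix P assume "P \<in> cobj (presheaf_cat \<U> C)"
    then show "cid (presheaf_cat \<U> C) P \<in> carr (presheaf_cat \<U> C)" by (intro cid_carr C) auto
  qed (auto simp: ccomp_presheaf_cat cid_presheaf_cat carr_presheaf_cat)
qed

lemma full_subcat_category: "category C \<Longrightarrow> category (full_subcat S C)"
  unfolding category_def full_subcat_def by auto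

lemma sheaf_cat_simps [simp]:
  "cobj (sheaf_cat \<U> C J) = {P. presheaf \<U> C P \<and> sheaf C J P}"
  "cdom (sheaf_cat \<U> C J) f = fst f" "ccod (sheaf_cat \<U> C J) f = fst (snd f)"
  "ccomp (sheaf_cat \<U> C J) = ccomp (presheaf_cat \<U> C)"
  "cid (sheaf_cat \<U> C J) = cid (presheaf_cat \<U> C)"
  by (auto simp add: sheaf_cat_def full_subcat_def)

lemma carr_sheaf_cat: "f \<in> carr (sheaf_cat \<U> C J) \<longleftrightarrow>
   f \<in> carr (presheaf_cat \<U> C) \<and> sheaf C J (fst f) \<and> sheaf C J (fst (snd f))"
  by (auto simp: sheaf_cat_def full_subcat_def)

lemma sheaf_cat_category: "category C \<Longrightarrow> category (sheaf_cat \<U> C J)"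
  unfolding sheaf_cat_def by (intro full_subcat_category presheaf_cat_category)

subsection \<open>Presheaves with values in another type\<close>

text \<open>
  Presheaves take values in small subsets of \<open>'u\<close>.  A functor \<open>Q\<close> whose natural values live in another
  type \<open>'b\<close> is therefore coded by a map \<open>en\<close> that is injective on each \<open>Q X\<close>.
\<close>

definition enc_psh :: "('o, 'm) cat \<Rightarrow> ('b \<Rightarrow> 'u) \<Rightarrow> ('o \<Rightarrow> 'b set) \<Rightarrow> ('m \<Rightarrow> 'b \<Rightarrow> 'b) \<Rightarrow> ('o, 'm, 'u) psh" where
  "enc_psh C en Q act = \<lparr>pob = (\<lambda>X. en ` Q X),
     pact = (\<lambda>f u. en (act f (inv_into (Q (ccod C f)) en u)))\<rparr>"

lemma pob_enc_psh [simp]: "pob (enc_psh C en Q act) X = en ` Q X"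
  by (simp add: enc_psh_def)

lemma pact_enc_psh [simp]:
  "inj_on en (Q (ccod C f)) \<Longrightarrow> t \<in> Q (ccod C f) \<Longrightarrow> pact (enc_psh C en Q act) f (en t) = en (act f t)"
  by (simp add: enc_psh_def inv_into_f_f)

lemma presheaf_enc_psh:
  assumes C: "category C"
    and en: "\<And>X. X \<in> cobj C \<Longrightarrow> inj_on en (Q X)" "\<And>X. X \<in> cobj C \<Longrightarrow> en ` Q X \<in> \<U>"
    and act: "\<And>f t. f \<in> carr C \<Longrightarrow> t \<in> Q (ccod C f) \<Longrightarrow> act f t \<in> Q (cdom C f)"
      "\<And>X t. X \<in> cobj C \<Longrightarrow> t \<in> Q X \<Longrightarrow> act (cid C X) t = t"
      "\<And>f g t. f \<in> carr C \<Longrightarrow> g \<in> carr C \<Longrightarrow> ccod C f = cdom C g \<Longrightarrow> t \<in> Q (ccod C g) \<Longrightarrow>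
         act (ccomp C g f) t = act f (act g t)"
  shows "presheaf \<U> C (enc_psh C en Q act)"
  unfolding presheaf_def
proof (intro conjI ballI impI)
  fix X assume "X \<in> cobj C" then show "pob (enc_psh C en Q act) X \<in> \<U>" using en by simp
next
  fix f u assume f: "f \<in> carr C" and "u \<in> pob (enc_psh C en Q act) (ccod C f)"
  then show "pact (enc_psh C en Q act) f u \<in> pob (enc_psh C en Q act) (cdom C f)"
    using en(1) act(1) cat_arr[OF C f] by auto
next
  fix X u assume X: "X \<in> cobj C" and "u \<in> pob (enc_psh C en Q act) X"
  then obtain t where t: "t \<in> Q X" "u = en t" by auto
  then have t': "t \<in> Q (ccod C (cid C X))" using X cat_id[OF C] by simp
  have "inj_on en (Q (ccod C (cid C X)))" using en(1) X cat_id[OF C] by simp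
  then show "pact (enc_psh C en Q act) (cid C X) u = u"
    using t t' act(2)[OF X] by simp
next
  fix f g u assume f: "f \<in> carr C" and g: "g \<in> carr C" and fg: "ccod C f = cdom C g"
    and "u \<in> pob (enc_psh C en Q act) (ccod C g)"
  then obtain t where t: "t \<in> Q (ccod C g)" "u = en t" by auto
  note [simp] = cat_comp[OF C f g fg]
  have gt: "act g t \<in> Q (ccod C f)" using act(1)[OF g t(1)] fg by simp
  have "pact (enc_psh C en Q act) (ccomp C g f) u = en (act (ccomp C g f) t)"
    using t cat_arr[OF C g] en(1) by simp
  moreover have "pact (enc_psh C en Q act) f (pact (enc_psh C en Q act) g u) = en (act f (act g t))"
    using t gt cat_arr[OF C g] cat_arr[OF C f] en(1) by simp
  ultimately show "pact (enc_psh C en Q act) (ccomp C g f) u = pact (enc_psh C en Q act) f (pact (enc_psh C en Q act) g u)"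
    using act(3)[OF f g fg t(1)] by simp
qed

lemma sheaf_enc_psh:
  assumes C: "category C"
    and en: "\<And>X. X \<in> cobj C \<Longrightarrow> inj_on en (Q X)"
    and J: "\<And>X S. X \<in> cobj C \<Longrightarrow> S \<in> J X \<Longrightarrow> sieve C X S"
    and act: "\<And>f t. f \<in> carr C \<Longrightarrow> t \<in> Q (ccod C f) \<Longrightarrow> act f t \<in> Q (cdom C f)"
    and glue: "\<And>X S s. X \<in> cobj C \<Longrightarrow> S \<in> J X \<Longrightarrow> (\<And>f. f \<in> S \<Longrightarrow> s f \<in> Q (cdom C f)) \<Longrightarrow>
       (\<And>f g. f \<in> S \<Longrightarrow> g \<in> carr C \<Longrightarrow> ccod C g = cdom C f \<Longrightarrow> s (ccomp C f g) = act g (s f)) \<Longrightarrow>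
       \<exists>t\<in>Q X. \<forall>f\<in>S. act f t = s f"
    and uniq: "\<And>X S t t'. X \<in> cobj C \<Longrightarrow> S \<in> J X \<Longrightarrow> t \<in> Q X \<Longrightarrow> t' \<in> Q X \<Longrightarrow>
       (\<And>f. f \<in> S \<Longrightarrow> act f t = act f t') \<Longrightarrow> t = t'"
  shows "sheaf C J (enc_psh C en Q act)"
  unfolding sheaf_def
proof (intro ballI allI impI)
  let ?P = "enc_psh C en Q act"
  fix X S s assume X: "X \<in> cobj C" and S: "S \<in> J X"
    and s: "(\<forall>f\<in>S. s f \<in> pob ?P (cdom C f)) \<and>
       (\<forall>f\<in>S. \<forall>g\<in>carr C. ccod C g = cdom C f \<longrightarrow> s (ccomp C f g) = pact ?P g (s f))"
  have S': "f \<in> carr C" "ccod C f = X" if "f \<in> S" for f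
    using J[OF X S] that by (auto simp: sieve_def)
  have Sc: "ccomp C f g \<in> S" if "f \<in> S" "g \<in> carr C" "ccod C g = cdom C f" for f g
    using J[OF X S] that by (auto simp: sieve_def)
  have inj: "inj_on en (Q (cdom C f))" "inj_on en (Q (ccod C f))" if "f \<in> carr C" for f
    using en that cat_arr[OF C] by auto
  define r where "r f = inv_into (Q (cdom C f)) en (s f)" for f
  have r: "r f \<in> Q (cdom C f)" "s f = en (r f)" if "f \<in> S" for f
    using s that by (auto simp: r_def inv_into_into f_inv_into_f)
  have rr: "r (ccomp C f g) = act g (r f)" if fg: "f \<in> S" "g \<in> carr C" "ccod C g = cdom C f" for f g
  proof -
    have rf: "r f \<in> Q (ccod C g)" using r(1)[OF fg(1)] fg(3) by simp
    have "en (r (ccomp C f g)) = pact ?P g (en (r f))"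
      using s fg r(2)[OF Sc[OF fg]] r(2)[OF fg(1)] by simp
    also have "\<dots> = en (act g (r f))" using rf inj[OF fg(2)] by simp
    finally have "en (r (ccomp C f g)) = en (act g (r f))" .
    moreover have "r (ccomp C f g) \<in> Q (cdom C g)"
      using r(1)[OF Sc[OF fg]] cat_comp(2)[OF C fg(2) S'(1)[OF fg(1)] fg(3)] by simp
    ultimately show ?thesis
      using inj(1)[OF fg(2)] act[OF fg(2) rf] by (meson inj_onD)
  qed
  obtain t where t: "t \<in> Q X" "\<forall>f\<in>S. act f t = r f"
    using glue[OF X S r(1) rr] by blast
  have pt: "pact ?P f (en t') = en (act f t')" if "f \<in> S" "t' \<in> Q X" for f t'
    using S'[OF that(1)] that(2) inj(2)[of f] by simp
  show "\<exists>!x. x \<in> pob ?P X \<and> (\<forall>f\<in>S. pact ?P f x = s f)"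
  proof (rule ex1I[of _ "en t"])
    show "en t \<in> pob ?P X \<and> (\<forall>f\<in>S. pact ?P f (en t) = s f)"
      using t pt r(2) by auto
    fix x assume x: "x \<in> pob ?P X \<and> (\<forall>f\<in>S. pact ?P f x = s f)"
    then obtain t' where t': "t' \<in> Q X" "x = en t'" by auto
    have "act f t' = act f t" if f: "f \<in> S" for f
    proof -
      have "en (act f t') = en (r f)" using x t' pt[OF f t'(1)] r(2)[OF f] f by simp
      moreover have "act f t' \<in> Q (cdom C f)" using act[OF S'(1)[OF f]] S'(2)[OF f] t' by simp
      ultimately have "act f t' = r f" using inj(1)[OF S'(1)[OF f]] r(1)[OF f] by (meson inj_onD)
      then show ?thesis using t f by simp
    qed
    then have "t' = t" using uniq[OF X S t'(1) t(1)] by simp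
    then show "x = en t" using t' by simp
  qed
qed

subsection \<open>Representable presheaves are irreducible and generate\<close>

definition hom_psh :: "('u, 'u) cat \<Rightarrow> 'u \<Rightarrow> ('u, 'u, 'u) psh" where
  "hom_psh D d = \<lparr>pob = (\<lambda>X. {f \<in> carr D. cdom D f = X \<and> ccod D f = d}), pact = (\<lambda>g f. ccomp D f g)\<rparr>"

context set_universe
begin

lemma presheaf_hom:
  assumes D: "category D" and "carr D \<in> \<U>"
  shows "presheaf \<U> D (hom_psh D d)"
proof -
  have "{f \<in> carr D. cdom D f = X \<and> ccod D f = d} \<in> \<U>" for X
    using small_subset[OF assms(2)] by auto
  then show ?thesis
    unfolding presheaf_def hom_psh_def
    by (auto simp: cat_comp[OF D] cat_assoc[OF D] cat_arr[OF D] cat_unit[OF D])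
qed

text \<open>
  By the Yoneda lemma the elements of \<open>P\<close> are the arrows from representables, and evaluation at the
  identity recovers the element.
\<close>

lemma elements_jointly_epic:
  assumes D: "category D" and sm: "carr D \<in> \<U>" and P: "presheaf \<U> D P"
  shows "jointly_epic (presheaf_cat \<U> D) P
    {psh_arr D (hom_psh D d) P (\<lambda>X f. pact P f x) | d x. d \<in> cobj D \<and> x \<in> pob P d}"
  unfolding jointly_epic_def
proof (intro conjI ballI impI)
  fix k assume "k \<in> {psh_arr D (hom_psh D d) P (\<lambda>X f. pact P f x) | d x. d \<in> cobj D \<and> x \<in> pob P d}"
  then obtain d x where k: "k = psh_arr D (hom_psh D d) P (\<lambda>X f. pact P f x)" "d \<in> cobj D" "x \<in> pob P d" by blast
  show "ccod (presheaf_cat \<U> D) k = P" by (simp add: k)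
  show "k \<in> carr (presheaf_cat \<U> D)"
    unfolding k(1)
  proof (rule psh_arr_carr[OF D presheaf_hom[OF D sm] P])
    fix X f assume "f \<in> pob (hom_psh D d) X"
    then show "pact P f x \<in> pob P X" using k presheaf_act[OF P] by (auto simp: hom_psh_def)
  next
    fix f g assume "f \<in> carr D" "g \<in> pob (hom_psh D d) (ccod D f)"
    then show "pact P (pact (hom_psh D d) f g) x = pact P f (pact P g x)"
      using k presheaf_comp[OF P] by (auto simp: hom_psh_def)
  qed
next
  fix u v
  assume u: "u \<in> carr (presheaf_cat \<U> D)" "cdom (presheaf_cat \<U> D) u = P"
    and v: "v \<in> carr (presheaf_cat \<U> D)" "cdom (presheaf_cat \<U> D) v = P"
    and cod: "ccod (presheaf_cat \<U> D) u = ccod (presheaf_cat \<U> D) v"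
    and eq: "\<forall>k\<in>{psh_arr D (hom_psh D d) P (\<lambda>X f. pact P f x) | d x. d \<in> cobj D \<and> x \<in> pob P d}.
      ccomp (presheaf_cat \<U> D) u k = ccomp (presheaf_cat \<U> D) v k"
  show "u = v"
  proof (rule presheaf_cat_eqI[OF u(1) v(1)])
    fix d x assume d: "d \<in> cobj D" and "x \<in> pob (fst u) d"
    then have x: "x \<in> pob P d" using u by simp
    let ?k = "psh_arr D (hom_psh D d) P (\<lambda>X f. pact P f x)"
    have i: "cid D d \<in> pob (hom_psh D d) d" using cat_id[OF D d] by (simp add: hom_psh_def)
    have "snd (snd (ccomp (presheaf_cat \<U> D) w ?k)) d (cid D d) = snd (snd w) d x" for w
      using d i x presheaf_id[OF P d x] by (simp add: ccomp_presheaf_cat)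
    moreover have "ccomp (presheaf_cat \<U> D) u ?k = ccomp (presheaf_cat \<U> D) v ?k"
      using eq d x by blast
    ultimately show "snd (snd u) d x = snd (snd v) d x" by metis
  qed (use u v cod in auto)
qed

text \<open>
  A small set may be all of \<open>'u\<close> and then leaves no room for a further element.  Two disjoint copies of
  it are nevertheless available, inside its product with a small set that has two elements.
\<close>

lemma small_option:
  assumes "S \<in> \<U>" "a \<in> S"
  shows "\<exists>en :: 'u option \<Rightarrow> 'u. inj_on en (insert None (Some ` S)) \<and> en ` insert None (Some ` S) \<in> \<U>"
proof -
  obtain B and \<nu> :: "nat set \<Rightarrow> 'u" where B: "B \<in> \<U>" and \<nu>: "inj \<nu>" "range \<nu> \<subseteq> B"
    using small_continuum unfolding lepoll_def by blast
  obtain Q where Q: "Q \<in> \<U>" "Q \<approx> S \<times> B" using small_Times[OF assms(1) B] by blast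
  then obtain g where g: "bij_betw g (S \<times> B) Q" using eqpoll_sym unfolding eqpoll_def by blast
  define b c where "b = \<nu> {}" and "c = \<nu> {0}"
  have bc: "b \<in> B" "c \<in> B" "b \<noteq> c" using \<nu> by (auto simp: b_def c_def inj_eq)
  define en where "en z = (case z of None \<Rightarrow> g (a, c) | Some x \<Rightarrow> g (x, b))" for z
  have inj: "inj_on g (S \<times> B)" and img: "g ` (S \<times> B) = Q" using g by (auto simp: bij_betw_def)
  have "inj_on en (insert None (Some ` S))"
    using bc assms(2) inj by (auto simp: inj_on_def en_def)
  moreover have "en ` insert None (Some ` S) \<subseteq> Q"
    using bc assms(2) img by (auto simp: en_def)
  ultimately show ?thesis using small_subset[OF Q(1)] by blast
qed

text \<open>
  It suffices that the identity is in the image \<open>R\<close> of the family, because a preimage of it is a section by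
  the Yoneda lemma.  Otherwise \<open>R\<close> is a proper subpresheaf, and collapsing \<open>R\<close> to a point yields a
  presheaf with two arrows into it, the collapse and the constant one, that agree on the family but
  differ at the identity.  The value \<open>None\<close> is the collapsed point.
\<close>

lemma hom_irreducible:
  assumes D: "category D" and sm: "carr D \<in> \<U>" and d: "d \<in> cobj D"
  shows "irreducible_ob (presheaf_cat \<U> D) (hom_psh D d)"
  unfolding irreducible_ob_def
proof (intro allI impI)
  let ?P = "presheaf_cat \<U> D" and ?h = "hom_psh D d"
  fix S assume S: "jointly_epic ?P ?h S"
  have S': "k \<in> carr ?P" "fst (snd k) = ?h" "presheaf \<U> D (fst k)" "nat_trans D (fst k) ?h (snd (snd k))" if "k \<in> S" for k
    using S that by (auto simp: jointly_epic_def carr_presheaf_cat)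
  have hom: "presheaf \<U> D ?h" using D sm by (rule presheaf_hom)
  have i: "cid D d \<in> pob ?h d" using cat_id[OF D d] by (simp add: hom_psh_def)
  define R where "R X = {snd (snd k) X x | k x. k \<in> S \<and> x \<in> pob (fst k) X}" for X
  have "cid D d \<in> R d"
  proof (rule ccontr)
    assume nR: "cid D d \<notin> R d"
    obtain en :: "'u option \<Rightarrow> 'u" where en: "inj_on en (insert None (Some ` carr D))" "en ` insert None (Some ` carr D) \<in> \<U>"
      using small_option[OF sm cat_id(1)[OF D d]] by blast
    define q where "q X f = (if f \<in> R X then None else Some f)" for X f
    define Q where "Q X = insert None (q X ` pob ?h X)" for X
    define act where "act g z = (case z of None \<Rightarrow> None | Some f \<Rightarrow> q (cdom D g) (ccomp D f g))" for g z
    have Q': "Q X \<subseteq> insert None (Some ` carr D)" for X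
      by (auto simp: Q_def q_def hom_psh_def)
    have closed: "ccomp D f g \<in> R (cdom D g)" if f: "f \<in> R (ccod D g)" and g: "g \<in> carr D" for f g
    proof -
      obtain k x where k: "f = snd (snd k) (ccod D g) x" "k \<in> S" "x \<in> pob (fst k) (ccod D g)"
        using f by (auto simp: R_def)
      have "ccomp D f g = snd (snd k) (cdom D g) (pact (fst k) g x)"
        using nat_trans_natural[OF S'(4)[OF k(2)] g k(3)] k(1) by (simp add: hom_psh_def)
      then show ?thesis
        using k(2) presheaf_act[OF S'(3)[OF k(2)] g k(3)] unfolding R_def by blast
    qed
    have q_act: "act g (q (ccod D g) f) = q (cdom D g) (ccomp D f g)"
      if "g \<in> carr D" for f g
      using closed[OF _ that] by (auto simp: act_def q_def)
    have hc: "ccomp D f g \<in> pob ?h (cdom D g)" if "f \<in> pob ?h (ccod D g)" "g \<in> carr D" for f g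
      using presheaf_act[OF hom that(2,1)] by (simp add: hom_psh_def)
    let ?Z = "enc_psh D en Q act"
    have enQ: "inj_on en (Q X)" for X using en(1) Q' by (rule inj_on_subset)
    have Z: "presheaf \<U> D ?Z"
    proof (rule presheaf_enc_psh[OF D enQ])
      show "en ` Q X \<in> \<U>" for X using small_subset[OF en(2)] Q'[of X] by (meson image_mono)
      show "act g z \<in> Q (cdom D g)" if "g \<in> carr D" "z \<in> Q (ccod D g)" for g z
        using that q_act[OF that(1)] hc[OF _ that(1)] by (auto simp: Q_def) (auto simp: act_def)
      show "act (cid D X) z = z" if X: "X \<in> cobj D" and z: "z \<in> Q X" for X z
      proof (cases z)
        case None then show ?thesis by (simp add: act_def)
      next
        case (Some f)
        then obtain f where f: "f \<in> pob ?h X" "z = q X f" using z by (auto simp: Q_def)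
        have "act (cid D X) (q (ccod D (cid D X)) f) = q X (ccomp D f (cid D X))"
          using q_act[OF cat_id(1)[OF D X]] cat_id[OF D X] by simp
        moreover have "ccomp D f (cid D X) = f" using f cat_unit(1)[OF D, of f] by (auto simp: hom_psh_def)
        ultimately show ?thesis using f cat_id[OF D X] by simp
      qed
      show "act (ccomp D g f) z = act f (act g z)"
        if f: "f \<in> carr D" and g: "g \<in> carr D" and fg: "ccod D f = cdom D g" and z: "z \<in> Q (ccod D g)" for f g z
      proof (cases z)
        case None then show ?thesis by (simp add: act_def)
      next
        case (Some x)
        then obtain x where x: "x \<in> pob ?h (ccod D g)" "z = q (ccod D g) x" using z by (auto simp: Q_def)
        have "act f (act g z) = act f (q (ccod D f) (ccomp D x g))" using x q_act[OF g] fg by simp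
        also have "\<dots> = q (cdom D f) (ccomp D (ccomp D x g) f)" using q_act[OF f] by simp
        also have "ccomp D (ccomp D x g) f = ccomp D x (ccomp D g f)"
          using x f g fg by (intro cat_assoc[OF D]) (auto simp: hom_psh_def)
        also have "q (cdom D f) \<dots> = act (ccomp D g f) z"
          using q_act[OF cat_comp(1)[OF D f g fg], of x] x cat_comp[OF D f g fg] by simp
        finally show ?thesis by simp
      qed
    qed
    \<comment> \<open>the collapse and the constant arrow\<close>
    define u v where "u = psh_arr D ?h ?Z (\<lambda>X f. en (q X f))" and "v = psh_arr D ?h ?Z (\<lambda>X f. en None)"
    have u: "u \<in> carr ?P" unfolding u_def
    proof (rule psh_arr_carr[OF D hom Z])
      fix g f assume g: "g \<in> carr D" and f: "f \<in> pob ?h (ccod D g)"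
      then have "q (ccod D g) f \<in> Q (ccod D g)" by (auto simp: Q_def)
      then show "en (q (cdom D g) (pact ?h g f)) = pact ?Z g (en (q (ccod D g) f))"
        using q_act[OF g] enQ by (simp add: hom_psh_def)
    qed (auto simp: Q_def)
    have v: "v \<in> carr ?P" unfolding v_def
    proof (rule psh_arr_carr[OF D hom Z])
      fix g f
      have "None \<in> Q (ccod D g)" by (auto simp: Q_def)
      then show "en None = pact ?Z g (en None)"
        using enQ by (simp add: act_def)
    qed (auto simp: Q_def)
    have "ccomp ?P u k = ccomp ?P v k" if k: "k \<in> S" for k
    proof -
      have "snd (snd k) X x \<in> R X \<and> snd (snd k) X x \<in> pob ?h X" if "x \<in> pob (fst k) X" "X \<in> cobj D" for X x
        using that k nat_trans_closed[OF S'(4)[OF k]] unfolding R_def by blast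
      moreover have "fst (snd k) = fst u" "fst (snd k) = fst v" using S'[OF k] by (auto simp: u_def v_def)
      note c = ccomp_carr[OF D S'(1)[OF k] u this(1)] ccomp_carr[OF D S'(1)[OF k] v this(2)]
      ultimately show ?thesis
        by (intro presheaf_cat_eqI[OF c]) (auto simp: ccomp_presheaf_cat u_def v_def q_def)
    qed
    then have "u = v" using S u v by (simp add: jointly_epic_def u_def v_def)
    then have "snd (snd u) d (cid D d) = snd (snd v) d (cid D d)" by simp
    then have "en (Some (cid D d)) = en None" using nR i d by (simp add: u_def v_def q_def)
    then have "Some (cid D d) = None" by (rule inj_onD[OF en(1)]) (use cat_id[OF D d] in auto)
    then show False by simp
  qed
  then obtain k x where k: "k \<in> S" "x \<in> pob (fst k) d" "snd (snd k) d x = cid D d" by (auto simp: R_def)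
  define s where "s = psh_arr D ?h (fst k) (\<lambda>X f. pact (fst k) f x)"
  note K = S'(3)[OF k(1)]
  have s: "s \<in> carr ?P" unfolding s_def
  proof (rule psh_arr_carr[OF D hom K])
    fix X f assume "f \<in> pob ?h X"
    then show "pact (fst k) f x \<in> pob (fst k) X" using k presheaf_act[OF K] by (auto simp: hom_psh_def)
  next
    fix f g assume "f \<in> carr D" "g \<in> pob ?h (ccod D f)"
    then show "pact (fst k) (pact ?h f g) x = pact (fst k) f (pact (fst k) g x)"
      using k presheaf_comp[OF K] by (auto simp: hom_psh_def)
  qed
  have "ccomp ?P k s = cid ?P ?h"
  proof (rule presheaf_cat_eqI[where \<U> = \<U> and C = D])
    show "ccomp ?P k s \<in> carr ?P" using s S'[OF k(1)] by (intro ccomp_carr D) (auto simp: s_def)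
    show "cid ?P ?h \<in> carr ?P" using D hom by (rule cid_carr)
    fix X f assume "X \<in> cobj D" "f \<in> pob (fst (ccomp ?P k s)) X"
    then have f: "f \<in> pob ?h X" "X \<in> cobj D" by (auto simp: ccomp_presheaf_cat s_def)
    then have f': "f \<in> carr D" "cdom D f = X" "ccod D f = d" by (auto simp: hom_psh_def)
    then have "snd (snd k) X (pact (fst k) f x) = ccomp D (cid D d) f"
      using nat_trans_natural[OF S'(4)[OF k(1)], of f x] k(2,3) by (simp add: hom_psh_def)
    then show "snd (snd (ccomp ?P k s)) X f = snd (snd (cid ?P ?h)) X f"
      using f f' cat_unit(2)[OF D f'(1)] by (simp add: ccomp_presheaf_cat cid_presheaf_cat s_def)
  qed (use S'[OF k(1)] in \<open>auto simp: ccomp_presheaf_cat cid_presheaf_cat s_def\<close>)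
  then show "\<exists>k\<in>S. \<exists>s\<in>carr ?P. cdom ?P s = ?h \<and> ccod ?P s = cdom ?P k \<and> ccomp ?P k s = cid ?P ?h"
    using k(1) s by (intro bexI[OF _ k(1)] bexI[OF _ s]) (simp add: s_def)
qed

end

section \<open>Sheaves on the syntactic site\<close>

text \<open>
  Pulling all disjunctions outwards turns a geometric formula into a disjunction of positive primitive
  formulas, of which there are only countably many.  Hence there are at most continuum many arrows
  between two objects of the syntactic category, and they can be coded in a small set.  Without this,
  representable presheaves would not be presheaves of small sets.
\<close>

datatype pp = PEq mv_term mv_term | PTop | PAnd pp pp | PEx pp

instance mv_term :: countable by countable_datatype
instance pp :: countable by countable_datatype

primrec psat :: "'a mv \<Rightarrow> pp \<Rightarrow> (nat \<Rightarrow> 'a) \<Rightarrow> bool" where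
  "psat A (PEq s t) = (\<lambda>e. teval A e s = teval A e t)"
| "psat A PTop = (\<lambda>e. True)"
| "psat A (PAnd a b) = (\<lambda>e. psat A a e \<and> psat A b e)"
| "psat A (PEx a) = (\<lambda>e. \<exists>x\<in>mcarrier A. psat A a (case_nat x e))"

primrec disjuncts :: "'u gform \<Rightarrow> pp set" where
  "disjuncts (FEq s t) = {PEq s t}"
| "disjuncts FTop = {PTop}"
| "disjuncts (FAnd \<phi> \<psi>) = (\<lambda>(a, b). PAnd a b) ` (disjuncts \<phi> \<times> disjuncts \<psi>)"
| "disjuncts (FEx \<phi>) = PEx ` disjuncts \<phi>"
| "disjuncts (FOr K F) = (\<Union>k\<in>K. disjuncts (F k))"

lemma fsat_disjuncts: "fsat A \<phi> e \<longleftrightarrow> (\<exists>a\<in>disjuncts \<phi>. psat A a e)"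
proof (induction \<phi> arbitrary: e)
  case (FAnd \<phi> \<psi>)
  then show ?case by (auto simp: image_iff)
qed auto

context set_universe
begin

definition code :: "nat set \<Rightarrow> 'u" where
  "code = (SOME \<nu>. inj \<nu> \<and> range \<nu> \<in> \<U>)"

lemma code: "inj code" "range code \<in> \<U>"
proof -
  have "\<exists>\<nu> :: nat set \<Rightarrow> 'u. inj \<nu> \<and> range \<nu> \<in> \<U>"
    using small_continuum small_subset unfolding lepoll_def by blast
  from someI_ex[OF this, folded code_def] show "inj code" "range code \<in> \<U>" by auto
qed

lemma small_code_image: "(\<lambda>x. code (F x)) ` B \<in> \<U>"
  by (rule small_subset[OF code(2)]) auto

abbreviation "topos \<equiv> sheaf_cat \<U> SC ST"

lemma ST_sieve: "X \<in> cobj SC \<Longrightarrow> S \<in> ST X \<Longrightarrow> sieve SC X S"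
  by (simp add: cobj_SC cover_iff)

lemma ST_cover: "Y \<in> cobj SC \<Longrightarrow> S \<in> ST Y \<Longrightarrow> \<exists>K\<in>\<U>. \<exists>F. (\<forall>k\<in>K. F k \<in> S) \<and>
    (\<forall>A\<in>models \<U>. \<forall>y\<in>pts A Y. \<exists>k\<in>K. \<exists>xs\<in>pts A (fst (F k)). ap A (F k) xs = y)"
  by (simp add: cobj_SC cover_iff)

text \<open>
  For a presheaf whose elements \<open>t\<close> have values \<open>val t v\<close> at the points \<open>v\<close> of a model, a matching family
  assigns the same value to all preimages of a point: the two preimages come from one point of the
  fibre product.
\<close>

lemma matching_compat:
  assumes S: "sieve SC Y S"
    and sQ: "\<And>f. f \<in> S \<Longrightarrow> s f \<in> Q (fst f)"
    and s: "\<And>f g. f \<in> S \<Longrightarrow> g \<in> carr SC \<Longrightarrow> fst (snd g) = fst f \<Longrightarrow> s (ccomp SC f g) = act g (s f)"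
    and val: "\<And>g t v. g \<in> carr SC \<Longrightarrow> t \<in> Q (fst (snd g)) \<Longrightarrow> v \<in> pts A (fst g) \<Longrightarrow> val (act g t) v = val t (ap A g v)"
    and A: "A \<in> models \<U>" and f: "f \<in> S" "xs \<in> pts A (fst f)" and g: "g \<in> S" "ys \<in> pts A (fst g)"
    and eq: "ap A f xs = ap A g ys"
  shows "val (s f) xs = val (s g) ys"
proof -
  have fg: "f \<in> carr SC" "g \<in> carr SC" "fst (snd f) = fst (snd g)" using S f g by (auto simp: sieve_def)
  obtain p q where pq: "p \<in> carr SC" "q \<in> carr SC" "fst p = fst q" "fst (snd p) = fst f" "fst (snd q) = fst g"
    "ccomp SC f p = ccomp SC g q"
    and ex: "\<And>A xs ys. A \<in> models \<U> \<Longrightarrow> xs \<in> pts A (fst f) \<Longrightarrow> ys \<in> pts A (fst g) \<Longrightarrow> ap A f xs = ap A g ys \<Longrightarrow>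
      \<exists>v\<in>pts A (fst p). ap A p v = xs \<and> ap A q v = ys"
    using fibre_product[OF fg] by metis
  obtain v where v: "v \<in> pts A (fst p)" "ap A p v = xs" "ap A q v = ys"
    using ex[OF A f(2) g(2) eq] by blast
  have "act p (s f) = act q (s g)"
    using s[OF f(1) pq(1,4)] s[OF g(1) pq(2,5)] pq(6) by simp
  moreover have "val (act p (s f)) v = val (s f) xs" "val (act q (s g)) v = val (s g) ys"
    using val[OF pq(1), of "s f" v] val[OF pq(2), of "s g" v] sQ[OF f(1)] sQ[OF g(1)] pq v by auto
  ultimately show ?thesis by simp
qed

subsection \<open>The underlying object of the generic model\<close>

text \<open>
  The object \<open>{x. \<top>}\<close> represents the underlying object of the generic model.  Its elements at stage \<open>Y\<close>
  are the definable functions from \<open>Y\<close> to the model.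
\<close>

definition line :: "'u fic" where "line = (1, FTop)"

lemma ob_line: "ob line" by (simp add: line_def)

lemma pts_line: "pts A line = tup A 1" by (auto simp: pts_def line_def)

definition funs :: "'u fic \<Rightarrow> 'u syn_arrow set" where
  "funs Y = {t \<in> carr SC. fst t = Y \<and> fst (snd t) = line}"

definition fcode :: "'u syn_arrow \<Rightarrow> 'u" where
  "fcode t = code (to_nat ` (\<Union>\<theta>\<in>snd (snd t). disjuncts \<theta>))"

definition line_sheaf :: "('u fic, 'u syn_arrow, 'u) psh" where
  "line_sheaf = enc_psh SC fcode funs (\<lambda>f t. ccomp SC t f)"

lemma inj_fcode: "inj_on fcode (funs Y)"
proof (rule inj_onI)
  fix t t' assume t: "t \<in> funs Y" and t': "t' \<in> funs Y" and "fcode t = fcode t'"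
  then have "to_nat ` (\<Union>\<theta>\<in>snd (snd t). disjuncts \<theta>) = to_nat ` (\<Union>\<theta>\<in>snd (snd t'). disjuncts \<theta>)"
    by (simp add: fcode_def inj_eq[OF code(1)])
  then have eq: "(\<Union>\<theta>\<in>snd (snd t). disjuncts \<theta>) = (\<Union>\<theta>\<in>snd (snd t'). disjuncts \<theta>)"
    by (simp only: inj_image_eq_iff[OF inj_to_nat])
  have gr: "gr A t = {(xs, ys). xs \<in> tup A (fst (fst t)) \<and> ys \<in> tup A (fst (fst (snd t))) \<and>
     (\<exists>a\<in>(\<Union>\<theta>\<in>snd (snd t). disjuncts \<theta>). psat A a ((!) (ys @ xs)))}" for A :: "'u mv" and t :: "'u syn_arrow"
    by (auto simp: gr_def fsat_disjuncts)
  have "gr A t = gr A t'" for A :: "'u mv"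
    unfolding gr[of A t] gr[of A t'] eq using t t' by (simp add: funs_def)
  then have "ap A t = ap A t'" for A :: "'u mv" by (simp add: ap_def[abs_def])
  then show "t = t'"
    using t t' by (intro arr_eqI) (auto simp: funs_def)
qed

lemma funs_act:
  assumes "f \<in> carr SC" "t \<in> funs (fst (snd f))"
  shows "ccomp SC t f \<in> funs (fst f)"
    and "A \<in> models \<U> \<Longrightarrow> xs \<in> pts A (fst f) \<Longrightarrow> ap A (ccomp SC t f) xs = ap A t (ap A f xs)"
  using assms syn_comp[OF assms(1), of t] by (auto simp: funs_def)

lemma line_presheaf: "presheaf \<U> SC line_sheaf"
  unfolding line_sheaf_def
proof (rule presheaf_enc_psh[OF syn_category])
  show "fcode ` funs X \<in> \<U>" for X unfolding fcode_def by (rule small_code_image)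
  show "ccomp SC t (cid SC X) = t" if "t \<in> funs X" for X t
    using cat_unit(1)[OF syn_category, of t] that by (simp add: funs_def)
  show "ccomp SC t (ccomp SC g f) = ccomp SC (ccomp SC t g) f"
    if "f \<in> carr SC" "g \<in> carr SC" "ccod SC f = cdom SC g" "t \<in> funs (ccod SC g)" for f g t
    using cat_assoc[OF syn_category, of f g t] that by (simp add: funs_def)
qed (simp_all add: inj_fcode funs_act(1))

text \<open>
  A matching family \<open>s\<close> on a cover \<open>F k\<close> is glued by the formula that relates \<open>y\<close> to \<open>x\<close> if, for some \<open>k\<close>, some
  \<open>w\<close> is sent to \<open>y\<close> by \<open>F k\<close> and to \<open>x\<close> by \<open>s (F k)\<close>.
\<close>

lemma line_is_sheaf: "sheaf SC ST line_sheaf"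
  unfolding line_sheaf_def
proof (rule sheaf_enc_psh[OF syn_category inj_fcode ST_sieve])
  show "ccomp SC t f \<in> funs (cdom SC f)" if "f \<in> carr SC" "t \<in> funs (ccod SC f)" for f t
    using that funs_act(1) by simp
next
  fix Y S t t' assume Y: "Y \<in> cobj SC" and S: "S \<in> ST Y" and t: "t \<in> funs Y" "t' \<in> funs Y"
    and eq: "\<And>f. f \<in> S \<Longrightarrow> ccomp SC t f = ccomp SC t' f"
  obtain K :: "'u set" and F where K: "\<forall>k\<in>K. F k \<in> S"
    and F': "\<forall>A\<in>models \<U>. \<forall>y\<in>pts A Y. \<exists>k\<in>K. \<exists>xs\<in>pts A (fst (F k)). ap A (F k) xs = y"
    using ST_cover[OF Y S] by blast
  note F = F'[rule_format]
  have S': "f \<in> carr SC" "fst (snd f) = Y" if "f \<in> S" for f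
    using ST_sieve[OF Y S] that by (auto simp: sieve_def)
  show "t = t'"
  proof (rule arr_eqI)
    fix A y assume A: "A \<in> models \<U>" and "y \<in> pts A (fst t)"
    then have "y \<in> pts A Y" using t by (simp add: funs_def)
    then obtain k x where k: "F k \<in> S" "x \<in> pts A (fst (F k))" "ap A (F k) x = y" using F[OF A] K by blast
    have "ap A t y = ap A (ccomp SC t (F k)) x" "ap A t' y = ap A (ccomp SC t' (F k)) x"
      using funs_act(2)[OF S'(1)[OF k(1)] _ A k(2)] S'[OF k(1)] t k by auto
    then show "ap A t y = ap A t' y" using eq[OF k(1)] by simp
  qed (use t in \<open>auto simp: funs_def\<close>)
next
  fix Y S s assume Y: "Y \<in> cobj SC" and S: "S \<in> ST Y"
    and s1: "\<And>f. f \<in> S \<Longrightarrow> s f \<in> funs (cdom SC f)"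
    and s2: "\<And>f g. f \<in> S \<Longrightarrow> g \<in> carr SC \<Longrightarrow> ccod SC g = cdom SC f \<Longrightarrow> s (ccomp SC f g) = ccomp SC (s f) g"
  obtain K F where K': "K \<in> \<U>" "\<forall>k\<in>K. F k \<in> S"
    and F': "\<forall>A\<in>models \<U>. \<forall>y\<in>pts A Y. \<exists>k\<in>K. \<exists>xs\<in>pts A (fst (F k)). ap A (F k) xs = y"
    using ST_cover[OF Y S] by blast
  note K = K'(1) K'(2)[rule_format]
  note F = F'[rule_format]
  have S': "f \<in> carr SC" "fst (snd f) = Y" if "f \<in> S" for f
    using ST_sieve[OF Y S] that by (auto simp: sieve_def)
  have sf: "s f \<in> carr SC" "fst (s f) = fst f" "fst (snd (s f)) = line" if "f \<in> S" for f
    using s1[OF that] by (auto simp: funs_def)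
  have compat: "ap A (s f) xs = ap A (s g) ys"
    if "A \<in> models \<U>" "f \<in> S" "xs \<in> pts A (fst f)" "g \<in> S" "ys \<in> pts A (fst g)" "ap A f xs = ap A g ys" for A f g xs ys
    using that s1 s2 funs_act(2)[OF _ _ that(1)]
    by (intro matching_compat[where Q = funs and act = "\<lambda>f t. ccomp SC t f" and val = "ap A" and s = s, OF ST_sieve[OF Y S]]) auto
  have "\<forall>A y. \<exists>ks. A \<in> models \<U> \<longrightarrow> y \<in> pts A Y \<longrightarrow> fst ks \<in> K \<and> snd ks \<in> pts A (fst (F (fst ks))) \<and> ap A (F (fst ks)) (snd ks) = y"
    using F by (metis fst_conv snd_conv)
  then obtain pick where pick: "\<And>A y. A \<in> models \<U> \<Longrightarrow> y \<in> pts A Y \<Longrightarrow>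
      fst (pick A y) \<in> K \<and> snd (pick A y) \<in> pts A (fst (F (fst (pick A y)))) \<and> ap A (F (fst (pick A y))) (snd (pick A y)) = y"
    by metis
  define T where "T A y = ap A (s (F (fst (pick A y)))) (snd (pick A y))" for A y
  have T: "T A (ap A f xs) = ap A (s f) xs" if "A \<in> models \<U>" "f \<in> S" "xs \<in> pts A (fst f)" for A f xs
  proof -
    have "ap A f xs \<in> pts A Y" using ap_pts[OF S'(1)[OF that(2)] that(1,3)] S'(2)[OF that(2)] by simp
    from pick[OF that(1) this] show ?thesis
      unfolding T_def using that K(2) by (intro compat) auto
  qed
  define n where "n = fst Y"
  define R where "R A zs \<longleftrightarrow> (\<exists>k\<in>K. \<exists>w\<in>tup A (fst (fst (F k))). (w, drop 1 zs) \<in> gr A (F k) \<and> (w, take 1 zs) \<in> gr A (s (F k)))"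
    for A :: "'u mv" and zs
  have "\<exists>t\<in>carr SC. fst t = Y \<and> fst (snd t) = line \<and> (\<forall>A\<in>models \<U>. \<forall>y\<in>pts A Y. ap A t y = T A y)"
  proof (rule arr_ex)
    show "ob Y" "ob line" using Y ob_line by (auto simp: cobj_SC)
    have "dfn (1 + n) R"
      unfolding R_def
    proof (rule dfn_or[OF K(1)])
      fix k assume k: "k \<in> K"
      define m where "m = fst (fst (F k))"
      note Fk = S'[OF K(2)[OF k]] and sk = sf[OF K(2)[OF k]]
      have "dfn (m + (1 + n)) (\<lambda>A ws. (take m (drop 0 ws), take n (drop (m + 1) ws)) \<in> gr A (F k) \<and>
         (take m (drop 0 ws), take 1 (drop m ws)) \<in> gr A (s (F k)))"
        using dfn_gr[OF Fk(1), of "m + 1" "m + (1 + n)" 0] dfn_gr[OF sk(1), of "m" "m + (1 + n)" 0] Fk sk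
        by (intro dfn_conj) (auto simp: m_def n_def line_def)
      then have "dfn (1 + n) (\<lambda>A zs. \<exists>w\<in>tup A m. (take m (drop 0 (w @ zs)), take n (drop (m + 1) (w @ zs))) \<in> gr A (F k) \<and>
         (take m (drop 0 (w @ zs)), take 1 (drop m (w @ zs))) \<in> gr A (s (F k)))"
        by (rule dfn_ex)
      then show "dfn (1 + n) (\<lambda>A zs. \<exists>w\<in>tup A (fst (fst (F k))). (w, drop 1 zs) \<in> gr A (F k) \<and> (w, take 1 zs) \<in> gr A (s (F k)))"
        by (rule dfn_cong) (auto simp: m_def tup_def)
    qed
    then show "dfn (fst line + fst Y) R" by (simp add: line_def n_def)
    fix A y assume A: "A \<in> models \<U>"
    show "T A y \<in> pts A line" if "y \<in> pts A Y"
    proof -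
      let ?k = "fst (pick A y)"
      have "F ?k \<in> S" using pick[OF A that] K(2) by blast
      then show ?thesis
        unfolding T_def using pick[OF A that] ap_pts[OF sf(1) A, of "F ?k"] sf(2,3) by simp
    qed
    fix x assume y: "y \<in> tup A (fst Y)" and "x \<in> tup A (fst line)"
    then have x: "length x = 1" by (simp add: tup_def line_def)
    have "(\<exists>w\<in>tup A (fst (fst (F k))). (w, y) \<in> gr A (F k) \<and> (w, x) \<in> gr A (s (F k))) \<longleftrightarrow>
        (\<exists>w\<in>pts A (fst (F k)). y = ap A (F k) w \<and> x = ap A (s (F k)) w)" if "k \<in> K" for k
      unfolding gr_iff[OF S'(1)[OF K(2)[OF that]] A] gr_iff[OF sf(1)[OF K(2)[OF that]] A] sf(2)[OF K(2)[OF that]]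
      by (blast dest: pts_tup)
    then have "R A (x @ y) \<longleftrightarrow> (\<exists>k\<in>K. \<exists>w\<in>pts A (fst (F k)). y = ap A (F k) w \<and> x = ap A (s (F k)) w)"
      using x by (simp add: R_def)
    also have "\<dots> \<longleftrightarrow> y \<in> pts A Y \<and> x = T A y"
    proof
      assume "\<exists>k\<in>K. \<exists>w\<in>pts A (fst (F k)). y = ap A (F k) w \<and> x = ap A (s (F k)) w"
      then obtain k w where "k \<in> K" "w \<in> pts A (fst (F k))" "y = ap A (F k) w" "x = ap A (s (F k)) w" by blast
      then show "y \<in> pts A Y \<and> x = T A y"
        using T[OF A K(2)] ap_pts[OF S'(1)[OF K(2)] A] S'(2)[OF K(2)] by metis
    next
      assume "y \<in> pts A Y \<and> x = T A y"
      then show "\<exists>k\<in>K. \<exists>w\<in>pts A (fst (F k)). y = ap A (F k) w \<and> x = ap A (s (F k)) w"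
        using pick[OF A] unfolding T_def by metis
    qed
    finally show "R A (x @ y) \<longleftrightarrow> y \<in> pts A Y \<and> x = T A y" .
  qed
  then obtain t where t: "t \<in> funs Y" "\<And>A y. A \<in> models \<U> \<Longrightarrow> y \<in> pts A Y \<Longrightarrow> ap A t y = T A y"
    unfolding funs_def by blast
  show "\<exists>t\<in>funs Y. \<forall>f\<in>S. ccomp SC t f = s f"
  proof (intro bexI[OF _ t(1)] ballI)
    fix f assume f: "f \<in> S"
    have tf: "t \<in> funs (fst (snd f))" using t S'[OF f] by simp
    show "ccomp SC t f = s f"
    proof (rule arr_eqI)
      fix A xs assume A: "A \<in> models \<U>" and "xs \<in> pts A (fst (ccomp SC t f))"
      then have xs: "xs \<in> pts A (fst f)" using funs_act(1)[OF S'(1)[OF f] tf] by (simp add: funs_def)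
      then show "ap A (ccomp SC t f) xs = ap A (s f) xs"
        using funs_act(2)[OF S'(1)[OF f] tf A xs] t(2)[OF A] T[OF A f xs] ap_pts[OF S'(1)[OF f] A xs] S'(2)[OF f] by simp
    qed (use funs_act(1)[OF S'(1)[OF f] tf] sf[OF f] in \<open>auto simp: funs_def\<close>)
  qed
qed

subsection \<open>Skyscraper sheaves\<close>

text \<open>
  The skyscraper at a model \<open>B\<close>: its elements at stage \<open>Y\<close> are arbitrary sets of \<open>B\<close>-points of \<open>Y\<close>, so that
  arrows into it see exactly the stalks at \<open>B\<close>.  If \<open>B\<close> is countable, there are at most continuum many
  such sets.
\<close>

definition zcode :: "'u mv \<Rightarrow> 'u list set \<Rightarrow> 'u" where
  "zcode B T = code (to_nat_on (lists (mcarrier B)) ` T)"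

definition sky_act :: "'u mv \<Rightarrow> 'u syn_arrow \<Rightarrow> 'u list set \<Rightarrow> 'u list set" where
  "sky_act B f T = {xs \<in> pts B (fst f). ap B f xs \<in> T}"

definition sky :: "'u mv \<Rightarrow> ('u fic, 'u syn_arrow, 'u) psh" where
  "sky B = enc_psh SC (zcode B) (\<lambda>Y. Pow (pts B Y)) (sky_act B)"

lemma inj_zcode:
  assumes "countable (mcarrier B)"
  shows "inj_on (zcode B) (Pow (pts B Y))"
proof (rule inj_onI)
  fix T T' assume T: "T \<in> Pow (pts B Y)" "T' \<in> Pow (pts B Y)" and "zcode B T = zcode B T'"
  then have eq: "to_nat_on (lists (mcarrier B)) ` T = to_nat_on (lists (mcarrier B)) ` T'"
    by (simp add: zcode_def inj_eq[OF code(1)])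
  have "pts B Y \<subseteq> lists (mcarrier B)" by (auto simp: pts_def tup_def)
  then have "T \<subseteq> lists (mcarrier B)" "T' \<subseteq> lists (mcarrier B)" using T by auto
  moreover have "inj_on (to_nat_on (lists (mcarrier B))) (lists (mcarrier B))"
    using assms by (intro inj_on_to_nat_on countable_lists)
  ultimately show "T = T'" using eq by (metis inj_on_image_eq_iff)
qed

lemma sky_presheaf:
  assumes "countable (mcarrier B)" and B: "B \<in> models \<U>"
  shows "presheaf \<U> SC (sky B)"
  unfolding sky_def
proof (rule presheaf_enc_psh[OF syn_category])
  show "zcode B ` Pow (pts B X) \<in> \<U>" for X unfolding zcode_def by (rule small_code_image)
  show "sky_act B (cid SC X) T = T" if "X \<in> cobj SC" "T \<in> Pow (pts B X)" for X T
    using that syn_id(2,4)[of X] B by (auto simp: sky_act_def cobj_SC)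
  show "sky_act B (ccomp SC g f) T = sky_act B f (sky_act B g T)"
    if "f \<in> carr SC" "g \<in> carr SC" "ccod SC f = cdom SC g" for f g T
    using that syn_comp[of f g] ap_pts[OF that(1) B] B by (auto simp: sky_act_def)
qed (use inj_zcode[OF assms(1)] in \<open>auto simp: sky_act_def\<close>)

lemma sky_is_sheaf:
  assumes "countable (mcarrier B)" and B: "B \<in> models \<U>"
  shows "sheaf SC ST (sky B)"
  unfolding sky_def
proof (rule sheaf_enc_psh[OF syn_category inj_zcode[OF assms(1)] ST_sieve])
  show "sky_act B f T \<in> Pow (pts B (cdom SC f))" for f T by (auto simp: sky_act_def)
next
  fix Y S T T' assume Y: "Y \<in> cobj SC" and S: "S \<in> ST Y" and T: "T \<in> Pow (pts B Y)" "T' \<in> Pow (pts B Y)"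
    and eq: "\<And>f. f \<in> S \<Longrightarrow> sky_act B f T = sky_act B f T'"
  obtain K :: "'u set" and F where K: "\<forall>k\<in>K. F k \<in> S"
    and F': "\<forall>A\<in>models \<U>. \<forall>y\<in>pts A Y. \<exists>k\<in>K. \<exists>xs\<in>pts A (fst (F k)). ap A (F k) xs = y"
    using ST_cover[OF Y S] by blast
  note F = F'[rule_format]
  have "\<exists>f\<in>S. \<exists>x\<in>pts B (fst f). ap B f x = y" if "y \<in> pts B Y" for y
    using F[OF B that] K by blast
  then have "y \<in> T \<longleftrightarrow> y \<in> T'" if "y \<in> pts B Y" for y
    using eq that unfolding sky_act_def by blast
  then show "T = T'" using T by blast
next
  fix Y S s assume Y: "Y \<in> cobj SC" and S: "S \<in> ST Y"
    and s1: "\<And>f. f \<in> S \<Longrightarrow> s f \<in> Pow (pts B (cdom SC f))"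
    and s2: "\<And>f g. f \<in> S \<Longrightarrow> g \<in> carr SC \<Longrightarrow> ccod SC g = cdom SC f \<Longrightarrow> s (ccomp SC f g) = sky_act B g (s f)"
  have S': "f \<in> carr SC" "fst (snd f) = Y" if "f \<in> S" for f
    using ST_sieve[OF Y S] that by (auto simp: sieve_def)
  have compat: "xs \<in> s f \<longleftrightarrow> ys \<in> s g"
    if "f \<in> S" "xs \<in> pts B (fst f)" "g \<in> S" "ys \<in> pts B (fst g)" "ap B f xs = ap B g ys" for f g xs ys
    using that s1 s2
    by (intro matching_compat[where Q = "\<lambda>Y. Pow (pts B Y)" and act = "sky_act B" and val = "\<lambda>T x. x \<in> T" and s = s, OF ST_sieve[OF Y S] _ _ _ B])
      (auto simp: sky_act_def)
  define T where "T = {ap B f xs | f xs. f \<in> S \<and> xs \<in> pts B (fst f) \<and> xs \<in> s f}"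
  show "\<exists>T\<in>Pow (pts B Y). \<forall>f\<in>S. sky_act B f T = s f"
  proof (intro bexI ballI)
    show "T \<in> Pow (pts B Y)" unfolding T_def using ap_pts[OF S'(1) B] S'(2) by force
    fix f assume f: "f \<in> S"
    have "xs \<in> s f \<longleftrightarrow> ap B f xs \<in> T" if xs: "xs \<in> pts B (fst f)" for xs
    proof
      assume "ap B f xs \<in> T"
      then obtain g ys where "g \<in> S" "ys \<in> pts B (fst g)" "ys \<in> s g" "ap B f xs = ap B g ys"
        unfolding T_def by blast
      then show "xs \<in> s f" using compat[OF f xs] by blast
    next
      assume "xs \<in> s f"
      then show "ap B f xs \<in> T" using f xs unfolding T_def by blast
    qed
    then show "sky_act B f T = s f" using s1[OF f] by (auto simp: sky_act_def)
  qed
qed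

end

section \<open>Generalized elements of the underlying object\<close>

context set_universe
begin

definition decode :: "'u fic \<Rightarrow> 'u \<Rightarrow> 'u syn_arrow" where
  "decode Y x = inv_into (funs Y) fcode x"

lemma pob_line [simp]: "pob line_sheaf Y = fcode ` funs Y"
  by (simp add: line_sheaf_def)

lemma decode_funs: "x \<in> pob line_sheaf Y \<Longrightarrow> decode Y x \<in> funs Y" "x \<in> pob line_sheaf Y \<Longrightarrow> fcode (decode Y x) = x"
  by (auto simp: decode_def inv_into_into f_inv_into_f)

lemma decode_fcode: "t \<in> funs Y \<Longrightarrow> decode Y (fcode t) = t"
  by (simp add: decode_def inv_into_f_f inj_fcode)

lemma pact_line: "f \<in> carr SC \<Longrightarrow> x \<in> pob line_sheaf (fst (snd f)) \<Longrightarrow>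
    pact line_sheaf f x = fcode (ccomp SC (decode (fst (snd f)) x) f)"
  by (simp add: line_sheaf_def enc_psh_def decode_def)

lemma decode_pact:
  assumes "f \<in> carr SC" "x \<in> pob line_sheaf (fst (snd f))" "A \<in> models \<U>" "y \<in> pts A (fst f)"
  shows "ap A (decode (fst f) (pact line_sheaf f x)) y = ap A (decode (fst (snd f)) x) (ap A f y)"
proof -
  let ?t = "decode (fst (snd f)) x"
  have t: "?t \<in> funs (fst (snd f))" using decode_funs[OF assms(2)] by simp
  show ?thesis
    unfolding pact_line[OF assms(1,2)] decode_fcode[OF funs_act(1)[OF assms(1) t]]
    using funs_act(2)[OF assms(1) t assms(3,4)] .
qed

lemma topos_category: "category topos"
  by (intro sheaf_cat_category syn_category)

lemma line_topos: "line_sheaf \<in> cobj topos"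
  using line_presheaf line_is_sheaf by simp

text \<open>
  A jointly epic family reaches every point of a countable model.  If it missed \<open>b\<close>, the two arrows to the
  skyscraper that send a definable function to its fibre over \<open>b\<close> and to the empty set would agree on the
  family, but they differ on the identity function.
\<close>

lemma jointly_epic_hits:
  assumes S: "jointly_epic topos line_sheaf S"
    and B: "countable (mcarrier B)" "B \<in> models \<U>" and b: "b \<in> mcarrier B"
  shows "\<exists>a\<in>S. \<exists>Y s y. ob Y \<and> s \<in> pob (fst a) Y \<and> y \<in> pts B Y \<and> ap B (decode Y (snd (snd a) Y s)) y = [b]"
proof (rule ccontr)
  assume no: "\<not> ?thesis"
  let ?Z = "sky B"
  define w where "w c = psh_arr SC line_sheaf ?Z (\<lambda>Y x. zcode B {y \<in> pts B Y. c \<and> ap B (decode Y x) y = [b]})" for c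
  have w: "w c \<in> carr topos" for c
  proof -
    have "w c \<in> carr (presheaf_cat \<U> SC)"
      unfolding w_def
    proof (rule psh_arr_carr[OF syn_category line_presheaf sky_presheaf[OF B]])
      show "zcode B {y \<in> pts B Y. c \<and> ap B (decode Y x) y = [b]} \<in> pob (sky B) Y" for Y x
        by (auto simp: sky_def)
      fix f x assume f: "f \<in> carr SC" and "x \<in> pob line_sheaf (ccod SC f)"
      then have x: "x \<in> pob line_sheaf (fst (snd f))" by simp
      have "pact (sky B) f (zcode B {y \<in> pts B (ccod SC f). c \<and> ap B (decode (ccod SC f) x) y = [b]}) =
         zcode B (sky_act B f {y \<in> pts B (ccod SC f). c \<and> ap B (decode (ccod SC f) x) y = [b]})"
        unfolding sky_def by (rule pact_enc_psh) (auto intro: inj_zcode B)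
      also have "sky_act B f {y \<in> pts B (ccod SC f). c \<and> ap B (decode (ccod SC f) x) y = [b]} =
         {y \<in> pts B (fst f). c \<and> ap B (decode (fst f) (pact line_sheaf f x)) y = [b]}"
        using decode_pact[OF f x B(2)] ap_pts[OF f B(2)] by (auto simp: sky_act_def)
      finally show "zcode B {y \<in> pts B (cdom SC f). c \<and> ap B (decode (cdom SC f) (pact line_sheaf f x)) y = [b]} =
         pact (sky B) f (zcode B {y \<in> pts B (ccod SC f). c \<and> ap B (decode (ccod SC f) x) y = [b]})"
        by simp
    qed
    then show ?thesis
      using line_is_sheaf sky_is_sheaf[OF B] by (simp add: carr_sheaf_cat w_def)
  qed
  have "ccomp topos (w True) a = ccomp topos (w False) a" if a: "a \<in> S" for a
  proof -
    have a': "a \<in> carr topos" "fst (snd a) = line_sheaf" using S a by (auto simp: jointly_epic_def)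
    then have a'': "a \<in> carr (presheaf_cat \<U> SC)" "nat_trans SC (fst a) line_sheaf (snd (snd a))"
      by (auto simp: carr_sheaf_cat carr_presheaf_cat)
    have w': "w c \<in> carr (presheaf_cat \<U> SC)" "fst (snd a) = fst (w c)" for c
      using w[of c] a' by (auto simp: carr_sheaf_cat w_def)
    note cc = ccomp_carr[OF syn_category a''(1) w']
    have "ccomp (presheaf_cat \<U> SC) (w True) a = ccomp (presheaf_cat \<U> SC) (w False) a"
    proof (rule presheaf_cat_eqI[OF cc cc])
      fix Y s assume Y: "Y \<in> cobj SC" and "s \<in> pob (fst (ccomp (presheaf_cat \<U> SC) (w True) a)) Y"
      then have s: "s \<in> pob (fst a) Y" by (simp add: ccomp_presheaf_cat)
      have x: "snd (snd a) Y s \<in> pob line_sheaf Y" using nat_trans_closed[OF a''(2) Y s] .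
      have "{y \<in> pts B Y. ap B (decode Y (snd (snd a) Y s)) y = [b]} = {}"
        using no a Y s unfolding cobj_SC by blast
      then show "snd (snd (ccomp (presheaf_cat \<U> SC) (w True) a)) Y s = snd (snd (ccomp (presheaf_cat \<U> SC) (w False) a)) Y s"
        using Y s x unfolding ccomp_presheaf_cat w_def
        by (simp del: pob_line Collect_empty_eq)
    qed (auto simp: ccomp_presheaf_cat w_def)
    then show ?thesis by simp
  qed
  moreover have "fst (w c) = line_sheaf" "fst (snd (w c)) = sky B" for c by (simp_all add: w_def)
  ultimately have "w True = w False"
    using S w unfolding jointly_epic_def by simp
  define x where "x = fcode (cid SC line)"
  have id: "cid SC line \<in> funs line" using syn_id[OF ob_line] by (simp add: funs_def)
  have x: "x \<in> pob line_sheaf line" using id by (simp add: x_def)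
  have e: "decode line x = cid SC line" using decode_fcode[OF id] by (simp add: x_def)
  have bl: "[b] \<in> pts B line" using b by (simp add: pts_line tup_def)
  have "snd (snd (w True)) line x = snd (snd (w False)) line x" using \<open>w True = w False\<close> by simp
  then have "zcode B {y \<in> pts B line. ap B (decode line x) y = [b]} = zcode B {}"
    using x ob_line unfolding w_def by (simp add: cobj_SC del: pob_line)
  then have "{y \<in> pts B line. ap B (decode line x) y = [b]} = {}"
    by (rule inj_onD[OF inj_zcode[OF B(1)]]) auto
  moreover have "ap B (decode line x) [b] = [b]" unfolding e using syn_id(4)[OF ob_line B(2) bl] .
  ultimately show False using bl by blast
qed

text \<open>
  For definable \<open>R\<close> these are the elements of the subobject \<open>{x. R x}\<close>; \<open>restrict_psh a R\<close> below is its
  pullback along the arrow \<open>a\<close>.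
\<close>

definition lies_in :: "('u mv \<Rightarrow> 'u list \<Rightarrow> bool) \<Rightarrow> 'u fic \<Rightarrow> 'u \<Rightarrow> bool" where
  "lies_in R Y x \<longleftrightarrow> (\<forall>A\<in>models \<U>. \<forall>y\<in>pts A Y. R A (ap A (decode Y x) y))"

lemma lies_in_pact:
  assumes "f \<in> carr SC" "x \<in> pob line_sheaf (fst (snd f))" "lies_in R (fst (snd f)) x"
  shows "lies_in R (fst f) (pact line_sheaf f x)"
  using assms(3) unfolding lies_in_def
  by (simp add: decode_pact[OF assms(1,2)] ap_pts[OF assms(1)] del: pob_line)

lemma lies_in_local:
  assumes Y: "Y \<in> cobj SC" and S: "S \<in> ST Y" and x: "x \<in> pob line_sheaf Y"
    and l: "\<And>f. f \<in> S \<Longrightarrow> lies_in R (fst f) (pact line_sheaf f x)"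
  shows "lies_in R Y x"
  unfolding lies_in_def
proof (intro ballI)
  fix A y assume A: "A \<in> models \<U>" and y: "y \<in> pts A Y"
  obtain K :: "'u set" and F where K: "\<forall>k\<in>K. F k \<in> S"
    and F': "\<forall>A\<in>models \<U>. \<forall>y\<in>pts A Y. \<exists>k\<in>K. \<exists>xs\<in>pts A (fst (F k)). ap A (F k) xs = y"
    using ST_cover[OF Y S] by blast
  obtain f z where f: "f \<in> S" "z \<in> pts A (fst f)" "ap A f z = y" using F' K A y by blast
  have f': "f \<in> carr SC" "fst (snd f) = Y" using ST_sieve[OF Y S] f by (auto simp: sieve_def)
  have "R A (ap A (decode (fst f) (pact line_sheaf f x)) z)" using l[OF f(1)] A f(2) by (simp add: lies_in_def)
  then show "R A (ap A (decode Y x) y)" using decode_pact[OF f'(1) _ A f(2)] x f' f(3) by simp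
qed

definition restrict_psh :: "('u fic, 'u syn_arrow, 'u) psh_arrow \<Rightarrow> ('u mv \<Rightarrow> 'u list \<Rightarrow> bool) \<Rightarrow> ('u fic, 'u syn_arrow, 'u) psh" where
  "restrict_psh a R = \<lparr>pob = (\<lambda>Y. {s \<in> pob (fst a) Y. lies_in R Y (snd (snd a) Y s)}), pact = pact (fst a)\<rparr>"

lemma restrict_simps [simp]: "s \<in> pob (restrict_psh a R) Y \<longleftrightarrow> s \<in> pob (fst a) Y \<and> lies_in R Y (snd (snd a) Y s)"
  "pact (restrict_psh a R) = pact (fst a)"
  by (simp_all add: restrict_psh_def)

context
  fixes a assumes a: "a \<in> carr topos" and acod: "fst (snd a) = line_sheaf"
begin

lemma a_facts: "presheaf \<U> SC (fst a)" "sheaf SC ST (fst a)" "nat_trans SC (fst a) line_sheaf (snd (snd a))"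
  using a acod by (auto simp: carr_sheaf_cat carr_presheaf_cat)

lemma lies_in_restrict:
  assumes "f \<in> carr SC" "s \<in> pob (fst a) (fst (snd f))" "lies_in R (fst (snd f)) (snd (snd a) (fst (snd f)) s)"
  shows "lies_in R (fst f) (snd (snd a) (fst f) (pact (fst a) f s))"
proof -
  have "snd (snd a) (fst (snd f)) s \<in> pob line_sheaf (fst (snd f))"
    using nat_trans_closed[OF a_facts(3) _ assms(2)] arr_ob[OF assms(1)] by (simp add: cobj_SC)
  then show ?thesis
    using lies_in_pact[OF assms(1) _ assms(3)] nat_trans_natural[OF a_facts(3) assms(1)] assms(2) by simp
qed

lemma restrict_presheaf: "presheaf \<U> SC (restrict_psh a R)"
  unfolding presheaf_def
proof (intro conjI ballI impI)
  fix X assume "X \<in> cobj SC"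
  then have "pob (fst a) X \<in> \<U>" using a_facts(1) by (simp add: presheaf_def)
  then show "pob (restrict_psh a R) X \<in> \<U>" by (rule small_subset) auto
next
  fix f x assume "f \<in> carr SC" "x \<in> pob (restrict_psh a R) (ccod SC f)"
  then show "pact (restrict_psh a R) f x \<in> pob (restrict_psh a R) (cdom SC f)"
    using lies_in_restrict presheaf_act[OF a_facts(1)] by simp
qed (use presheaf_id[OF a_facts(1)] presheaf_comp[OF a_facts(1)] in auto)

lemma restrict_sheaf: "sheaf SC ST (restrict_psh a R)"
  unfolding sheaf_def
proof (intro ballI allI impI)
  fix X S s assume X: "X \<in> cobj SC" and S: "S \<in> ST X"
    and s: "(\<forall>f\<in>S. s f \<in> pob (restrict_psh a R) (cdom SC f)) \<and>
          (\<forall>f\<in>S. \<forall>g\<in>carr SC. ccod SC g = cdom SC f \<longrightarrow> s (ccomp SC f g) = pact (restrict_psh a R) g (s f))"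
  then have ex1: "\<exists>!x. x \<in> pob (fst a) X \<and> (\<forall>f\<in>S. pact (fst a) f x = s f)"
    using a_facts(2)[unfolded sheaf_def, rule_format, OF X S, of s] by auto
  have "lies_in R X (snd (snd a) X x)" if x: "x \<in> pob (fst a) X" "\<forall>f\<in>S. pact (fst a) f x = s f" for x
  proof (rule lies_in_local[OF X S nat_trans_closed[OF a_facts(3) X x(1)]])
    fix f assume f: "f \<in> S"
    have f': "f \<in> carr SC" "fst (snd f) = X" using ST_sieve[OF X S] f by (auto simp: sieve_def)
    have "pact line_sheaf f (snd (snd a) X x) = snd (snd a) (fst f) (s f)"
      using nat_trans_natural[OF a_facts(3) f'(1), of x] x f' f by simp
    then show "lies_in R (fst f) (pact line_sheaf f (snd (snd a) X x))" using s f by simp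
  qed
  then have "(x \<in> pob (restrict_psh a R) X \<and> (\<forall>f\<in>S. pact (restrict_psh a R) f x = s f)) \<longleftrightarrow>
      (x \<in> pob (fst a) X \<and> (\<forall>f\<in>S. pact (fst a) f x = s f))" for x
    unfolding restrict_simps by blast
  then show "\<exists>!x. x \<in> pob (restrict_psh a R) X \<and> (\<forall>f\<in>S. pact (restrict_psh a R) f x = s f)"
    using ex1 by (simp only:)
qed

definition incl :: "('u mv \<Rightarrow> 'u list \<Rightarrow> bool) \<Rightarrow> ('u fic, 'u syn_arrow, 'u) psh_arrow" where
  "incl R = psh_arr SC (restrict_psh a R) (fst a) (\<lambda>Y s. s)"

lemma incl_carr: "incl R \<in> carr (presheaf_cat \<U> SC)" "incl R \<in> carr topos"
proof -
  show "incl R \<in> carr (presheaf_cat \<U> SC)"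
    unfolding incl_def by (rule psh_arr_carr[OF syn_category restrict_presheaf a_facts(1)]) auto
  then show "incl R \<in> carr topos"
    using restrict_sheaf a_facts(2) by (simp add: carr_sheaf_cat incl_def)
qed

text \<open>
  Given an element \<open>s\<close> at stage \<open>Y\<close>, the definable function \<open>a s\<close> splits \<open>Y\<close> into the two definable parts on
  which its values satisfy \<open>R1\<close> and \<open>R2\<close>.  Their inclusions cover \<open>Y\<close>, and the restrictions of \<open>s\<close> to them
  belong to the two pullbacks.
\<close>

lemma incl_jointly_epic:
  assumes dfn: "dfn 1 R1" "dfn 1 R2" and cover: "\<And>A x. A \<in> models \<U> \<Longrightarrow> x \<in> tup A 1 \<Longrightarrow> R1 A x \<or> R2 A x"
  shows "jointly_epic topos (fst a) {incl R1, incl R2}"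
  unfolding jointly_epic_def
proof (intro conjI ballI impI)
  fix f assume "f \<in> {incl R1, incl R2}"
  then show "f \<in> carr topos" "ccod topos f = fst a" using incl_carr(2) by (auto simp: incl_def)
next
  fix u v assume u: "u \<in> carr topos" "cdom topos u = fst a" and v: "v \<in> carr topos" "cdom topos v = fst a"
    and cod: "ccod topos u = ccod topos v"
    and eq: "\<forall>f\<in>{incl R1, incl R2}. ccomp topos u f = ccomp topos v f"
  define W where "W = fst (snd u)"
  have u': "u \<in> carr (presheaf_cat \<U> SC)" "nat_trans SC (fst a) W (snd (snd u))" "sheaf SC ST W"
    and v': "v \<in> carr (presheaf_cat \<U> SC)" "nat_trans SC (fst a) W (snd (snd v))"
    using u v cod by (auto simp: carr_sheaf_cat carr_presheaf_cat W_def)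
  have eq': "snd (snd u) Y s = snd (snd v) Y s"
    if Y: "Y \<in> cobj SC" and s: "s \<in> pob (fst a) Y" and R: "R = R1 \<or> R = R2" "lies_in R Y (snd (snd a) Y s)" for Y s R
  proof -
    have "snd (snd (ccomp topos u (incl R))) Y s = snd (snd (ccomp topos v (incl R))) Y s" using eq R by auto
    then show ?thesis using Y s R(2) by (simp add: ccomp_presheaf_cat incl_def)
  qed
  show "u = v"
  proof (rule presheaf_cat_eqI[OF u'(1) v'(1)])
    fix Y s assume Y: "Y \<in> cobj SC" and "s \<in> pob (fst u) Y"
    then have s: "s \<in> pob (fst a) Y" using u by simp
    let ?x = "snd (snd a) Y s"
    have x: "?x \<in> pob line_sheaf Y" using nat_trans_closed[OF a_facts(3) Y s] .
    define t where "t = decode Y ?x"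
    have t: "t \<in> carr SC" "fst t = Y" "fst (snd t) = line" using decode_funs(1)[OF x] by (auto simp: t_def funs_def)
    have obY: "ob Y" using Y by (simp add: cobj_SC)
    define n where "n = fst Y"
    have part: "\<exists>i\<in>carr SC. fst (snd i) = Y \<and> lies_in R (fst i) (pact line_sheaf i ?x) \<and>
       (\<forall>A\<in>models \<U>. \<forall>y\<in>pts A Y. R A (ap A t y) \<longrightarrow> (\<exists>z\<in>pts A (fst i). ap A i z = y))" if R: "dfn 1 R" for R
    proof -
      have "dfn (1 + n) (\<lambda>A zs. (take n (drop 1 zs), take 1 (drop 0 zs)) \<in> gr A t \<and> R A (take 1 (drop 0 zs)))"
        using dfn_gr[OF t(1), of 0 "1 + n" 1] t by (intro dfn_conj dfn_slice[OF R]) (auto simp: n_def line_def)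
      then have "dfn n (\<lambda>A y. \<exists>w\<in>tup A 1. (take n (drop 1 (w @ y)), take 1 (drop 0 (w @ y))) \<in> gr A t \<and> R A (take 1 (drop 0 (w @ y))))"
        by (rule dfn_ex)
      then have "dfn n (\<lambda>A y. \<exists>w\<in>tup A 1. (y, w) \<in> gr A t \<and> R A w)"
        by (rule dfn_cong) (auto simp: tup_def)
      then have D: "dfn n (\<lambda>A y. y \<in> pts A Y \<and> R A (ap A t y))"
      proof (rule dfn_cong)
        fix A y assume A: "A \<in> models \<U>"
        show "(\<exists>w\<in>tup A 1. (y, w) \<in> gr A t \<and> R A w) \<longleftrightarrow> y \<in> pts A Y \<and> R A (ap A t y)"
          unfolding gr_iff[OF t(1) A] using ap_pts[OF t(1) A] by (auto simp: t pts_line)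
      qed
      obtain V where V: "ob V" "fst V = n" "\<And>A. A \<in> models \<U> \<Longrightarrow> pts A V = {y \<in> tup A n. y \<in> pts A Y \<and> R A (ap A t y)}"
        using ob_ex[OF D] by blast
      have "\<exists>i\<in>carr SC. fst i = V \<and> fst (snd i) = Y \<and> (\<forall>A\<in>models \<U>. \<forall>y\<in>pts A V. ap A i y = y)"
      proof (rule arr_ex[OF V(1) obY, of "\<lambda>A zs. take n (drop 0 zs) = take n (drop n zs) \<and> take n (drop n zs) \<in> pts A V"])
        show "dfn (fst Y + fst V) (\<lambda>A zs. take n (drop 0 zs) = take n (drop n zs) \<and> take n (drop n zs) \<in> pts A V)"
          using V dfn_pts[OF V(1)] by (intro dfn_conj dfn_eq dfn_slice) (auto simp: n_def)
      qed (auto simp: V n_def tup_def)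
      then obtain i where i: "i \<in> carr SC" "fst i = V" "fst (snd i) = Y" "\<forall>A\<in>models \<U>. \<forall>y\<in>pts A V. ap A i y = y" by blast
      have xi: "?x \<in> pob line_sheaf (fst (snd i))" using x i by simp
      have "lies_in R (fst i) (pact line_sheaf i ?x)"
        unfolding lies_in_def
      proof (intro ballI)
        fix A y assume A: "A \<in> models \<U>" and y: "y \<in> pts A (fst i)"
        show "R A (ap A (decode (fst i) (pact line_sheaf i ?x)) y)"
          using decode_pact[OF i(1) xi A y] A y i V by (simp add: t_def)
      qed
      moreover have "\<exists>z\<in>pts A (fst i). ap A i z = y" if "A \<in> models \<U>" "y \<in> pts A Y" "R A (ap A t y)" for A y
        using that i V pts_tup[OF that(2)] by (intro bexI[of _ y]) (auto simp: n_def)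
      ultimately show ?thesis using i by blast
    qed
    define S where "S = {f \<in> carr SC. fst (snd f) = Y \<and> (\<exists>R\<in>{R1, R2}. lies_in R (fst f) (pact line_sheaf f ?x))}"
    obtain i1 i2 where i1: "i1 \<in> S" "\<forall>A\<in>models \<U>. \<forall>y\<in>pts A Y. R1 A (ap A t y) \<longrightarrow> (\<exists>z\<in>pts A (fst i1). ap A i1 z = y)"
      and i2: "i2 \<in> S" "\<forall>A\<in>models \<U>. \<forall>y\<in>pts A Y. R2 A (ap A t y) \<longrightarrow> (\<exists>z\<in>pts A (fst i2). ap A i2 z = y)"
      using part[OF dfn(1)] part[OF dfn(2)] unfolding S_def by blast
    have S: "S \<in> ST Y"
      unfolding cover_iff[OF obY]
    proof (intro conjI bexI HOL.exI)
      show "sieve SC Y S"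
        unfolding sieve_def
      proof (intro conjI ballI impI)
        show "S \<subseteq> {f \<in> carr SC. ccod SC f = Y}" by (auto simp: S_def)
        fix f g assume f: "f \<in> S" and g: "g \<in> carr SC" "ccod SC g = cdom SC f"
        then have f': "f \<in> carr SC" "fst (snd f) = Y" "fst (snd g) = fst f" by (auto simp: S_def)
        obtain R where R: "R \<in> {R1, R2}" "lies_in R (fst f) (pact line_sheaf f ?x)" using f by (auto simp: S_def)
        have xf: "?x \<in> pob line_sheaf (ccod SC f)" using x f' by simp
        have "pact line_sheaf f ?x \<in> pob line_sheaf (fst f)"
          using presheaf_act[OF line_presheaf f'(1) xf] by simp
        then have "lies_in R (fst g) (pact line_sheaf g (pact line_sheaf f ?x))"
          using lies_in_pact[OF g(1), of "pact line_sheaf f ?x" R] R f'(3) by simp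
        moreover have "pact line_sheaf (ccomp SC f g) ?x = pact line_sheaf g (pact line_sheaf f ?x)"
          using presheaf_comp[OF line_presheaf g(1) f'(1) g(2) xf] .
        ultimately show "ccomp SC f g \<in> S"
          using syn_comp[OF g(1) f'(1,3)] f' R unfolding S_def by auto
      qed
      \<comment> \<open>the index set of the cover has to be small; only two values of \<open>?F\<close> matter\<close>
      let ?F = "\<lambda>k. if k = code {} then i1 else i2"
      show "range code \<in> \<U>" by (rule code(2))
      show "\<forall>k\<in>range code. ?F k \<in> S" using i1 i2 by simp
      show "\<forall>A\<in>models \<U>. \<forall>y\<in>pts A Y. \<exists>k\<in>range code. \<exists>z\<in>pts A (fst (?F k)). ap A (?F k) z = y"
      proof (intro ballI)
        fix A y assume A: "A \<in> models \<U>" and y: "y \<in> pts A Y"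
        have "ap A t y \<in> tup A 1" using ap_pts[OF t(1) A] y t by (simp add: pts_line)
        then consider "R1 A (ap A t y)" | "R2 A (ap A t y)" using cover[OF A] by blast
        then show "\<exists>k\<in>range code. \<exists>z\<in>pts A (fst (?F k)). ap A (?F k) z = y"
        proof cases
          case 1
          then show ?thesis using i1(2) A y by (intro bexI[of _ "code {}"]) auto
        next
          case 2
          have "code {0} \<noteq> code {}" using code(1) by (simp add: inj_eq)
          then show ?thesis using 2 i2(2) A y by (intro bexI[of _ "code {0}"]) auto
        qed
      qed
    qed
    have loc: "pact W f (snd (snd u) Y s) = pact W f (snd (snd v) Y s)" if f: "f \<in> S" for f
    proof -
      have f': "f \<in> carr SC" "fst (snd f) = Y" using f by (auto simp: S_def)
      obtain R where R: "R = R1 \<or> R = R2" "lies_in R (fst f) (pact line_sheaf f ?x)" using f by (auto simp: S_def)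
      have sf: "s \<in> pob (fst a) (ccod SC f)" using s f' by simp
      have "pact line_sheaf f ?x = snd (snd a) (fst f) (pact (fst a) f s)"
        using nat_trans_natural[OF a_facts(3) f'(1) sf] f' by simp
      then have "snd (snd u) (fst f) (pact (fst a) f s) = snd (snd v) (fst f) (pact (fst a) f s)"
        using R presheaf_act[OF a_facts(1) f'(1) sf] arr_ob[OF f'(1)] by (intro eq'[of _ _ R]) (auto simp: cobj_SC)
      then show ?thesis
        using nat_trans_natural[OF u'(2) f'(1) sf] nat_trans_natural[OF v'(2) f'(1) sf] f' by simp
    qed
    have W: "presheaf \<U> SC W" using u'(1) by (simp add: carr_presheaf_cat W_def)
    have us: "snd (snd u) Y s \<in> pob W Y" and vs: "snd (snd v) Y s \<in> pob W Y"
      using nat_trans_closed[OF u'(2) Y s] nat_trans_closed[OF v'(2) Y s] by auto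
    have "\<exists>!z. z \<in> pob W Y \<and> (\<forall>f\<in>S. pact W f z = pact W f (snd (snd u) Y s))"
    proof (rule u'(3)[unfolded sheaf_def, rule_format, OF Y S], intro conjI ballI impI)
      fix f assume f: "f \<in> S"
      then have f': "f \<in> carr SC" "ccod SC f = Y" by (auto simp: S_def)
      show "pact W f (snd (snd u) Y s) \<in> pob W (cdom SC f)"
        using presheaf_act[OF W f'(1)] us f' by simp
      fix g assume g: "g \<in> carr SC" "ccod SC g = cdom SC f"
      show "pact W (ccomp SC f g) (snd (snd u) Y s) = pact W g (pact W f (snd (snd u) Y s))"
        using presheaf_comp[OF W g(1) f'(1) g(2)] us f' by simp
    qed
    then show "snd (snd u) Y s = snd (snd v) Y s"
      using us vs loc by (metis (no_types, lifting))
  qed (use u v cod in auto)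
qed

text \<open>
  The inclusion of a subobject that has a section is the whole object.
\<close>

lemma irreducible_dichotomy:
  assumes irr: "irreducible_ob topos (fst a)"
    and dfn: "dfn 1 R1" "dfn 1 R2" and cover: "\<And>A x. A \<in> models \<U> \<Longrightarrow> x \<in> tup A 1 \<Longrightarrow> R1 A x \<or> R2 A x"
  shows "\<exists>R\<in>{R1, R2}. \<forall>Y\<in>cobj SC. \<forall>s\<in>pob (fst a) Y. lies_in R Y (snd (snd a) Y s)"
proof -
  obtain f \<sigma> where f: "f \<in> {incl R1, incl R2}" and s: "\<sigma> \<in> carr topos" "cdom topos \<sigma> = fst a"
    "ccod topos \<sigma> = cdom topos f" "ccomp topos f \<sigma> = cid topos (fst a)"
    using irr incl_jointly_epic[OF dfn cover] unfolding irreducible_ob_def by blast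
  obtain R where R: "R \<in> {R1, R2}" "f = incl R" using f by blast
  have n: "nat_trans SC (fst a) (restrict_psh a R) (snd (snd \<sigma>))"
    using s R by (simp add: carr_sheaf_cat carr_presheaf_cat incl_def)
  have "lies_in R Y (snd (snd a) Y x)" if Y: "Y \<in> cobj SC" and x: "x \<in> pob (fst a) Y" for Y x
  proof -
    have r: "snd (snd \<sigma>) Y x \<in> pob (restrict_psh a R) Y" using nat_trans_closed[OF n Y x] .
    have "snd (snd (ccomp topos f \<sigma>)) Y x = snd (snd (cid topos (fst a))) Y x" using s by simp
    then have "snd (snd \<sigma>) Y x = x"
      using Y x r s(2) R by (simp add: ccomp_presheaf_cat cid_presheaf_cat incl_def)
    then show ?thesis using r by simp
  qed
  then show ?thesis using R by blast
qed

end

end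

section \<open>Local MV-algebras of finite rank from homomorphisms\<close>

text \<open>
  The map \<open>h\<close> plays the role of the quotient map onto \<open>S_n\<close>.  The last clause makes its kernel the unique
  maximal ideal: an ideal with an element outside the kernel contains a multiple of it that is \<open>1\<close>.
\<close>

definition rank_hom :: "'a mv \<Rightarrow> nat \<Rightarrow> ('a \<Rightarrow> nat) \<Rightarrow> bool" where
  "rank_hom A n h \<longleftrightarrow> mv_algebra A \<and> n \<ge> 1 \<and> h ` mcarrier A = {0..n} \<and> h (mzero A) = 0 \<and>
     (\<forall>x\<in>mcarrier A. h (mneg A x) = n - h x) \<and>
     (\<forall>x\<in>mcarrier A. \<forall>y\<in>mcarrier A. h (mplus A x y) = min (h x + h y) n) \<and>
     (\<forall>x\<in>mcarrier A. h x > 0 \<longrightarrow> (\<exists>k\<ge>1. mmult A k x = mone A))"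

lemma mmult_closed: "mv_algebra A \<Longrightarrow> x \<in> mcarrier A \<Longrightarrow> mmult A k x \<in> mcarrier A"
  by (induction k) (auto simp: mv_algebra_def)

context
  fixes A :: "'a mv" and n h assumes rh: "rank_hom A n h"
begin

lemma rh_alg: "mv_algebra A" and rh_n: "n \<ge> 1" and rh_img: "h ` mcarrier A = {0..n}" and rh_zero: "h (mzero A) = 0"
  and rh_neg: "x \<in> mcarrier A \<Longrightarrow> h (mneg A x) = n - h x"
  and rh_plus: "x \<in> mcarrier A \<Longrightarrow> y \<in> mcarrier A \<Longrightarrow> h (mplus A x y) = min (h x + h y) n"
  and rh_mult: "x \<in> mcarrier A \<Longrightarrow> h x > 0 \<Longrightarrow> \<exists>k\<ge>1. mmult A k x = mone A"
  using rh by (auto simp: rank_hom_def)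

lemma rh_closed [simp]: "mzero A \<in> mcarrier A" "x \<in> mcarrier A \<Longrightarrow> mneg A x \<in> mcarrier A"
  "x \<in> mcarrier A \<Longrightarrow> y \<in> mcarrier A \<Longrightarrow> mplus A x y \<in> mcarrier A" "mone A \<in> mcarrier A"
  using rh_alg by (auto simp: mv_algebra_def mone_def)

lemma rh_le: "x \<in> mcarrier A \<Longrightarrow> h x \<le> n"
  using rh_img by auto

lemma rh_one: "h (mone A) = n"
  by (simp add: mone_def rh_neg rh_zero)

lemma rh_local: "mv_local A"
  unfolding mv_local_def
proof (intro conjI ballI)
  show "mzero A \<noteq> mone A" using rh_one rh_zero rh_n by auto
  fix x assume x: "x \<in> mcarrier A"
  show "\<exists>k\<ge>1. mmult A k x = mone A \<or> mmult A k (mneg A x) = mone A"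
  proof (cases "h x > 0")
    case False
    then have "h (mneg A x) > 0" using x rh_neg rh_n by simp
    then show ?thesis using rh_mult[of "mneg A x"] x by auto
  qed (use rh_mult x in blast)
qed (rule rh_alg)

lemma rh_kernel_ideal: "mv_ideal A {x \<in> mcarrier A. h x = 0}"
  unfolding mv_ideal_def
proof (intro conjI ballI impI)
  fix x y assume x: "x \<in> {x \<in> mcarrier A. h x = 0}" and y: "y \<in> mcarrier A" and le: "mle A y x"
  have "h (mplus A (mneg A y) x) = n" using le rh_one by (simp add: mle_def)
  then have "h y = 0" using x y rh_le[OF y] rh_n by (simp add: rh_plus rh_neg)
  then show "y \<in> {x \<in> mcarrier A. h x = 0}" using y by simp
qed (auto simp: rh_zero rh_plus)

lemma rh_proper_ideal:
  assumes J: "mv_ideal A J" "J \<noteq> mcarrier A"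
  shows "J \<subseteq> {x \<in> mcarrier A. h x = 0}"
proof (rule ccontr)
  assume "\<not> ?thesis"
  then obtain x where x: "x \<in> J" "h x > 0" "x \<in> mcarrier A" using J by (auto simp: mv_ideal_def)
  then obtain k where k: "mmult A k x = mone A" using rh_mult by blast
  have "mmult A k x \<in> J" for k
    using J(1) x by (induction k) (auto simp: mv_ideal_def)
  then have one: "mone A \<in> J" using k by metis
  have "mle A y (mone A)" if "y \<in> mcarrier A" for y
    using rh_alg that by (auto simp: mle_def mone_def mv_algebra_def)
  then have "mcarrier A \<subseteq> J" using J(1) one by (auto simp: mv_ideal_def)
  then show False using J by (auto simp: mv_ideal_def)
qed

lemma rh_radical: "mv_radical A = {x \<in> mcarrier A. h x = 0}"
proof -
  let ?I = "{x \<in> mcarrier A. h x = 0}"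
  have ne: "?I \<noteq> mcarrier A" 
  proof -
    have "mone A \<notin> ?I" using rh_one rh_n by simp
    then show ?thesis using rh_closed(4) by blast
  qed
  have "mv_maximal_ideal A J \<longleftrightarrow> J = ?I" for J
  proof
    assume "mv_maximal_ideal A J"
    then show "J = ?I"
      using rh_kernel_ideal ne rh_proper_ideal[of J] unfolding mv_maximal_ideal_def by metis
  next
    assume "J = ?I"
    then show "mv_maximal_ideal A J"
      using rh_kernel_ideal ne rh_proper_ideal unfolding mv_maximal_ideal_def by (metis subset_antisym)
  qed
  then show ?thesis by (auto simp: mv_radical_def)
qed

lemma rh_cong: "mv_cong A (mv_radical A) `` {x} = {y \<in> mcarrier A. h y = h x}" if x: "x \<in> mcarrier A"
proof -
  have "h (mplus A (mneg A (mplus A (mneg A x) y)) (mneg A (mplus A (mneg A y) x))) = 0 \<longleftrightarrow> h y = h x"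
    if y: "y \<in> mcarrier A" for y
    using x y rh_le[OF x] rh_le[OF y] rh_n by (simp add: rh_plus rh_neg) linarith
  then show ?thesis using x by (auto simp: mv_cong_def rh_radical)
qed

lemma rh_rank: "mv_local_of_rank A n"
proof -
  let ?c = "\<lambda>x. {y \<in> mcarrier A. h y = h x}"
  let ?Q = "mv_quotient A (mv_radical A)"
  define g where "g X = the_elem (h ` X)" for X
  have img: "h ` ?c x = {h x}" if "x \<in> mcarrier A" for x using that by auto
  have g: "g (?c x) = h x" if "x \<in> mcarrier A" for x unfolding g_def img[OF that] by simp
  have carrier: "mcarrier ?Q = ?c ` mcarrier A"
    using rh_cong by (auto simp: mv_quotient_def quotient_def)
  have zero: "mzero ?Q = ?c (mzero A)" using rh_cong[of "mzero A"] by (simp add: mv_quotient_def)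
  have neg: "mneg ?Q (?c x) = ?c (mneg A x)" if x: "x \<in> mcarrier A" for x
  proof -
    have "mneg ?Q (?c x) = (\<Union>y\<in>?c x. ?c (mneg A y))" by (simp add: mv_quotient_def rh_cong)
    also have "\<dots> = (\<Union>y\<in>?c x. ?c (mneg A x))" using x by (intro SUP_cong) (auto simp: rh_neg)
    finally show ?thesis using x by blast
  qed
  have plus: "mplus ?Q (?c x) (?c y) = ?c (mplus A x y)" if x: "x \<in> mcarrier A" and y: "y \<in> mcarrier A" for x y
  proof -
    have "mplus ?Q (?c x) (?c y) = (\<Union>a\<in>?c x. \<Union>b\<in>?c y. ?c (mplus A a b))" by (simp add: mv_quotient_def rh_cong)
    also have "\<dots> = (\<Union>a\<in>?c x. \<Union>b\<in>?c y. ?c (mplus A x y))" using x y by (intro SUP_cong) (auto simp: rh_plus)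
    finally show ?thesis using x y by blast
  qed
  have "bij_betw g (mcarrier ?Q) (mcarrier (mv_S n))"
    unfolding bij_betw_def
  proof
    show "inj_on g (mcarrier ?Q)" unfolding carrier by (auto simp: inj_on_def g)
    have "g ` mcarrier ?Q = h ` mcarrier A" unfolding carrier image_image using g by (intro image_cong) auto
    then show "g ` mcarrier ?Q = mcarrier (mv_S n)" by (simp add: rh_img mv_S_def)
  qed
  moreover have "g (mzero ?Q) = mzero (mv_S n)" using g[of "mzero A"] by (simp add: zero rh_zero mv_S_def)
  moreover have "g (mneg ?Q X) = mneg (mv_S n) (g X)" if "X \<in> mcarrier ?Q" for X
  proof -
    obtain x where x: "x \<in> mcarrier A" "X = ?c x" using \<open>X \<in> mcarrier ?Q\<close> unfolding carrier by blast
    show ?thesis unfolding x(2) neg[OF x(1)] g[OF x(1)] g[OF rh_closed(2)[OF x(1)]]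
      using x(1) by (simp add: rh_neg mv_S_def)
  qed
  moreover have "g (mplus ?Q X Y) = mplus (mv_S n) (g X) (g Y)" if "X \<in> mcarrier ?Q" "Y \<in> mcarrier ?Q" for X Y
  proof -
    obtain x y where x: "x \<in> mcarrier A" "X = ?c x" "y \<in> mcarrier A" "Y = ?c y" using \<open>X \<in> mcarrier ?Q\<close> \<open>Y \<in> mcarrier ?Q\<close> unfolding carrier by blast
    show ?thesis unfolding x(2,4) plus[OF x(1,3)] g[OF x(1)] g[OF x(3)] g[OF rh_closed(3)[OF x(1,3)]]
      using x(1,3) by (simp add: rh_plus mv_S_def)
  qed
  ultimately have "mv_isomorphic ?Q (mv_S n)" unfolding mv_isomorphic_def by blast
  then show ?thesis using rh_local rh_n by (simp add: mv_local_of_rank_def)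
qed

end

section \<open>Copies of an algebra\<close>

definition copy :: "('a \<Rightarrow> 'b) \<Rightarrow> 'a mv \<Rightarrow> 'b mv" where
  "copy j A = \<lparr>mcarrier = j ` mcarrier A, mplus = (\<lambda>x y. j (mplus A (inv j x) (inv j y))),
     mneg = (\<lambda>x. j (mneg A (inv j x))), mzero = j (mzero A)\<rparr>"

context
  fixes j :: "'a \<Rightarrow> 'b" and A :: "'a mv" assumes j: "inj j"
begin

lemma copy_simps [simp]: "mcarrier (copy j A) = j ` mcarrier A" "mplus (copy j A) (j x) (j y) = j (mplus A x y)"
  "mneg (copy j A) (j x) = j (mneg A x)" "mzero (copy j A) = j (mzero A)" "mone (copy j A) = j (mone A)"
  by (simp_all add: copy_def j mone_def)

lemma mmult_copy: "mmult (copy j A) k (j x) = j (mmult A k x)"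
  by (induction k) simp_all

lemma teval_copy: "teval (copy j A) (\<lambda>i. j (e i)) t = j (teval A e t)"
  by (induction t) simp_all

lemma fsat_copy: "fsat (copy j A) \<phi> (\<lambda>i. j (e i)) \<longleftrightarrow> fsat A \<phi> e"
proof (induction \<phi> arbitrary: e)
  case (FEq s t)
  then show ?case by (simp add: teval_copy inj_eq[OF j])
next
  case (FEx \<phi>)
  have "case_nat (j a) (\<lambda>i. j (e i)) = (\<lambda>i. j (case_nat a e i))" for a
    by (rule ext) (auto split: nat.split)
  then show ?case using FEx.IH by simp
qed auto

lemma mv_algebra_copy: "mv_algebra (copy j A) \<longleftrightarrow> mv_algebra A"
  unfolding mv_algebra_def
  by (simp only: copy_simps ball_simps inj_eq[OF j] inj_image_mem_iff[OF j])

lemma rank_hom_copy: "rank_hom A n h \<Longrightarrow> rank_hom (copy j A) n (\<lambda>x. h (inv j x))"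
  unfolding rank_hom_def by (simp add: mv_algebra_copy mmult_copy image_image inv_f_f[OF j] inj_eq[OF j])

lemma sat_copy:
  assumes "fwf \<U> \<phi> n" "length cs = n"
  shows "sat (copy j A) \<phi> (map j cs) \<longleftrightarrow> sat A \<phi> cs"
proof -
  have "sat (copy j A) \<phi> (map j cs) \<longleftrightarrow> fsat (copy j A) \<phi> (\<lambda>i. j (cs ! i))"
    using assms by (intro fsat_cong) auto
  then show ?thesis by (simp add: fsat_copy)
qed

end

section \<open>Chang's algebra as a limit of the finite chains\<close>

text \<open>
  The pair \<open>(False, k)\<close> stands for \<open>k\<epsilon>\<close> and \<open>(True, k)\<close> for \<open>1 - k\<epsilon>\<close>, where \<open>\<epsilon>\<close> is a positive infinitesimal.
  Truncated subtraction in the mixed sums is the truncation of sums at \<open>1\<close>.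
\<close>

definition chang :: "(bool \<times> nat) mv" where
  "chang = \<lparr>mcarrier = UNIV,
     mplus = (\<lambda>(a, k) (b, l). if a then (if b then (True, 0) else (True, k - l))
                              else (if b then (True, l - k) else (False, k + l))),
     mneg = (\<lambda>(a, k). (\<not> a, k)), mzero = (False, 0)\<rparr>"

lemma rank_hom_chang: "rank_hom chang 1 (\<lambda>x. if fst x then 1 else 0)"
proof -
  have "mv_algebra chang"
    unfolding mv_algebra_def chang_def by (auto split: if_splits)
  moreover have "(\<lambda>x :: bool \<times> nat. if fst x then 1 else (0 :: nat)) ` UNIV = {0..1}"
    by (auto simp: image_iff le_Suc_eq)
  moreover have "mmult chang 2 x = mone chang" if "fst x" for x
    using that by (cases x) (simp add: numeral_2_eq_2 chang_def mone_def)
  then have "\<exists>k\<ge>1. mmult chang k x = mone chang" if "fst x" for x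
    using that by (intro HOL.exI[of _ 2]) auto
  ultimately show ?thesis
    unfolding rank_hom_def by (auto simp: chang_def)
qed

lemma mmult_mv_S: "x \<le> n \<Longrightarrow> mmult (mv_S n) k x = min (k * x) n"
  by (induction k) (auto simp: mv_S_def)

lemma rank_hom_mv_S: "n \<ge> 1 \<Longrightarrow> rank_hom (mv_S n) n (\<lambda>x. x)"
proof -
  assume n: "n \<ge> 1"
  have "mv_algebra (mv_S n)"
    unfolding mv_algebra_def mv_S_def by auto
  moreover have "mmult (mv_S n) n x = mone (mv_S n)" if "x \<le> n" "x > 0" for x
    using that by (simp add: mmult_mv_S) (simp add: mone_def mv_S_def)
  ultimately show ?thesis
    using n unfolding rank_hom_def by (auto simp: mv_S_def)
qed

lemma mmult_chang: "mmult chang k (False, l) = (False, k * l)"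
  by (induction k) (simp_all add: chang_def)

text \<open>
  The substitution of \<open>1/N\<close> for \<open>\<epsilon>\<close>; the element \<open>1/N\<close> of the chain is the number \<open>1\<close> of \<open>mv_S N\<close>.  This is not a
  homomorphism, but it respects any given sum as soon as \<open>N\<close> is large enough.
\<close>

definition trunc :: "nat \<Rightarrow> bool \<times> nat \<Rightarrow> nat" where
  "trunc N = (\<lambda>(b, k). if b then N - k else min k N)"

lemma trunc_le: "trunc N x \<le> N"
  by (auto simp: trunc_def split: prod.split)

lemma teval_trunc: "eventually (\<lambda>N. teval (mv_S N) (\<lambda>i. trunc N (e i)) t = trunc N (teval chang e t)) sequentially"
proof (induction t)
  case (TPlus s t)
  obtain a k b l where st: "teval chang e s = (a, k)" "teval chang e t = (b, l)" by (metis surj_pair)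
  have "eventually (\<lambda>N. N \<ge> k + l) sequentially" by (rule eventually_ge_at_top)
  with TPlus show ?case
  proof eventually_elim
    case (elim N)
    then show ?case
      by (simp add: st) (auto simp: mv_S_def chang_def trunc_def)
  qed
next
  case (TNeg t)
  then show ?case
    by eventually_elim (auto simp: mv_S_def chang_def trunc_def split: prod.split)
qed (auto simp: mv_S_def chang_def trunc_def)

text \<open>
  The truth of a geometric formula at a point is witnessed by finitely many elements and equations once
  a disjunct is chosen, and each equation between terms survives truncation for all large \<open>N\<close>.
\<close>

lemma fsat_trunc: "fsat chang \<phi> e \<Longrightarrow> eventually (\<lambda>N. fsat (mv_S N) \<phi> (\<lambda>i. trunc N (e i))) sequentially"
proof (induction \<phi> arbitrary: e)
  case (FEq s t)
  show ?case using teval_trunc[of e s] teval_trunc[of e t]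
    by eventually_elim (use FEq in simp)
next
  case (FAnd \<phi> \<psi>)
  then show ?case by (simp add: eventually_conj)
next
  case (FEx \<phi>)
  then obtain x where "fsat chang \<phi> (case_nat x e)" by auto
  from FEx.IH[OF this] show ?case
  proof eventually_elim
    case (elim N)
    have "(\<lambda>i. trunc N (case_nat x e i)) = case_nat (trunc N x) (\<lambda>i. trunc N (e i))"
      by (rule ext) (auto split: nat.split)
    moreover have "trunc N x \<in> mcarrier (mv_S N)" using trunc_le by (simp add: mv_S_def)
    ultimately show ?case using elim by auto
  qed
next
  case (FOr K F)
  then obtain k where k: "k \<in> K" "fsat chang (F k) e" by auto
  from FOr.IH[OF _ k(2)] have "eventually (\<lambda>N. fsat (mv_S N) (F k) (\<lambda>i. trunc N (e i))) sequentially"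
    by blast
  then show ?case by eventually_elim (use k in auto)
qed auto

section \<open>The classifying topos is not a presheaf topos\<close>

context set_universe
begin

primrec tmult :: "nat \<Rightarrow> mv_term \<Rightarrow> mv_term" where
  "tmult 0 t = TZero"
| "tmult (Suc k) t = TPlus t (tmult k t)"

lemma teval_tmult: "teval A e (tmult k t) = mmult A k (teval A e t)"
  by (induction k) simp_all

lemma twf_tmult: "twf n t \<Longrightarrow> twf n (tmult k t)"
  by (induction k) simp_all

lemma dfn_multiple:
  assumes "twf n t"
  shows "dfn n (\<lambda>A x. \<exists>k. mmult A k (teval A ((!) x) t) = mone A)"
proof -
  define f :: "nat \<Rightarrow> 'u" where "f k = code {k}" for k
  have f: "inj f" by (rule injI) (simp add: f_def inj_eq[OF code(1)])
  have "dfn n (\<lambda>A x. \<exists>c\<in>range f. mmult A (inv f c) (teval A ((!) x) t) = mone A)"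
  proof (rule dfn_or)
    show "range f \<in> \<U>" unfolding f_def by (rule small_code_image)
    show "dfn n (\<lambda>A x. mmult A (inv f c) (teval A ((!) x) t) = mone A)" for c
      using assms by (intro dfnI[of "FEq (tmult (inv f c) t) (TNeg TZero)"]) (auto simp: twf_tmult teval_tmult mone_def)
  qed
  then show ?thesis by (rule dfn_cong) (auto simp: inv_f_f[OF f])
qed

definition embed :: "'a :: countable \<Rightarrow> 'u" where
  "embed x = code {to_nat x}"

lemma inj_embed: "inj embed"
  by (rule injI) (simp add: embed_def inj_eq[OF code(1)])

lemma copy_models: "rank_hom A n h \<Longrightarrow> copy embed A \<in> models \<U>"
proof -
  assume "rank_hom A n h"
  then have "mv_local_of_finite_rank (copy embed A)"
    using rh_rank[OF rank_hom_copy[OF inj_embed]] unfolding mv_local_of_finite_rank_def by blast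
  moreover have "embed ` mcarrier A \<in> \<U>" unfolding embed_def by (rule small_code_image)
  ultimately show ?thesis by (simp add: models_def inj_embed)
qed

lemma not_presheaf_type: "\<not> of_presheaf_type \<U> (FinRank \<U>)"
proof
  assume "of_presheaf_type \<U> (FinRank \<U>)"
  then obtain D :: "('u, 'u) cat" where D: "category D" "carr D \<in> \<U>"
    and eqv: "equivalent_cats topos (presheaf_cat \<U> D)"
    by (auto simp: of_presheaf_type_def classifying_topos_def)
  obtain Fo Fa Go Ga where "cat_equiv topos (presheaf_cat \<U> D) Fo Fa Go Ga"
    using equivalent_cats_cat_equiv[OF eqv topos_category presheaf_cat_category[OF D(1)]] by blast
  then interpret cat_equiv topos "presheaf_cat \<U> D" Fo Fa Go Ga .
  interpret sym: cat_equiv "presheaf_cat \<U> D" topos Go Ga Fo Fa by (rule cat_equiv_sym)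
  define Q where "Q = Fo line_sheaf"
  have Q: "presheaf \<U> D Q" using F_obj[OF line_topos] by (simp add: Q_def)
  \<comment> \<open>a jointly epic family of arrows from irreducible objects to the underlying object\<close>
  define cov where "cov = (\<lambda>f. ccomp topos (counit line_sheaf) (Ga f)) `
     {psh_arr D (hom_psh D d) Q (\<lambda>X f. pact Q f x) | d x. d \<in> cobj D \<and> x \<in> pob Q d}"
  have je: "jointly_epic topos line_sheaf cov"
    unfolding cov_def Q_def
    by (rule jointly_epic_transport[OF line_topos elements_jointly_epic[OF D Q[unfolded Q_def]]])
  define C where "C = (copy embed chang :: 'u mv)"
  define eps :: 'u where "eps = embed (False, 1 :: nat)"
  have C: "C \<in> models \<U>" unfolding C_def by (rule copy_models[OF rank_hom_chang])
  have "countable (mcarrier C)" "eps \<in> mcarrier C"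
    by (auto simp: C_def inj_embed eps_def chang_def)
  then obtain a Y s y where a: "a \<in> cov" and Y: "ob Y" and s: "s \<in> pob (fst a) Y"
    and y: "y \<in> pts C Y" "ap C (decode Y (snd (snd a) Y s)) y = [eps]"
    using jointly_epic_hits[OF je _ C] by blast
  have a': "a \<in> carr topos" "fst (snd a) = line_sheaf" using je a by (auto simp: jointly_epic_def)
  obtain d x where d: "d \<in> cobj D" "x \<in> pob Q d"
    and ad: "a = ccomp topos (counit line_sheaf) (Ga (psh_arr D (hom_psh D d) Q (\<lambda>X f. pact Q f x)))"
    using a unfolding cov_def by blast
  have "psh_arr D (hom_psh D d) Q (\<lambda>X f. pact Q f x) \<in> carr (presheaf_cat \<U> D)"
    using elements_jointly_epic[OF D Q] d unfolding jointly_epic_def by blast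
  from sym.F_arr(2)[OF this] have "fst a = Go (hom_psh D d)"
    by (simp add: ad ccomp_presheaf_cat)
  then have irr: "irreducible_ob topos (fst a)"
    using irreducible_transport[of "hom_psh D d"] hom_irreducible[OF D d(1)] presheaf_hom[OF D] by simp
  define t where "t = decode Y (snd (snd a) Y s)"
  have "nat_trans SC (fst a) line_sheaf (snd (snd a))"
    using a' by (auto simp: carr_sheaf_cat carr_presheaf_cat)
  from nat_trans_closed[OF this _ s] have "snd (snd a) Y s \<in> pob line_sheaf Y" using Y by (simp add: cobj_SC)
  then have t: "t \<in> carr SC" "fst t = Y" "fst (snd t) = line"
    using decode_funs(1) by (auto simp: t_def funs_def)
  have "(y, [eps]) \<in> gr C t" using gr_iff[OF t(1) C] y t by (simp add: t_def)
  then obtain \<theta> where th: "\<theta> \<in> snd (snd t)" "sat C \<theta> ([eps] @ y)" by (auto simp: gr_def)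
  have wf: "fwf \<U> \<theta> (1 + fst Y)"
    using t th(1) by (auto simp: carr_SC syn_arr_def line_def fclass_def)
  define cs where "cs = map (inv (embed :: bool \<times> nat \<Rightarrow> 'u)) y"
  have len: "length cs = fst Y" using pts_tup[OF y(1)] by (simp add: cs_def tup_def)
  have "y = map embed cs"
  proof -
    have "set y \<subseteq> range (embed :: bool \<times> nat \<Rightarrow> 'u)"
      using pts_tup[OF y(1)] by (simp add: tup_def C_def inj_embed chang_def)
    then have "map (\<lambda>u. embed (inv (embed :: bool \<times> nat \<Rightarrow> 'u) u)) y = y"
      by (intro map_idI) (auto simp: f_inv_into_f)
    then show ?thesis by (simp add: cs_def comp_def)
  qed
  then have "sat C \<theta> (map embed ((False, 1) # cs))" using th(2) by (simp add: eps_def)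
  then have "sat chang \<theta> ((False, 1) # cs)"
    unfolding C_def by (subst (asm) sat_copy[OF inj_embed wf]) (simp_all add: len)
  \<comment> \<open>the graph of \<open>t\<close> contains a pair over \<open>\<epsilon>\<close>, hence also one over \<open>1/N\<close> for all large \<open>N\<close>\<close>
  from eventually_conj[OF eventually_ge_at_top[of 1] fsat_trunc[OF this]]
  obtain N where N: "N \<ge> 1" "fsat (mv_S N) \<theta> (\<lambda>i. trunc N (((False, 1) # cs) ! i))"
    unfolding eventually_sequentially by blast
  define S where "S = (copy embed (mv_S N) :: 'u mv)"
  have S: "S \<in> models \<U>" unfolding S_def by (rule copy_models[OF rank_hom_mv_S[OF N(1)]])
  define z where "z = map (\<lambda>c. embed (trunc N c) :: 'u) cs"
  have "sat (mv_S N) \<theta> (1 # map (trunc N) cs)"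
  proof -
    have "fsat (mv_S N) \<theta> (\<lambda>i. trunc N (((False, 1) # cs) ! i)) = sat (mv_S N) \<theta> (1 # map (trunc N) cs)"
      using len N(1) by (intro fsat_cong[OF wf]) (auto simp: nth_Cons trunc_def split: nat.split)
    then show ?thesis using N by simp
  qed
  then have "sat S \<theta> (map embed (1 # map (trunc N) cs))"
    unfolding S_def by (subst sat_copy[OF inj_embed wf]) (simp_all add: len)
  then have "sat S \<theta> ([embed (1::nat)] @ z)" by (simp add: z_def comp_def)
  moreover have "[embed (1::nat)] \<in> tup S 1" "z \<in> tup S (fst Y)"
    using N(1) len trunc_le by (auto simp: tup_def S_def inj_embed mv_S_def z_def)
  ultimately have "(z, [embed (1::nat)]) \<in> gr S t"
    using th(1) t by (auto simp: gr_def line_def)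
  then have z: "z \<in> pts S Y" "ap S t z = [embed (1::nat)]" using gr_iff[OF t(1) S] t by auto
  \<comment> \<open>two cases of locality for \<open>N x\<close>: the first fails at \<open>\<epsilon>\<close>, the second at \<open>1/N\<close>\<close>
  define R1 :: "'u mv \<Rightarrow> 'u list \<Rightarrow> bool" where "R1 = (\<lambda>A x. \<exists>k. mmult A k (teval A ((!) x) (tmult N (TVar 0))) = mone A)"
  define R2 :: "'u mv \<Rightarrow> 'u list \<Rightarrow> bool" where "R2 = (\<lambda>A x. \<exists>k. mmult A k (teval A ((!) x) (TNeg (tmult N (TVar 0)))) = mone A)"
  have "\<exists>R\<in>{R1, R2}. \<forall>Y\<in>cobj SC. \<forall>s\<in>pob (fst a) Y. lies_in R Y (snd (snd a) Y s)"
  proof (rule irreducible_dichotomy[OF a' irr])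
    show "dfn 1 R1" unfolding R1_def by (rule dfn_multiple) (simp add: twf_tmult)
    show "dfn 1 R2" unfolding R2_def by (rule dfn_multiple) (simp add: twf_tmult)
    fix A x assume A: "A \<in> models \<U>" and x: "x \<in> tup A 1"
    have "mmult A N (x ! 0) \<in> mcarrier A"
      using models_mv_algebra[OF A] tup_nth[OF x] by (intro mmult_closed) auto
    then have "\<exists>k\<ge>1. mmult A k (mmult A N (x ! 0)) = mone A \<or> mmult A k (mneg A (mmult A N (x ! 0))) = mone A"
      using A by (auto simp: models_def mv_local_of_finite_rank_def mv_local_of_rank_def mv_local_def)
    then show "R1 A x \<or> R2 A x" by (auto simp: R1_def R2_def teval_tmult)
  qed
  then have "lies_in R1 Y (snd (snd a) Y s) \<or> lies_in R2 Y (snd (snd a) Y s)"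
    using Y s by (auto simp: cobj_SC)
  then show False
  proof
    assume "lies_in R1 Y (snd (snd a) Y s)"
    then have "R1 C (ap C t y)" using C y(1) unfolding lies_in_def t_def by blast
    then have "R1 C [eps]" using y(2) by (simp add: t_def)
    then obtain k where "mmult C k (mmult C N eps) = mone C" by (auto simp: R1_def teval_tmult)
    then have "(embed (False, k * N) :: 'u) = embed (True, 0::nat)"
      by (simp add: C_def eps_def mmult_copy[OF inj_embed] mmult_chang inj_embed) (simp add: mone_def chang_def)
    then show False by (simp add: inj_eq[OF inj_embed])
  next
    assume "lies_in R2 Y (snd (snd a) Y s)"
    then have "R2 S (ap S t z)" using S z(1) unfolding lies_in_def t_def by blast
    then have "R2 S [embed (1::nat)]" using z(2) by simp
    then obtain k where "mmult S k (mneg S (mmult S N (embed (1::nat)))) = mone S" by (auto simp: R2_def teval_tmult)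
    moreover have "mneg (mv_S N) N = 0" "mone (mv_S N) = N" by (simp_all add: mv_S_def mone_def)
    ultimately have "(embed (0::nat) :: 'u) = embed N"
      using N(1) by (simp add: S_def mmult_copy[OF inj_embed] mmult_mv_S inj_embed)
    then show False using N(1) by (simp add: inj_eq[OF inj_embed])
  qed
qed

end

theorem mainTheorem13:
  fixes \<U> :: "'u set set"
  assumes "set_universe \<U>"
  shows "\<not> of_presheaf_type \<U> (FinRank \<U>)"
  using assms by (rule set_universe.not_presheaf_type)

end
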